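(* If $A$ is a simply connected finite dimensional algebra over an algebraically closed field $k$ (of any characteristic), then the Lie algebra $\mathrm{HH}^1(A)$ is nilpotent.
   Context: $\mathrm{HH}^1(A)=\mathrm{Der}(A)/\mathrm{Inn}(A)$ is the Lie algebra of $k$-linear derivations of $A$ (bracket $[f,g]=f\circ g-g\circ f$) modulo inner derivations. The algebra $A$ is triangular if its Gabriel quiver $Q$ has no oriented cycles. $A$ is simply connected if it is triangular and, for every admissible quiver presentation $A\cong kQ/I$, the fundamental group $\pi_1(Q,I)$ is trivial. Fundamental group. A minimal relation in $I$ is a nonzero element $r=\sum_{i=1}^s a_ip_i\in I$, with $p_i$ distinct paths and $a_i\in k\smallsetminus\{0\}$, such that $\sum_{i\in T}a_ip_i\notin I$ for every proper nonempty $T\subset\{1,\dots,s\}$. A walk in $Q$ is an oriented path in the quiver obtained from $Q$ by adding a formal inverse arrow $\alpha^{-1}$ for each arrow $\alpha$. The homotopy relation $\sim_I$ is the equivalence relation on walks generated by: (1) $\alpha^{-1}\alpha\sim_I e_i$ and $\alpha\alpha^{-1}\sim_I e_j$ for any arrow $\alpha$ from vertex $i$ to vertex $j$ ($e_i$ the trivial walk at $i$); (2) if $v\sim_I v'$ then $wvu\sim_I wv'u$ whenever these concatenations are defined; (3) $u\sim_I v$ if $u,v$ are paths occurring with nonzero coefficient in the same minimal relation. If $Q$ is connected, $\pi_1(Q,I)$ is the group of $\sim_I$-classes of closed walks at a fixed vertex under concatenation (independent of the vertex up to isomorphism). If $Q$ is not connected, $\pi_1(Q,I)$ is the direct product of the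 fundamental groups of the connected components.
   Formalization: "Simply connected" here also requires that A has at least one admissible quiver presentation (so A is basic); otherwise the condition is vacuous for non-basic triangular algebras and the claim fails, e.g. for 2×2 matrices over the Kronecker algebra. *)

theory Defs
  imports
    "HOL-Library.Poly_Mapping"
    "HOL-Computational_Algebra.Polynomial"
    "HOL-Algebra.QuotRing"
    "HOL-Algebra.Product_Groups"
    "Graph_Theory.Arc_Walk"
begin

section \<open>Quivers and path algebras\<close>

text \<open>
  A quiver is a \<^typ>\<open>('v, 'e) pre_digraph\<close> (multiple arcs and loops allowed).  A path is a pair of
  its source and the list of its arrows in the order of traversal; \<open>(v, [])\<close> is the trivial path
  at \<open>v\<close>.  Products of paths are read from right to left: \<open>p q\<close> is ``first \<open>q\<close>, then \<open>p\<close>''.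
\<close>

type_synonym ('v, 'e) qpath = "'v \<times> 'e list"

definition psource :: "('v, 'e) qpath \<Rightarrow> 'v"
  where "psource p = fst p"

definition ptarget :: "('v, 'e) pre_digraph \<Rightarrow> ('v, 'e) qpath \<Rightarrow> 'v"
  where "ptarget Q p = pre_digraph.awlast Q (fst p) (snd p)"

definition paths :: "('v, 'e) pre_digraph \<Rightarrow> ('v, 'e) qpath set"
  where "paths Q = {p. pre_digraph.awalk Q (psource p) (snd p) (ptarget Q p)}"

definition pcomp :: "('v, 'e) qpath \<Rightarrow> ('v, 'e) qpath \<Rightarrow> ('v, 'e) qpath"
  where "pcomp p q = (fst q, snd q @ snd p)"

definition acyclic_quiver :: "('v, 'e) pre_digraph \<Rightarrow> bool"
  where "acyclic_quiver Q \<longleftrightarrow> \<not> (\<exists>u p. p \<noteq> [] \<and> pre_digraph.awalk Q u p u)"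

definition path_mult ::
    "('v, 'e) pre_digraph \<Rightarrow> (('v, 'e) qpath \<Rightarrow>\<^sub>0 'k::field) \<Rightarrow> (('v, 'e) qpath \<Rightarrow>\<^sub>0 'k)
      \<Rightarrow> (('v, 'e) qpath \<Rightarrow>\<^sub>0 'k)"
  where "path_mult Q x y =
    (\<Sum>p\<in>Poly_Mapping.keys x. \<Sum>q\<in>Poly_Mapping.keys y.
       if ptarget Q q = psource p
       then Poly_Mapping.single (pcomp p q) (Poly_Mapping.lookup x p * Poly_Mapping.lookup y q)
       else 0)"

definition path_algebra :: "('v, 'e) pre_digraph \<Rightarrow> (('v, 'e) qpath \<Rightarrow>\<^sub>0 'k::field) ring"
  where "path_algebra Q =
    \<lparr> carrier = {x. Poly_Mapping.keys x \<subseteq> paths Q},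
      monoid.mult = path_mult Q,
      one = (\<Sum>v\<in>verts Q. Poly_Mapping.single (v, []) 1),
      zero = 0,
      add = (+) \<rparr>"

text \<open>The \<open>m\<close>-th power of the two-sided ideal generated by the arrows.\<close>

definition arrow_ideal_power ::
    "('v, 'e) pre_digraph \<Rightarrow> nat \<Rightarrow> (('v, 'e) qpath \<Rightarrow>\<^sub>0 'k::field) set"
  where "arrow_ideal_power Q m =
    {x \<in> carrier (path_algebra Q). \<forall>p\<in>Poly_Mapping.keys x. m \<le> length (snd p)}"

definition admissible_ideal ::
    "('v, 'e) pre_digraph \<Rightarrow> (('v, 'e) qpath \<Rightarrow>\<^sub>0 'k::field) set \<Rightarrow> bool"
  where "admissible_ideal Q I \<longleftrightarrow>
    ideal I (path_algebra Q) \<and>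
    I \<subseteq> arrow_ideal_power Q 2 \<and>
    (\<exists>m\<ge>2. arrow_ideal_power Q m \<subseteq> I)"

section \<open>The fundamental group of a quiver with relations\<close>

definition minimal_relation ::
    "(('v, 'e) qpath \<Rightarrow>\<^sub>0 'k::field) set \<Rightarrow> (('v, 'e) qpath \<Rightarrow>\<^sub>0 'k) \<Rightarrow> bool"
  where "minimal_relation I r \<longleftrightarrow>
    r \<in> I \<and> r \<noteq> 0 \<and>
    (\<forall>T. T \<noteq> {} \<and> T \<subset> Poly_Mapping.keys r \<longrightarrow>
       (\<Sum>p\<in>T. Poly_Mapping.single p (Poly_Mapping.lookup r p)) \<notin> I)"

text \<open>Adding formal inverses: \<open>(a, True)\<close> is the arrow \<open>a\<close> and \<open>(a, False)\<close> its inverse.\<close>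

definition double_quiver :: "('v, 'e) pre_digraph \<Rightarrow> ('v, 'e \<times> bool) pre_digraph"
  where "double_quiver Q =
    \<lparr> verts = verts Q,
      arcs = arcs Q \<times> UNIV,
      tail = (\<lambda>(a, s). if s then tail Q a else head Q a),
      head = (\<lambda>(a, s). if s then head Q a else tail Q a) \<rparr>"

abbreviation walks :: "('v, 'e) pre_digraph \<Rightarrow> ('v, 'e \<times> bool) qpath set"
  where "walks Q \<equiv> paths (double_quiver Q)"

definition walk_of_path :: "('v, 'e) qpath \<Rightarrow> ('v, 'e \<times> bool) qpath"
  where "walk_of_path p = (fst p, map (\<lambda>a. (a, True)) (snd p))"

inductive homotopic ::
    "('v, 'e) pre_digraph \<Rightarrow> (('v, 'e) qpath \<Rightarrow>\<^sub>0 'k::field) set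
      \<Rightarrow> ('v, 'e \<times> bool) qpath \<Rightarrow> ('v, 'e \<times> bool) qpath \<Rightarrow> bool"
  for Q I
  where
    refl: "w \<in> walks Q \<Longrightarrow> homotopic Q I w w"
  | sym: "homotopic Q I v w \<Longrightarrow> homotopic Q I w v"
  | trans: "homotopic Q I u v \<Longrightarrow> homotopic Q I v w \<Longrightarrow> homotopic Q I u w"
  | inv_left: "a \<in> arcs Q \<Longrightarrow>
      homotopic Q I (tail Q a, [(a, True), (a, False)]) (tail Q a, [])"
  | inv_right: "a \<in> arcs Q \<Longrightarrow>
      homotopic Q I (head Q a, [(a, False), (a, True)]) (head Q a, [])"
  | cong: "homotopic Q I v v' \<Longrightarrow> u \<in> walks Q \<Longrightarrow> w \<in> walks Q \<Longrightarrow>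
      ptarget (double_quiver Q) u = psource v \<Longrightarrow> ptarget (double_quiver Q) v = psource w \<Longrightarrow>
      ptarget (double_quiver Q) u = psource v' \<Longrightarrow> ptarget (double_quiver Q) v' = psource w \<Longrightarrow>
      homotopic Q I (pcomp w (pcomp v u)) (pcomp w (pcomp v' u))"
  | rel: "minimal_relation I r \<Longrightarrow> p \<in> Poly_Mapping.keys r \<Longrightarrow> q \<in> Poly_Mapping.keys r \<Longrightarrow>
      homotopic Q I (walk_of_path p) (walk_of_path q)"

definition homotopy_class ::
    "('v, 'e) pre_digraph \<Rightarrow> (('v, 'e) qpath \<Rightarrow>\<^sub>0 'k::field) set
      \<Rightarrow> ('v, 'e \<times> bool) qpath \<Rightarrow> ('v, 'e \<times> bool) qpath set"
  where "homotopy_class Q I w = {w'. homotopic Q I w w'}"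

definition loops :: "('v, 'e) pre_digraph \<Rightarrow> 'v \<Rightarrow> ('v, 'e \<times> bool) qpath set"
  where "loops Q x = {w \<in> walks Q. psource w = x \<and> ptarget (double_quiver Q) w = x}"

definition fundamental_group_at ::
    "('v, 'e) pre_digraph \<Rightarrow> (('v, 'e) qpath \<Rightarrow>\<^sub>0 'k::field) set \<Rightarrow> 'v
      \<Rightarrow> ('v, 'e \<times> bool) qpath set monoid"
  where "fundamental_group_at Q I x =
    \<lparr> carrier = homotopy_class Q I ` loops Q x,
      monoid.mult = (\<lambda>X Y. \<Union>v\<in>X. \<Union>w\<in>Y. homotopy_class Q I (pcomp v w)),
      one = homotopy_class Q I (x, []) \<rparr>"

definition components :: "('v, 'e) pre_digraph \<Rightarrow> 'v set set"
  where "components Q =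
    verts Q // {(u, v). \<exists>w\<in>walks Q. psource w = u \<and> ptarget (double_quiver Q) w = v}"

text \<open>
  The direct product over all connected components, with an arbitrary base point chosen in each.
\<close>

definition fundamental_group ::
    "('v, 'e) pre_digraph \<Rightarrow> (('v, 'e) qpath \<Rightarrow>\<^sub>0 'k::field) set
      \<Rightarrow> ('v set \<Rightarrow> ('v, 'e \<times> bool) qpath set) monoid"
  where "fundamental_group Q I =
    product_group (components Q) (\<lambda>C. fundamental_group_at Q I (SOME x. x \<in> C))"

section \<open>Lie algebras\<close>

record ('k, 'l) lie_alg =
  lie_carrier :: "'l set"
  lie_zero :: 'l
  lie_add :: "'l \<Rightarrow> 'l \<Rightarrow> 'l"
  lie_scale :: "'k \<Rightarrow> 'l \<Rightarrow> 'l"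
  lie_bracket :: "'l \<Rightarrow> 'l \<Rightarrow> 'l"

locale lie_algebra =
  fixes L :: "('k::field, 'l) lie_alg"
  assumes zero_closed: "lie_zero L \<in> lie_carrier L"
    and add_closed: "\<lbrakk>x \<in> lie_carrier L; y \<in> lie_carrier L\<rbrakk> \<Longrightarrow> lie_add L x y \<in> lie_carrier L"
    and scale_closed: "x \<in> lie_carrier L \<Longrightarrow> lie_scale L c x \<in> lie_carrier L"
    and bracket_closed:
      "\<lbrakk>x \<in> lie_carrier L; y \<in> lie_carrier L\<rbrakk> \<Longrightarrow> lie_bracket L x y \<in> lie_carrier L"
    and add_assoc: "\<lbrakk>x \<in> lie_carrier L; y \<in> lie_carrier L; z \<in> lie_carrier L\<rbrakk>
      \<Longrightarrow> lie_add L (lie_add L x y) z = lie_add L x (lie_add L y z)"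
    and add_commute:
      "\<lbrakk>x \<in> lie_carrier L; y \<in> lie_carrier L\<rbrakk> \<Longrightarrow> lie_add L x y = lie_add L y x"
    and add_zero: "x \<in> lie_carrier L \<Longrightarrow> lie_add L (lie_zero L) x = x"
    and add_inverse: "x \<in> lie_carrier L \<Longrightarrow> lie_add L (lie_scale L (-1) x) x = lie_zero L"
    and scale_add_right: "\<lbrakk>x \<in> lie_carrier L; y \<in> lie_carrier L\<rbrakk>
      \<Longrightarrow> lie_scale L c (lie_add L x y) = lie_add L (lie_scale L c x) (lie_scale L c y)"
    and scale_add_left: "x \<in> lie_carrier L
      \<Longrightarrow> lie_scale L (c + d) x = lie_add L (lie_scale L c x) (lie_scale L d x)"
    and scale_scale: "x \<in> lie_carrier L \<Longrightarrow> lie_scale L c (lie_scale L d x) = lie_scale L (c * d) x"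
    and scale_one: "x \<in> lie_carrier L \<Longrightarrow> lie_scale L 1 x = x"
    and bracket_add_left: "\<lbrakk>x \<in> lie_carrier L; y \<in> lie_carrier L; z \<in> lie_carrier L\<rbrakk>
      \<Longrightarrow> lie_bracket L (lie_add L x y) z = lie_add L (lie_bracket L x z) (lie_bracket L y z)"
    and bracket_add_right: "\<lbrakk>x \<in> lie_carrier L; y \<in> lie_carrier L; z \<in> lie_carrier L\<rbrakk>
      \<Longrightarrow> lie_bracket L x (lie_add L y z) = lie_add L (lie_bracket L x y) (lie_bracket L x z)"
    and bracket_scale_left: "\<lbrakk>x \<in> lie_carrier L; y \<in> lie_carrier L\<rbrakk>
      \<Longrightarrow> lie_bracket L (lie_scale L c x) y = lie_scale L c (lie_bracket L x y)"
    and bracket_scale_right: "\<lbrakk>x \<in> lie_carrier L; y \<in> lie_carrier L\<rbrakk>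
      \<Longrightarrow> lie_bracket L x (lie_scale L c y) = lie_scale L c (lie_bracket L x y)"
    and bracket_self: "x \<in> lie_carrier L \<Longrightarrow> lie_bracket L x x = lie_zero L"
    and jacobi: "\<lbrakk>x \<in> lie_carrier L; y \<in> lie_carrier L; z \<in> lie_carrier L\<rbrakk>
      \<Longrightarrow> lie_add L (lie_bracket L x (lie_bracket L y z))
            (lie_add L (lie_bracket L y (lie_bracket L z x)) (lie_bracket L z (lie_bracket L x y)))
          = lie_zero L"

inductive_set lie_span :: "('k, 'l) lie_alg \<Rightarrow> 'l set \<Rightarrow> 'l set"
  for L S
  where
    zero: "lie_zero L \<in> lie_span L S"
  | base: "x \<in> S \<Longrightarrow> x \<in> lie_span L S"
  | add: "x \<in> lie_span L S \<Longrightarrow> y \<in> lie_span L S \<Longrightarrow> lie_add L x y \<in> lie_span L S"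
  | scale: "x \<in> lie_span L S \<Longrightarrow> lie_scale L c x \<in> lie_span L S"

primrec lower_central_series :: "('k, 'l) lie_alg \<Rightarrow> nat \<Rightarrow> 'l set"
  where
    "lower_central_series L 0 = lie_carrier L"
  | "lower_central_series L (Suc n) =
      lie_span L {lie_bracket L x y |x y. x \<in> lie_carrier L \<and> y \<in> lower_central_series L n}"

definition nilpotent_lie_algebra :: "('k::field, 'l) lie_alg \<Rightarrow> bool"
  where "nilpotent_lie_algebra L \<longleftrightarrow>
    lie_algebra L \<and> (\<exists>n. lower_central_series L n = {lie_zero L})"

section \<open>Algebras\<close>

text \<open>
  The sort \<open>{ring, monoid_mult}\<close> is that of unital associative rings; unlike \<open>ring_1\<close> it does not
  impose \<open>0 \<noteq> 1\<close>.
\<close>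

definition type_ring :: "'a::{ring, monoid_mult} ring"
  where "type_ring = \<lparr> carrier = UNIV, monoid.mult = (*), one = 1, zero = 0, add = (+) \<rparr>"

definition left_ideal :: "'a::{ring, monoid_mult} set \<Rightarrow> bool"
  where "left_ideal J \<longleftrightarrow>
    0 \<in> J \<and> (\<forall>x\<in>J. \<forall>y\<in>J. x + y \<in> J) \<and> (\<forall>a. \<forall>x\<in>J. a * x \<in> J)"

definition maximal_left_ideal :: "'a::{ring, monoid_mult} set \<Rightarrow> bool"
  where "maximal_left_ideal J \<longleftrightarrow>
    left_ideal J \<and> J \<noteq> UNIV \<and> (\<forall>K. left_ideal K \<and> J \<subseteq> K \<longrightarrow> K = J \<or> K = UNIV)"

definition jacobson_radical :: "'a::{ring, monoid_mult} set"
  where "jacobson_radical = \<Inter>{J. maximal_left_ideal J}"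

definition primitive_idempotent :: "'a::{ring, monoid_mult} \<Rightarrow> bool"
  where "primitive_idempotent e \<longleftrightarrow>
    e * e = e \<and> e \<noteq> 0 \<and>
    \<not> (\<exists>f g. f \<noteq> 0 \<and> g \<noteq> 0 \<and> f * f = f \<and> g * g = g \<and> f * g = 0 \<and> g * f = 0 \<and> e = f + g)"

text \<open>Equivalently, the projective left modules \<open>A e\<close> and \<open>A f\<close> are isomorphic.\<close>

definition equivalent_idempotents :: "'a::{ring, monoid_mult} \<Rightarrow> 'a \<Rightarrow> bool"
  where "equivalent_idempotents e f \<longleftrightarrow>
    (\<exists>a b. a = e * a * f \<and> b = f * b * e \<and> a * b = e \<and> b * a = f)"

locale algebra_over = vector_space scale
  for scale :: "'k::field \<Rightarrow> 'a::{ring, monoid_mult} \<Rightarrow> 'a" +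
  assumes scale_mult_left: "scale c x * y = scale c (x * y)"
    and scale_mult_right: "x * scale c y = scale c (x * y)"
begin

definition radical_square :: "'a set"
  where "radical_square = span {x * y |x y. x \<in> jacobson_radical \<and> y \<in> jacobson_radical}"

text \<open>
  The vertices \<open>v\<close> label representatives \<open>e v\<close> of the isomorphism classes of indecomposable
  projective modules; the number of arrows from \<open>u\<close> to \<open>v\<close> is the dimension of
  \<open>e\<^sub>v (rad A / rad\<^sup>2 A) e\<^sub>u\<close>, which is the quotient of \<open>e\<^sub>v (rad A) e\<^sub>u\<close> by its subspace
  \<open>e\<^sub>v (rad\<^sup>2 A) e\<^sub>u\<close>.
\<close>

definition gabriel_quiver :: "('v, 'e) pre_digraph \<Rightarrow> bool"
  where "gabriel_quiver Q \<longleftrightarrow>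
    fin_digraph Q \<and>
    (\<exists>e :: 'v \<Rightarrow> 'a.
      (\<forall>v\<in>verts Q. primitive_idempotent (e v)) \<and>
      (\<forall>f. primitive_idempotent f \<longrightarrow> (\<exists>!v. v \<in> verts Q \<and> equivalent_idempotents f (e v))) \<and>
      (\<forall>u\<in>verts Q. \<forall>v\<in>verts Q.
        card {a \<in> arcs Q. tail Q a = u \<and> head Q a = v} =
          dim ((\<lambda>x. e v * x * e u) ` jacobson_radical) - dim ((\<lambda>x. e v * x * e u) ` radical_square)))"

text \<open>
  Every finite quiver is isomorphic to one whose vertices and arrows are natural numbers, so
  quantifying over \<^typ>\<open>(nat, nat) pre_digraph\<close> covers all finite quivers.
\<close>

definition triangular :: bool
  where "triangular \<longleftrightarrow> (\<exists>Q :: (nat, nat) pre_digraph. gabriel_quiver Q \<and> acyclic_quiver Q)"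

text \<open>\<open>A \<cong> k Q / I\<close> as \<open>k\<close>-algebras, with \<open>Q\<close> finite and \<open>I\<close> admissible.\<close>

definition admissible_presentation ::
    "('v, 'e) pre_digraph \<Rightarrow> (('v, 'e) qpath \<Rightarrow>\<^sub>0 'k) set \<Rightarrow> bool"
  where "admissible_presentation Q I \<longleftrightarrow>
    fin_digraph Q \<and> admissible_ideal Q I \<and>
    (\<exists>\<phi> \<in> ring_iso (path_algebra Q Quot I) (type_ring :: 'a ring).
      \<forall>c. \<forall>x\<in>carrier (path_algebra Q).
        \<phi> (I +>\<^bsub>path_algebra Q\<^esub> Poly_Mapping.map ((*) c) x) =
          scale c (\<phi> (I +>\<^bsub>path_algebra Q\<^esub> x)))"

text \<open>
  An algebra without an admissible presentation (that is, a non-basic one) is not regarded as simply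
  connected.
\<close>

definition simply_connected :: bool
  where "simply_connected \<longleftrightarrow>
    triangular \<and>
    (\<exists>(Q :: (nat, nat) pre_digraph) I. admissible_presentation Q I) \<and>
    (\<forall>(Q :: (nat, nat) pre_digraph) I.
      admissible_presentation Q I \<longrightarrow> trivial_group (fundamental_group Q I))"

definition Der :: "('a \<Rightarrow> 'a) set"
  where "Der = {f. Vector_Spaces.linear scale scale f \<and> (\<forall>x y. f (x * y) = f x * y + x * f y)}"

definition Inn :: "('a \<Rightarrow> 'a) set"
  where "Inn = range (\<lambda>a x. a * x - x * a)"

definition outer_class :: "('a \<Rightarrow> 'a) \<Rightarrow> ('a \<Rightarrow> 'a) set"
  where "outer_class f = (\<lambda>d x. f x + d x) ` Inn"

definition HH1 :: "('k, ('a \<Rightarrow> 'a) set) lie_alg"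
  where "HH1 =
    \<lparr> lie_carrier = outer_class ` Der,
      lie_zero = Inn,
      lie_add = (\<lambda>X Y. \<Union>f\<in>X. \<Union>g\<in>Y. outer_class (\<lambda>x. f x + g x)),
      lie_scale = (\<lambda>c X. \<Union>f\<in>X. outer_class (\<lambda>x. scale c (f x))),
      lie_bracket = (\<lambda>X Y. \<Union>f\<in>X. \<Union>g\<in>Y. outer_class (\<lambda>x. f (g x) - g (f x))) \<rparr>"

end

locale fin_dim_algebra = algebra_over +
  assumes finite_dimensional: "\<exists>B. finite_dimensional_vector_space scale B"

section \<open>Well-definedness of the structures above\<close>

text \<open>
  The path algebra is a ring, the fundamental group is a group, and \<open>HH1\<close> is a Lie algebra.
\<close>

lemma ptarget_simps [simp]: "ptarget Q (v, []) = v" "ptarget Q (v, p @ [a]) = head Q a"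
  by (simp_all add: ptarget_def pre_digraph.awalk_verts_conv)

lemma ptarget_def': "ptarget Q (v, p) = (if p = [] then v else head Q (last p))"
  by (simp add: ptarget_def pre_digraph.awalk_verts_conv)

lemma psource_pcomp [simp]: "psource (pcomp p q) = psource q"
  by (simp add: pcomp_def psource_def)

lemma ptarget_pcomp: "ptarget Q q = psource p \<Longrightarrow> ptarget Q (pcomp p q) = ptarget Q p"
  by (cases p; cases q) (auto simp: ptarget_def' pcomp_def psource_def)

lemma pcomp_assoc: "pcomp (pcomp p q) r = pcomp p (pcomp q r)"
  by (simp add: pcomp_def)

lemma cas_append: "pre_digraph.cas Q u (p @ q) w \<longleftrightarrow>
  (\<exists>v. pre_digraph.cas Q u p v \<and> pre_digraph.cas Q v q w)"
  by (induction p arbitrary: u) (auto simp: pre_digraph.cas.simps)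

lemma cas_target: "pre_digraph.cas Q u p v \<Longrightarrow> v = ptarget Q (u, p)"
proof (induction p arbitrary: u)
  case (Cons a p)
  then show ?case
    by (cases p) (force simp: pre_digraph.cas.simps ptarget_def')+
qed (auto simp: pre_digraph.cas.simps ptarget_def')

lemma paths_iff: "p \<in> paths Q \<longleftrightarrow>
  fst p \<in> verts Q \<and> set (snd p) \<subseteq> arcs Q \<and> pre_digraph.cas Q (fst p) (snd p) (ptarget Q p)"
  by (simp add: paths_def pre_digraph.awalk_def psource_def)

lemma pcomp_paths: "p \<in> paths Q \<Longrightarrow> q \<in> paths Q \<Longrightarrow> ptarget Q q = psource p \<Longrightarrow> pcomp p q \<in> paths Q"
  by (simp add: paths_iff ptarget_pcomp) (auto simp: pcomp_def cas_append psource_def)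

lemma trivial_path [simp]: "(v, []) \<in> paths Q \<longleftrightarrow> v \<in> verts Q"
  by (auto simp: paths_iff pre_digraph.cas.simps)

lemma ptarget_vert: assumes "wf_digraph Q" "p \<in> paths Q" shows "ptarget Q p \<in> verts Q"
proof -
  interpret wf_digraph Q by fact
  show ?thesis using assms(2) last_in_set[of "snd p"] by (cases p) (fastforce simp: paths_iff ptarget_def')
qed

abbreviation path_mult_term where
  "path_mult_term Q p q a b \<equiv> (if ptarget Q q = psource p then Poly_Mapping.single (pcomp p q) (a * b) else 0)"

lemma path_mult_superset:
  assumes "finite S" "Poly_Mapping.keys x \<subseteq> S" "finite T" "Poly_Mapping.keys y \<subseteq> T"
  shows "path_mult Q x y = (\<Sum>p\<in>S. \<Sum>q\<in>T. path_mult_term Q p q (Poly_Mapping.lookup x p) (Poly_Mapping.lookup y q))"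
proof -
  have "(\<Sum>q\<in>Poly_Mapping.keys y. path_mult_term Q p q (Poly_Mapping.lookup x p) (Poly_Mapping.lookup y q))
     = (\<Sum>q\<in>T. path_mult_term Q p q (Poly_Mapping.lookup x p) (Poly_Mapping.lookup y q))" for p
    by (rule sum.mono_neutral_left) (use assms in \<open>auto simp: in_keys_iff\<close>)
  then show ?thesis unfolding path_mult_def
    by (simp only:) (rule sum.mono_neutral_left, use assms in \<open>auto simp: in_keys_iff intro!: sum.neutral\<close>)
qed

lemma path_mult_add_left: "path_mult Q (x + y) z = path_mult Q x z + path_mult Q y z"
proof -
  let ?S = "Poly_Mapping.keys x \<union> Poly_Mapping.keys y" and ?T = "Poly_Mapping.keys z"
  have *: "Poly_Mapping.keys (x + y) \<subseteq> ?S" by (rule Poly_Mapping.keys_add)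
  show ?thesis
    using * by (subst (1 2 3) path_mult_superset[of ?S _ ?T])
     (auto simp: sum.distrib[symmetric] lookup_add single_add distrib_right intro!: sum.cong)
qed

lemma path_mult_add_right: "path_mult Q z (x + y) = path_mult Q z x + path_mult Q z y"
proof -
  let ?S = "Poly_Mapping.keys x \<union> Poly_Mapping.keys y" and ?T = "Poly_Mapping.keys z"
  have *: "Poly_Mapping.keys (x + y) \<subseteq> ?S" by (rule Poly_Mapping.keys_add)
  show ?thesis
    using * by (subst (1 2 3) path_mult_superset[of ?T _ ?S])
     (auto simp: sum.distrib[symmetric] lookup_add single_add distrib_left intro!: sum.cong)
qed

lemma path_mult_zero [simp]: "path_mult Q 0 x = 0" "path_mult Q x 0 = 0"
  by (simp_all add: path_mult_def)

lemma path_mult_sum: "path_mult Q (sum f S) z = (\<Sum>s\<in>S. path_mult Q (f s) z)"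
  "path_mult Q z (sum f S) = (\<Sum>s\<in>S. path_mult Q z (f s))"
  by (induction S rule: infinite_finite_induct) (auto simp: path_mult_add_left path_mult_add_right)

lemma path_mult_single: "path_mult Q (Poly_Mapping.single p a) (Poly_Mapping.single q b) = path_mult_term Q p q a b"
  by (subst path_mult_superset[of "{p}" _ "{q}"]) auto

lemma sum_of_singles: "x = (\<Sum>p\<in>Poly_Mapping.keys x. Poly_Mapping.single p (Poly_Mapping.lookup x p))"
  by (rule poly_mapping_eqI) (simp add: lookup_sum lookup_single when_def in_keys_iff sum.delta)

lemma path_mult_assoc: "path_mult Q (path_mult Q x y) z = path_mult Q x (path_mult Q y z)"
proof -
  have 1: "path_mult Q (path_mult Q (Poly_Mapping.single p a) (Poly_Mapping.single q b)) (Poly_Mapping.single r c)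
    = path_mult Q (Poly_Mapping.single p a) (path_mult Q (Poly_Mapping.single q b) (Poly_Mapping.single r c))" for p q r a b c
    by (auto simp: path_mult_single ptarget_pcomp pcomp_assoc mult.assoc)
  show ?thesis
    by (subst (1 2) sum_of_singles[of x], subst (1 2) sum_of_singles[of y], subst (1 2) sum_of_singles[of z])
      (simp only: path_mult_sum 1)
qed

lemma keys_sum_subset:
  "(\<And>s. s \<in> S \<Longrightarrow> Poly_Mapping.keys (f s) \<subseteq> A) \<Longrightarrow> Poly_Mapping.keys (sum f S) \<subseteq> A"
  using Poly_Mapping.keys_sum[of f S] by blast

lemma path_mult_closed:
  assumes "Poly_Mapping.keys x \<subseteq> paths Q" "Poly_Mapping.keys y \<subseteq> paths Q"
  shows "Poly_Mapping.keys (path_mult Q x y) \<subseteq> paths Q"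
  unfolding path_mult_def using assms by (intro keys_sum_subset) (auto intro: pcomp_paths)

lemma path_mult_one:
  assumes "fin_digraph Q" "Poly_Mapping.keys x \<subseteq> paths Q"
  shows "path_mult Q (\<Sum>v\<in>verts Q. Poly_Mapping.single (v, []) 1) x = x"
    "path_mult Q x (\<Sum>v\<in>verts Q. Poly_Mapping.single (v, []) 1) = x"
proof -
  interpret fin_digraph Q by fact
  have 1: "(\<Sum>v\<in>verts Q. path_mult Q (Poly_Mapping.single (v, []) 1) (Poly_Mapping.single p a)) = Poly_Mapping.single p a"
    "(\<Sum>v\<in>verts Q. path_mult Q (Poly_Mapping.single p a) (Poly_Mapping.single (v, []) 1)) = Poly_Mapping.single p a"
    if "p \<in> paths Q" for p and a :: 'c
  proof -
    have "ptarget Q p \<in> verts Q" "psource p \<in> verts Q" using that ptarget_vert[OF wf_digraph_axioms that]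
      by (auto simp: paths_iff psource_def)
    then show "(\<Sum>v\<in>verts Q. path_mult Q (Poly_Mapping.single (v, []) 1) (Poly_Mapping.single p a)) = Poly_Mapping.single p a"
      "(\<Sum>v\<in>verts Q. path_mult Q (Poly_Mapping.single p a) (Poly_Mapping.single (v, []) 1)) = Poly_Mapping.single p a"
      by (auto simp: path_mult_single psource_def pcomp_def sum.delta sum.delta' cong: if_cong)
  qed
  have "path_mult Q (\<Sum>v\<in>verts Q. Poly_Mapping.single (v, []) 1) x = 
     (\<Sum>p\<in>Poly_Mapping.keys x. \<Sum>v\<in>verts Q. path_mult Q (Poly_Mapping.single (v, []) 1) (Poly_Mapping.single p (Poly_Mapping.lookup x p)))"
    by (subst sum_of_singles[of x]) (simp only: path_mult_sum; rule sum.swap)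
  also have "\<dots> = (\<Sum>p\<in>Poly_Mapping.keys x. Poly_Mapping.single p (Poly_Mapping.lookup x p))"
    by (rule sum.cong) (use 1 assms in auto)
  finally show "path_mult Q (\<Sum>v\<in>verts Q. Poly_Mapping.single (v, []) 1) x = x" using sum_of_singles by metis
  have "path_mult Q x (\<Sum>v\<in>verts Q. Poly_Mapping.single (v, []) 1) = 
     (\<Sum>p\<in>Poly_Mapping.keys x. \<Sum>v\<in>verts Q. path_mult Q (Poly_Mapping.single p (Poly_Mapping.lookup x p)) (Poly_Mapping.single (v, []) 1))"
    by (subst sum_of_singles[of x]) (simp only: path_mult_sum; rule sum.swap)
  also have "\<dots> = (\<Sum>p\<in>Poly_Mapping.keys x. Poly_Mapping.single p (Poly_Mapping.lookup x p))"
    by (rule sum.cong) (use 1 assms in auto)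
  finally show "path_mult Q x (\<Sum>v\<in>verts Q. Poly_Mapping.single (v, []) 1) = x" using sum_of_singles by metis
qed

lemma ring_path_algebra:
  assumes "fin_digraph Q"
  shows "ring (path_algebra Q :: (('v, 'e) qpath \<Rightarrow>\<^sub>0 'k::field) ring)"
proof (rule ringI)
  show "abelian_group (path_algebra Q :: (('v, 'e) qpath \<Rightarrow>\<^sub>0 'k::field) ring)"
  proof (rule abelian_groupI)
    fix x assume "x \<in> carrier (path_algebra Q :: (('v, 'e) qpath \<Rightarrow>\<^sub>0 'k::field) ring)"
    then show "\<exists>y\<in>carrier (path_algebra Q). y \<oplus>\<^bsub>path_algebra Q\<^esub> x = \<zero>\<^bsub>path_algebra Q\<^esub>"
      by (intro bexI[of _ "- x"]) (auto simp: path_algebra_def)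
  qed (use Poly_Mapping.keys_add in \<open>fastforce simp: path_algebra_def algebra_simps\<close>)+
  show "Group.monoid (path_algebra Q :: (('v, 'e) qpath \<Rightarrow>\<^sub>0 'k::field) ring)"
    by (rule monoidI) (auto simp: path_algebra_def path_mult_assoc path_mult_one[OF assms]
       dest: path_mult_closed[THEN subsetD, rotated 2] keys_sum[THEN subsetD])
qed (auto simp: path_algebra_def path_mult_add_left path_mult_add_right)


lemma minimal_relation_parallel:
  assumes Q: "fin_digraph Q" and I: "ideal I (path_algebra Q)" and r: "minimal_relation I r"
    and p: "p \<in> Poly_Mapping.keys r" and q: "q \<in> Poly_Mapping.keys r"
  shows "psource p = psource q \<and> ptarget Q p = ptarget Q q"
proof -
  interpret fin_digraph Q by fact
  interpret I: ideal I "path_algebra Q" by fact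
  have rI: "r \<in> I" using r by (simp add: minimal_relation_def)
  then have "r \<in> carrier (path_algebra Q)" using I.a_Hcarr by blast
  then have rp: "Poly_Mapping.keys r \<subseteq> paths Q" by (simp add: path_algebra_def)
  have vs: "psource p \<in> verts Q" "ptarget Q p \<in> verts Q"
    using p rp ptarget_vert[OF wf_digraph_axioms, of p] by (auto simp: paths_iff psource_def)
  let ?e = "\<lambda>v. Poly_Mapping.single (v, []) (1 :: 'c)"
  define T where "T = {q \<in> Poly_Mapping.keys r. psource q = psource p \<and> ptarget Q q = ptarget Q p}"
  have ec: "?e v \<in> carrier (path_algebra Q)" if "v \<in> verts Q" for v
    using that by (simp add: path_algebra_def)
  have "path_mult Q (?e (ptarget Q p)) (path_mult Q r (?e (psource p))) \<in> I"
    using I.I_l_closed[OF I.I_r_closed[OF rI ec[OF vs(1)]] ec[OF vs(2)]] by (simp add: path_algebra_def)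
  also have "path_mult Q (?e (ptarget Q p)) (path_mult Q r (?e (psource p))) =
     (\<Sum>q\<in>Poly_Mapping.keys r. path_mult Q (?e (ptarget Q p)) (path_mult Q (Poly_Mapping.single q (Poly_Mapping.lookup r q)) (?e (psource p))))"
    by (subst sum_of_singles[of r]) (simp only: path_mult_sum)
  also have "\<dots> = (\<Sum>q\<in>Poly_Mapping.keys r. if q \<in> T then Poly_Mapping.single q (Poly_Mapping.lookup r q) else 0)"
    by (rule sum.cong) (auto simp: T_def path_mult_single ptarget_pcomp, auto simp: pcomp_def psource_def)
  also have "\<dots> = (\<Sum>q\<in>T. Poly_Mapping.single q (Poly_Mapping.lookup r q))"
    by (rule sum.mono_neutral_cong_right) (auto simp: T_def)
  finally have "(\<Sum>q\<in>T. Poly_Mapping.single q (Poly_Mapping.lookup r q)) \<in> I" .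
  moreover have "T \<noteq> {}" "T \<subseteq> Poly_Mapping.keys r" using p unfolding T_def by blast+
  ultimately have "T = Poly_Mapping.keys r"
    using r unfolding minimal_relation_def by (metis psubsetI)
  then have "q \<in> T" using q by simp
  then show ?thesis by (simp add: T_def)
qed

lemma wf_double: "wf_digraph Q \<Longrightarrow> wf_digraph (double_quiver Q)"
  by (auto simp: double_quiver_def wf_digraph_def)

lemma walk_of_path_props:
  "psource (walk_of_path p) = psource p"
  "ptarget (double_quiver Q) (walk_of_path p) = ptarget Q p"
  "p \<in> paths Q \<Longrightarrow> walk_of_path p \<in> walks Q"
proof -
  show 1: "psource (walk_of_path p) = psource p" by (simp add: walk_of_path_def psource_def)
  show 2: "ptarget (double_quiver Q) (walk_of_path p) = ptarget Q p"
    by (cases p) (auto simp: walk_of_path_def ptarget_def' last_map double_quiver_def)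
  have 3: "pre_digraph.cas (double_quiver Q) u (map (\<lambda>a. (a, True)) p) v \<longleftrightarrow> pre_digraph.cas Q u p v" for u p v
    by (induction p arbitrary: u) (auto simp: pre_digraph.cas.simps double_quiver_def)
  show "p \<in> paths Q \<Longrightarrow> walk_of_path p \<in> walks Q"
    using 2 3 by (auto simp: paths_iff walk_of_path_def double_quiver_def)
qed

context
  fixes Q :: "('v, 'e) pre_digraph" and I :: "(('v, 'e) qpath \<Rightarrow>\<^sub>0 'k::field) set"
  assumes Q: "fin_digraph Q" and I: "ideal I (path_algebra Q)"
begin

abbreviation "walk_target \<equiv> ptarget (double_quiver Q)"

lemma homotopic_walks:
  "homotopic Q I v w \<Longrightarrow> v \<in> walks Q \<and> w \<in> walks Q \<and> psource v = psource w \<and> walk_target v = walk_target w"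
proof (induction rule: homotopic.induct)
  case (inv_left a)
  interpret fin_digraph Q by (rule Q)
  from inv_left show ?case by (auto simp: paths_iff psource_def ptarget_def' pre_digraph.cas.simps double_quiver_def)
next
  case (inv_right a)
  interpret fin_digraph Q by (rule Q)
  from inv_right show ?case by (auto simp: paths_iff psource_def ptarget_def' pre_digraph.cas.simps double_quiver_def)
next
  case (cong v v' u w)
  then show ?case by (auto intro!: pcomp_paths simp: ptarget_pcomp)
next
  case (rel r p q)
  interpret I: ideal I "path_algebra Q" by (rule I)
  have "r \<in> carrier (path_algebra Q)" using rel(1) I.a_Hcarr by (auto simp: minimal_relation_def)
  then have "Poly_Mapping.keys r \<subseteq> paths Q" by (simp add: path_algebra_def)
  then show ?case using minimal_relation_parallel[OF Q I rel] rel walk_of_path_props by (metis subsetD)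
qed auto

lemma class_eq: "homotopic Q I v w \<Longrightarrow> homotopy_class Q I v = homotopy_class Q I w"
  using homotopic.sym homotopic.trans unfolding homotopy_class_def by blast

lemma pcomp_homotopic:
  assumes "homotopic Q I v v'" "homotopic Q I w w'" "walk_target w = psource v"
  shows "homotopic Q I (pcomp v w) (pcomp v' w')"
proof -
  note W = homotopic_walks[OF assms(1)] homotopic_walks[OF assms(2)]
  interpret fin_digraph "Q" by (rule Q)
  have e: "(walk_target v, []) \<in> walks Q" "(psource w, []) \<in> walks Q"
    using W ptarget_vert[OF wf_double[OF wf_digraph_axioms]] by (auto simp: psource_def) (auto simp: paths_iff)
  have "homotopic Q I (pcomp (walk_target v, []) (pcomp v w)) (pcomp (walk_target v, []) (pcomp v' w))"
    by (rule homotopic.cong) (use assms W e in \<open>auto simp: psource_def\<close>)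
  moreover have "homotopic Q I (pcomp v' (pcomp w (psource w, []))) (pcomp v' (pcomp w' (psource w, [])))"
    by (rule homotopic.cong) (use assms W e in \<open>auto simp: psource_def\<close>)
  ultimately show ?thesis using W by (auto simp: pcomp_def psource_def intro: homotopic.trans)
qed

lemma mult_class:
  assumes "v \<in> loops Q x" "w \<in> loops Q x"
  shows "homotopy_class Q I v \<otimes>\<^bsub>fundamental_group_at Q I x\<^esub> homotopy_class Q I w = homotopy_class Q I (pcomp v w)"
proof -
  have "homotopy_class Q I (pcomp v' w') = homotopy_class Q I (pcomp v w)"
    if "v' \<in> homotopy_class Q I v" "w' \<in> homotopy_class Q I w" for v' w'
    using that pcomp_homotopic[of v v' w w'] assms class_eq by (auto simp: loops_def homotopy_class_def)
  moreover have "v \<in> homotopy_class Q I v" "w \<in> homotopy_class Q I w"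
    using assms by (auto simp: homotopy_class_def loops_def intro: homotopic.refl)
  ultimately show ?thesis unfolding fundamental_group_at_def monoid.simps by blast
qed

abbreviation "reverse_walk \<equiv> map (\<lambda>(a, s). (a, \<not> s)) \<circ> rev"

lemma bar_walk: "(x, p) \<in> walks Q \<Longrightarrow> (walk_target (x, p), reverse_walk p) \<in> walks Q \<and> walk_target (walk_target (x, p), reverse_walk p) = x
   \<and> homotopic Q I (x, p @ reverse_walk p) (x, [])"
proof (induction p rule: rev_induct)
  case Nil then show ?case by (auto intro: homotopic.refl)
next
  case (snoc a p)
  interpret D: wf_digraph "double_quiver Q" using Q wf_double fin_digraph_def by blast
  obtain e s where a: "a = (e, s)" by (cases a)
  have e: "e \<in> arcs Q" using snoc.prems by (auto simp: paths_iff a double_quiver_def)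
  have p: "(x, p) \<in> walks Q" and t: "walk_target (x, p) = tail (double_quiver Q) a"
    using snoc.prems cas_target[of "double_quiver Q" x p]
    by (auto simp: paths_iff cas_append pre_digraph.cas.simps)
  note IH = snoc.IH[OF p]
  have 1: "tail (double_quiver Q) (e, \<not> s) = head (double_quiver Q) (e, s)"
    "head (double_quiver Q) (e, \<not> s) = tail (double_quiver Q) (e, s)" by (auto simp: double_quiver_def)
  have A: "(head (double_quiver Q) a, [(e, \<not> s)]) \<in> walks Q"
    using snoc.prems e 1 D.head_in_verts[of a]
    by (auto simp: a paths_iff pre_digraph.cas.simps ptarget_def') (auto simp: double_quiver_def)
  have B: "(walk_target (x, p @ [a]), reverse_walk (p @ [a])) = pcomp (walk_target (x, p), reverse_walk p) (head (double_quiver Q) a, [(e, \<not> s)])"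
    by (simp add: pcomp_def a)
  have C: "walk_target (head (double_quiver Q) a, [(e, \<not> s)]) = psource (walk_target (x, p), reverse_walk p)"
    using t 1 by (simp add: psource_def ptarget_def' a)
  have H: "homotopic Q I (tail (double_quiver Q) a, [a, (e, \<not> s)]) (tail (double_quiver Q) a, [])"
    using homotopic.inv_left[OF e, of I] homotopic.inv_right[OF e, of I] by (cases s) (auto simp: a double_quiver_def)
  have "homotopic Q I
     (pcomp (walk_target (x, p), reverse_walk p) (pcomp (tail (double_quiver Q) a, [a, (e, \<not> s)]) (x, p)))
     (pcomp (walk_target (x, p), reverse_walk p) (pcomp (tail (double_quiver Q) a, []) (x, p)))"
    by (rule homotopic.cong[OF H]) (use p IH t 1 in \<open>auto simp: psource_def ptarget_def' a\<close>)
  then have "homotopic Q I (x, (p @ [a]) @ reverse_walk (p @ [a])) (x, p @ reverse_walk p)"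
    by (simp add: pcomp_def a)
  with IH have "homotopic Q I (x, (p @ [a]) @ reverse_walk (p @ [a])) (x, [])" using homotopic.trans by blast
  moreover have "walk_target (walk_target (x, p @ [a]), reverse_walk (p @ [a])) = x"
    unfolding B using ptarget_pcomp[OF C] IH by simp
  ultimately show ?case unfolding B using pcomp_paths[OF _ A C] IH by simp
qed

lemma group_fundamental_group_at:
  assumes x: "x \<in> verts Q" shows "Group.group (fundamental_group_at Q I x)"
proof -
  have comp: "pcomp v w \<in> loops Q x" if "v \<in> loops Q x" "w \<in> loops Q x" for v w
    using that by (auto simp: loops_def ptarget_pcomp intro: pcomp_paths)
  have one: "(x, []) \<in> loops Q x" using x by (auto simp: loops_def psource_def double_quiver_def)
  have c: "carrier (fundamental_group_at Q I x) = homotopy_class Q I ` loops Q x"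
    and o: "\<one>\<^bsub>fundamental_group_at Q I x\<^esub> = homotopy_class Q I (x, [])" by (auto simp: fundamental_group_at_def)
  show ?thesis
  proof (rule groupI)
    fix X assume "X \<in> carrier (fundamental_group_at Q I x)"
    then obtain w where w: "w \<in> loops Q x" "X = homotopy_class Q I w" by (auto simp: c)
    have "w = (x, snd w)" using w by (cases w) (auto simp: loops_def psource_def)
    with bar_walk[of x "snd w"] w have "(x, reverse_walk (snd w)) \<in> loops Q x" "homotopic Q I (x, snd w @ reverse_walk (snd w)) (x, [])"
      by (auto simp: loops_def psource_def)
    moreover from this have "homotopy_class Q I (pcomp (x, reverse_walk (snd w)) w) = homotopy_class Q I (x, [])"
    proof -
      have "fst w = x" using \<open>w = (x, snd w)\<close> by (metis fst_conv)
      then have "pcomp (x, reverse_walk (snd w)) w = (x, snd w @ reverse_walk (snd w))" by (simp add: pcomp_def)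
      then show ?thesis using class_eq[OF \<open>homotopic Q I (x, snd w @ reverse_walk (snd w)) (x, [])\<close>] by simp
    qed
    ultimately show "\<exists>Y\<in>carrier (fundamental_group_at Q I x). Y \<otimes>\<^bsub>fundamental_group_at Q I x\<^esub> X = \<one>\<^bsub>fundamental_group_at Q I x\<^esub>"
      using mult_class w by (auto simp: c o)
  next
    fix X assume "X \<in> carrier (fundamental_group_at Q I x)"
    then obtain w where w: "w \<in> loops Q x" "X = homotopy_class Q I w" by (auto simp: c)
    then show "\<one>\<^bsub>fundamental_group_at Q I x\<^esub> \<otimes>\<^bsub>fundamental_group_at Q I x\<^esub> X = X"
      using mult_class[OF one w(1)] by (simp add: o pcomp_def)
  qed (use comp one in \<open>auto simp: c o mult_class pcomp_assoc\<close>)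
qed

lemma group_fundamental_group: "Group.group (fundamental_group Q I)"
  unfolding fundamental_group_def
proof (rule product_group)
  fix C assume C: "C \<in> components Q"
  interpret fin_digraph Q by (rule Q)
  have "C \<noteq> {} \<and> C \<subseteq> verts Q" 
  proof -
    from C obtain u where u: "u \<in> verts Q" "C = {v. \<exists>w\<in>walks Q. psource w = u \<and> ptarget (double_quiver Q) w = v}"
      by (auto simp: components_def quotient_def)
    have "(u, []) \<in> walks Q" using u by (simp add: double_quiver_def)
    then have "u \<in> C" using u by (auto simp: psource_def intro!: bexI[of _ "(u, [])"])
    then show ?thesis using u ptarget_vert[OF wf_double[OF wf_digraph_axioms]] by (auto simp: double_quiver_def)
  qed
  then show "Group.group (fundamental_group_at Q I (SOME x. x \<in> C))"
    using group_fundamental_group_at someI_ex[of "\<lambda>x. x \<in> C"] by blast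
qed

end

context algebra_over
begin

lemma linear_iff: "Vector_Spaces.linear scale scale f \<longleftrightarrow>
  (\<forall>x y. f (x + y) = f x + f y) \<and> (\<forall>c x. f (scale c x) = scale c (f x))"
  using vector_space_axioms
  by (auto simp: Vector_Spaces.linear_def module_hom_def module_hom_axioms_def
      vector_space_def module_def)

lemma DerI:
  assumes "\<And>x y. f (x + y) = f x + f y" "\<And>c x. f (scale c x) = scale c (f x)"
    "\<And>x y. f (x * y) = f x * y + x * f y"
  shows "f \<in> Der"
  using assms by (simp add: Der_def linear_iff)

lemma DerD:
  assumes "f \<in> Der"
  shows "f (x + y) = f x + f y" "f (scale c x) = scale c (f x)" "f (x * y) = f x * y + x * f y"
    "f (x - y) = f x - f y" "f 0 = 0" "f (- x) = - f x"
proof -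
  show a: "f (x + y) = f x + f y" for x y
    using assms by (auto simp: Der_def linear_iff)
  show "f (scale c x) = scale c (f x)" "f (x * y) = f x * y + x * f y"
    using assms by (auto simp: Der_def linear_iff)
  show "f (x - y) = f x - f y" using a[of "x - y" y] by (simp add: algebra_simps)
  show z: "f 0 = 0" using a[of 0 0] by simp
  show "f (- x) = - f x" using a[of x "- x"] z by (metis add.right_inverse neg_eq_iff_add_eq_0)
qed

lemma Inn_subset_Der: "Inn \<subseteq> Der"
  by (auto simp: Inn_def intro!: DerI)
     (simp_all add: algebra_simps scale_mult_left scale_mult_right)

lemma Der_zero: "(\<lambda>x. 0) \<in> Der" by (rule DerI) auto

lemma Der_add: "f \<in> Der \<Longrightarrow> g \<in> Der \<Longrightarrow> (\<lambda>x. f x + g x) \<in> Der"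
  by (rule DerI) (auto simp: DerD algebra_simps)

lemma Der_scale: "f \<in> Der \<Longrightarrow> (\<lambda>x. scale c (f x)) \<in> Der"
  by (rule DerI) (auto simp: DerD scale_right_distrib scale_mult_left scale_mult_right mult.commute)

lemma Der_bracket: "f \<in> Der \<Longrightarrow> g \<in> Der \<Longrightarrow> (\<lambda>x. f (g x) - g (f x)) \<in> Der"
  by (rule DerI) (auto simp: DerD algebra_simps scale_right_diff_distrib)

lemma Inn_zero: "(\<lambda>x. 0) \<in> Inn" unfolding Inn_def by (rule range_eqI[of _ _ 0]) auto

lemma Inn_add: "f \<in> Inn \<Longrightarrow> g \<in> Inn \<Longrightarrow> (\<lambda>x. f x + g x) \<in> Inn"
proof -
  assume "f \<in> Inn" "g \<in> Inn"
  then obtain a b where "f = (\<lambda>x. a * x - x * a)" "g = (\<lambda>x. b * x - x * b)"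
    by (auto simp: Inn_def)
  then have "(\<lambda>x. f x + g x) = (\<lambda>x. (a + b) * x - x * (a + b))" by (auto simp: algebra_simps)
  then show ?thesis unfolding Inn_def by (rule range_eqI)
qed

lemma Inn_scale: "f \<in> Inn \<Longrightarrow> (\<lambda>x. scale c (f x)) \<in> Inn"
proof -
  assume "f \<in> Inn"
  then obtain a where "f = (\<lambda>x. a * x - x * a)" by (auto simp: Inn_def)
  then have "(\<lambda>x. scale c (f x)) = (\<lambda>x. scale c a * x - x * scale c a)"
    by (auto simp: scale_right_diff_distrib scale_mult_left scale_mult_right)
  then show ?thesis unfolding Inn_def by (rule range_eqI)
qed

lemma Inn_minus: "f \<in> Inn \<Longrightarrow> (\<lambda>x. - f x) \<in> Inn"
  using Inn_scale[of f "-1"] by simp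

lemma Inn_bracket: "f \<in> Inn \<Longrightarrow> g \<in> Der \<Longrightarrow> (\<lambda>x. g (f x) - f (g x)) \<in> Inn"
proof -
  assume f: "f \<in> Inn" and g: "g \<in> Der"
  obtain a where a: "f = (\<lambda>x. a * x - x * a)" using f by (auto simp: Inn_def)
  have "(\<lambda>x. g (f x) - f (g x)) = (\<lambda>x. g a * x - x * g a)"
    by (intro ext) (simp only: a DerD[OF g], simp add: algebra_simps)
  then show ?thesis unfolding Inn_def by (rule range_eqI)
qed

lemma outer_class_iff: "g \<in> outer_class f \<longleftrightarrow> (\<lambda>x. g x - f x) \<in> Inn"
proof
  assume "(\<lambda>x. g x - f x) \<in> Inn"
  then show "g \<in> outer_class f" unfolding outer_class_def
    by (intro image_eqI[where x="\<lambda>x. g x - f x"]) auto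
qed (auto simp: outer_class_def)

lemma outer_class_self: "f \<in> outer_class f" using Inn_zero by (simp add: outer_class_iff)

lemma outer_class_eqI: assumes fg: "(\<lambda>x. f x - g x) \<in> Inn" shows "outer_class f = outer_class g"
proof (rule Set.set_eqI)
  fix h
  show "h \<in> outer_class f \<longleftrightarrow> h \<in> outer_class g"
    using Inn_add[OF fg, of "\<lambda>x. h x - f x"] Inn_add[OF Inn_minus[OF fg], of "\<lambda>x. h x - g x"]
    by (auto simp: outer_class_iff algebra_simps)
qed

lemma Inn_eq: "Inn = outer_class (\<lambda>x. 0)" by (auto simp: outer_class_iff)

lemma outer_class_Der: "f \<in> Der \<Longrightarrow> g \<in> outer_class f \<Longrightarrow> g \<in> Der"
  using Der_add[of f "\<lambda>x. g x - f x"] Inn_subset_Der by (auto simp: outer_class_iff)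

lemma HH1_add: "f \<in> Der \<Longrightarrow> g \<in> Der \<Longrightarrow>
  lie_add HH1 (outer_class f) (outer_class g) = outer_class (\<lambda>x. f x + g x)"
proof -
  assume "f \<in> Der" "g \<in> Der"
  have "outer_class (\<lambda>x. f' x + g' x) = outer_class (\<lambda>x. f x + g x)"
    if "f' \<in> outer_class f" "g' \<in> outer_class g" for f' g'
    using Inn_add that by (intro outer_class_eqI) (fastforce simp: outer_class_iff algebra_simps)
  then show ?thesis using outer_class_self[of f] outer_class_self[of g]
    unfolding HH1_def lie_alg.simps by blast
qed

lemma HH1_scale: "lie_scale HH1 c (outer_class f) = outer_class (\<lambda>x. scale c (f x))"
proof -
  have "outer_class (\<lambda>x. scale c (f' x)) = outer_class (\<lambda>x. scale c (f x))"
    if "f' \<in> outer_class f" for f'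
    using Inn_scale[of "\<lambda>x. f' x - f x" c] that
    by (intro outer_class_eqI) (simp add: outer_class_iff scale_right_diff_distrib)
  then show ?thesis using outer_class_self[of f]
    unfolding HH1_def lie_alg.simps by blast
qed

lemma HH1_bracket: "f \<in> Der \<Longrightarrow> g \<in> Der \<Longrightarrow>
  lie_bracket HH1 (outer_class f) (outer_class g) = outer_class (\<lambda>x. f (g x) - g (f x))"
proof -
  assume f: "f \<in> Der" and g: "g \<in> Der"
  have "outer_class (\<lambda>x. f' (g' x) - g' (f' x)) = outer_class (\<lambda>x. f (g x) - g (f x))"
    if f': "f' \<in> outer_class f" and g': "g' \<in> outer_class g" for f' g'
  proof (rule outer_class_eqI)
    define d e where "d = (\<lambda>x. f' x - f x)" and "e = (\<lambda>x. g' x - g x)"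
    have d: "d \<in> Inn" and e: "e \<in> Inn" using f' g' by (auto simp: d_def e_def outer_class_iff)
    have "g' \<in> Der" using g g' outer_class_Der by blast
    note D = DerD[OF f] DerD[OF this]
    have "(\<lambda>x. (f (e x) - e (f x)) + - (g' (d x) - d (g' x))) \<in> Inn"
      using Inn_add[OF Inn_bracket[OF e f] Inn_minus[OF Inn_bracket[OF d \<open>g' \<in> Der\<close>]]] by simp
    also have "(\<lambda>x. (f (e x) - e (f x)) + - (g' (d x) - d (g' x))) =
      (\<lambda>x. f' (g' x) - g' (f' x) - (f (g x) - g (f x)))"
      by (auto simp: d_def e_def D algebra_simps)
    finally show "(\<lambda>x. f' (g' x) - g' (f' x) - (f (g x) - g (f x))) \<in> Inn" .
  qed
  then show ?thesis using outer_class_self[of f] outer_class_self[of g]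
    unfolding HH1_def lie_alg.simps by blast
qed

lemma HH1_carrier: "lie_carrier HH1 = outer_class ` Der" by (simp add: HH1_def)
lemma HH1_zero: "lie_zero HH1 = outer_class (\<lambda>x. 0)" by (simp add: HH1_def Inn_eq)


lemma Der_minus: "f \<in> Der \<Longrightarrow> (\<lambda>x. - f x) \<in> Der"
  using Der_scale[of f "-1"] by simp

lemma HH1_jacobi:
  assumes f: "f \<in> Der" and g: "g \<in> Der" and h: "h \<in> Der"
  shows "lie_add HH1 (lie_bracket HH1 (outer_class f) (lie_bracket HH1 (outer_class g) (outer_class h)))
     (lie_add HH1 (lie_bracket HH1 (outer_class g) (lie_bracket HH1 (outer_class h) (outer_class f)))
       (lie_bracket HH1 (outer_class h) (lie_bracket HH1 (outer_class f) (outer_class g))))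
     = lie_zero HH1"
proof -
  note 1 = Der_bracket[OF g h] Der_bracket[OF h f] Der_bracket[OF f g]
  note 2 = Der_bracket[OF f 1(1)] Der_bracket[OF g 1(2)] Der_bracket[OF h 1(3)]
  show ?thesis unfolding HH1_zero
    apply (simp only: HH1_bracket f g h 1)
    apply (simp only: HH1_add[OF 2(2,3)] HH1_add[OF 2(1) Der_add[OF 2(2,3)]])
    apply (rule arg_cong[where f=outer_class])
    apply (simp only: DerD[OF f] DerD[OF g] DerD[OF h])
    apply (simp add: algebra_simps)
    done
qed

lemma lie_algebra_HH1: "lie_algebra HH1"
proof
  show "\<lbrakk>x \<in> lie_carrier HH1; y \<in> lie_carrier HH1; z \<in> lie_carrier HH1\<rbrakk>
      \<Longrightarrow> lie_add HH1 (lie_bracket HH1 x (lie_bracket HH1 y z))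
            (lie_add HH1 (lie_bracket HH1 y (lie_bracket HH1 z x)) (lie_bracket HH1 z (lie_bracket HH1 x y)))
          = lie_zero HH1" for x y z
    unfolding HH1_carrier using HH1_jacobi by blast
qed (auto simp: HH1_carrier HH1_zero HH1_add HH1_scale HH1_bracket Der_zero Der_add Der_scale
        Der_bracket Der_minus DerD scale_right_distrib scale_left_distrib scale_right_diff_distrib
        algebra_simps intro!: imageI arg_cong[where f=outer_class])

end

end

(*
  By Engel's theorem it suffices that every derivation d of A is the sum of an inner derivation and a
  nilpotent one.  Subtracting an inner derivation, d kills the idempotents e_v of a presentation kQ/I.
  Since Q is acyclic, d preserves the radical, so the arrows can be replaced by
  generalised eigenvectors of d; this gives a new presentation kQ/I' with a weight (the eigenvalue) on
  every arrow.  The generalised eigenspaces form a grading of A by the additive group of k, so minimal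
  relations in I' are homogeneous and the weight is a homomorphism from pi_1(Q, I') to k.  As this group
  is trivial, the weight of an arrow u -> v is c(v) - c(u) for some function c on the vertices, and
  d - [sum_v c(v) e_v, -] is nilpotent.
*)

theory Submission
  imports Defs "HOL-Library.Function_Algebras"
begin

text \<open>Triviality of pi_1 is applied to an ideal I' that depends on d. This is where the
  quantifier over all presentations in the definition of simple connectedness enters, and why the
  eigenvectors must give a genuine admissible presentation and not only a grading of A. To serve as
  arrows again, they are chosen in the corners e_v rad(A) e_u, modulo e_v rad(A)^2 e_u.

  The argument is uniform in the characteristic: eigenvalues are used only as elements of the
  additive group of k, and the Leibniz rule alone shows that generalised eigenspaces for l and m
  multiply into the one for l + m.

  If n is nilpotent on A, then [n, -] is nilpotent on maps, and changing n by an inner derivation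
  changes nothing modulo Inn. Engel's theorem is therefore proved for a Lie algebra relative to an
  ideal and applied to Der and Inn, without passing to the quotient.

  Triangularity is defined intrinsically, through the radical and primitive idempotents; a separate
  comparison carries acyclicity over to the quiver of the chosen presentation.\<close>

section \<open>Engel's theorem modulo an ideal\<close>

text \<open>Statements about the Lie algebra L/J are phrased inside an ambient vector space as
  membership in J, so no quotient has to be formed. The instance in view is L = Der, J =
  Inn.\<close>

locale lie_ideal_pair = vector_space scale
  for scale :: "'k::field \<Rightarrow> 'b::ab_group_add \<Rightarrow> 'b" +
  fixes L J :: "'b set" and br :: "'b \<Rightarrow> 'b \<Rightarrow> 'b"
  assumes subspace_L: "subspace L" and subspace_J: "subspace J" and J_subset_L: "J \<subseteq> L"
    and br_closed: "\<lbrakk>x \<in> L; y \<in> L\<rbrakk> \<Longrightarrow> br x y \<in> L"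
    and br_ideal: "\<lbrakk>x \<in> L; y \<in> J\<rbrakk> \<Longrightarrow> br x y \<in> J"
    and br_add_left: "\<lbrakk>x \<in> L; y \<in> L; z \<in> L\<rbrakk> \<Longrightarrow> br (x + y) z = br x z + br y z"
    and br_add_right: "\<lbrakk>x \<in> L; y \<in> L; z \<in> L\<rbrakk> \<Longrightarrow> br x (y + z) = br x y + br x z"
    and br_scale_left: "\<lbrakk>x \<in> L; y \<in> L\<rbrakk> \<Longrightarrow> br (scale c x) y = scale c (br x y)"
    and br_scale_right: "\<lbrakk>x \<in> L; y \<in> L\<rbrakk> \<Longrightarrow> br x (scale c y) = scale c (br x y)"
    and br_self: "x \<in> L \<Longrightarrow> br x x = 0"
    and br_jacobi: "\<lbrakk>x \<in> L; y \<in> L; z \<in> L\<rbrakk> \<Longrightarrow> br x (br y z) = br (br x y) z + br y (br x z)"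
begin

text \<open>For K = L this is the upper central series of L/J, pulled back to L. For a subalgebra K,
  the equation \<open>ann K m = L\<close> says that any m successive brackets with elements of K
  send L into J, that is, that K acts nilpotently on L/J.\<close>

primrec ann :: "'b set \<Rightarrow> nat \<Rightarrow> 'b set"
  where
    "ann K 0 = J"
  | "ann K (Suc j) = {y \<in> L. \<forall>k\<in>K. br k y \<in> ann K j}"

lemma ann_subset: "ann K j \<subseteq> L"
  using J_subset_L by (cases j) auto

lemma br_anticomm: assumes "x \<in> L" "y \<in> L" shows "br x y = - br y x"
proof -
  have "x + y \<in> L" using assms subspace_add[OF subspace_L] by blast
  then have "0 = br (x + y) (x + y)" using br_self by simp
  also have "\<dots> = br x y + br y x"
    using assms \<open>x + y \<in> L\<close> by (simp add: br_add_left br_add_right br_self[OF assms(1)] br_self[OF assms(2)] del: br_self)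
  finally show ?thesis by (metis add.commute eq_neg_iff_add_eq_0)
qed

lemma subspace_ann: assumes "K \<subseteq> L" shows "subspace (ann K j)"
proof (induction j)
  case (Suc j)
  have "br k 0 = 0" if "k \<in> K" for k
    using br_scale_right[of k 0 0] that assms subspace_0[OF subspace_L] by auto
  with Suc show ?case
    using assms subspace_L
    by (auto simp: subspace_def br_add_right br_scale_right subset_iff)
qed (use subspace_J in simp)

lemma ann_mono: assumes "K \<subseteq> L" "i \<le> j" shows "ann K i \<subseteq> ann K j"
proof -
  have "ann K j \<subseteq> ann K (Suc j)" for j
  proof (induction j)
    case 0 then show ?case using assms(1) J_subset_L br_ideal by auto
  qed auto
  then show ?thesis using assms(2) lift_Suc_mono_le[of "ann K"] by blast
qed

text \<open>The Jacobi identity moves k past x at the price of [k, x], which lies in K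
  again.\<close>

lemma br_ann:
  assumes K: "K \<subseteq> L" and x: "x \<in> L" and nx: "\<And>k. k \<in> K \<Longrightarrow> br k x \<in> K" and y: "y \<in> ann K j"
  shows "br x y \<in> ann K j"
  using y
proof (induction j arbitrary: y)
  case 0 then show ?case using x br_ideal by auto
next
  case (Suc j)
  have yL: "y \<in> L" using Suc.prems by simp
  have "br k (br x y) \<in> ann K j" if k: "k \<in> K" for k
  proof -
    have "br k (br x y) = br (br k x) y + br x (br k y)"
      using br_jacobi k K x yL by blast
    moreover have "br (br k x) y \<in> ann K j" using Suc.prems nx[OF k] by simp
    moreover have "br x (br k y) \<in> ann K j" using Suc k by simp
    ultimately show ?thesis using subspace_add[OF subspace_ann[OF K]] by simp
  qed
  then show ?case using x yL br_closed by simp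
qed

text \<open>One step for K costs N steps for K'. A bracket with an element of K drops
  \<open>ann K (Suc j)\<close> into \<open>ann K j\<close> at once; a bracket with x stays in
  \<open>ann K (Suc j)\<close>, because x normalises K, and after N of them the element is in J. The
  inner induction counts the brackets with x that are still to come.\<close>

lemma ann_extend:
  assumes K: "subspace K" "K \<subseteq> L" and x: "x \<in> L" and nx: "\<And>k. k \<in> K \<Longrightarrow> br k x \<in> K"
    and K': "K' \<subseteq> L" "\<And>z. z \<in> K' \<Longrightarrow> \<exists>k\<in>K. \<exists>c. z = k + scale c x"
    and N: "\<And>y. y \<in> L \<Longrightarrow> (br x ^^ N) y \<in> J"
  shows "ann K j \<subseteq> ann K' (j * N)"
proof (induction j)
  case (Suc j)
  have *: "z \<in> ann K' (j * N + i)" if "z \<in> ann K (Suc j)" "(br x ^^ i) z \<in> ann K j" for z i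
    using that
  proof (induction i arbitrary: z)
    case 0 then show ?case using Suc.IH by auto
  next
    case (Suc i)
    have zL: "z \<in> L" using Suc.prems by simp
    have xz: "br x z \<in> ann K' (j * N + i)"
      using Suc.IH[of "br x z"] Suc.prems br_ann[OF K(2) x nx] by (metis comp_apply funpow_Suc_right)
    have "br k' z \<in> ann K' (j * N + i)" if k': "k' \<in> K'" for k'
    proof -
      obtain k c where k: "k \<in> K" "k' = k + scale c x" using K'(2) k' by blast
      have "br k z \<in> ann K j" using Suc.prems k by simp
      then have "br k z \<in> ann K' (j * N + i)"
        using \<open>ann K j \<subseteq> ann K' (j * N)\<close> ann_mono[OF K'(1), of "j * N" "j * N + i"] by auto
      moreover have "br k' z = br k z + scale c (br x z)"
        using k K x zL subspace_scale[OF subspace_L] by (auto simp: br_add_left br_scale_left)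
      ultimately show ?thesis
        using subspace_add[OF subspace_ann[OF K'(1)] _ subspace_scale[OF subspace_ann[OF K'(1)] xz]]
        by simp
    qed
    then show ?case using zL by simp
  qed
  have "(br x ^^ N) z \<in> ann K j" if "z \<in> L" for z
    using N[OF that] ann_mono[OF K(2), of 0 j] by auto
  then have "ann K (Suc j) \<subseteq> ann K' (j * N + N)"
    using *[of _ N] ann_subset[of K "Suc j"] by blast
  then show ?case by (simp only: mult_Suc add.commute)
qed simp

text \<open>
  Take a subalgebra \<open>K \<supseteq> J\<close> of maximal dimension that acts nilpotently on \<open>L\<close> modulo \<open>J\<close>.  If \<open>K \<noteq> L\<close>,
  an element \<open>x \<notin> K\<close> of the first \<open>ann K j\<close> not contained in \<open>K\<close> normalises \<open>K\<close>, and the span of \<open>K\<close> and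
  \<open>x\<close> still acts nilpotently.
\<close>

theorem engel_mod_ideal:
  assumes T: "finite T" "L \<subseteq> span T"
    and nilp: "\<And>x. x \<in> L \<Longrightarrow> \<exists>N. \<forall>y\<in>L. (br x ^^ N) y \<in> J"
  shows "\<exists>m. ann L m = L"
proof -
  define good where "good S \<longleftrightarrow> independent S \<and> span S \<subseteq> L \<and> J \<subseteq> span S \<and>
    (\<forall>x\<in>span S. \<forall>y\<in>span S. br x y \<in> span S) \<and> (\<exists>m. ann (span S) m = L)" for S
  \<comment> \<open>Only L has to lie in a finitely spanned subspace, not the ambient space. This
    bound is what makes a good set of maximal cardinality exist.\<close>
  have bound: "finite S \<and> card S \<le> card T" if "good S" for S
    using that T independent_span_bound[of T S] span_superset[of S] unfolding good_def by blast
  obtain S0 where S0: "S0 \<subseteq> J" "independent S0" "J \<subseteq> span S0"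
    using basis_exists[of J] by metis
  have "span S0 = J" using S0 span_minimal[OF S0(1) subspace_J] by blast
  \<comment> \<open>J itself starts the search: it is an ideal, so a single bracket with an element
    of J already sends L into J.\<close>
  moreover have "ann J 1 = L"
  proof -
    have "br k y \<in> J" if "k \<in> J" "y \<in> L" for k y
      using that br_ideal[of y k] br_anticomm[of k y] subspace_neg[OF subspace_J] J_subset_L by auto
    then show ?thesis by auto
  qed
  ultimately have "good S0"
    unfolding good_def using S0 br_ideal J_subset_L by (intro conjI ballI exI[of _ 1]) auto
  then obtain S where S: "good S" and max: "\<And>S'. good S' \<Longrightarrow> card S' \<le> card S"
    using ex_has_greatest_nat[of good S0 card "Suc (card T)"] bound by (meson le_imp_less_Suc)
  define K where "K = span S"
  have K: "subspace K" "K \<subseteq> L" "J \<subseteq> K" and Kbr: "\<And>x y. x \<in> K \<Longrightarrow> y \<in> K \<Longrightarrow> br x y \<in> K"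
    and ex: "\<exists>m. ann K m = L"
    using S by (auto simp: good_def K_def)
  obtain m where m: "ann K m = L" using ex by blast
  have "K = L"
  proof (rule ccontr)
    assume "K \<noteq> L"
    then have ex': "\<exists>j. \<not> ann K j \<subseteq> K" using m K(2) by blast
    define j where "j = (LEAST j. \<not> ann K j \<subseteq> K)"
    have j: "\<not> ann K j \<subseteq> K" and jl: "\<And>i. i < j \<Longrightarrow> ann K i \<subseteq> K"
      unfolding j_def using LeastI_ex[OF ex'] not_less_Least by blast+
    obtain j' where j': "j = Suc j'" using j K(3) by (cases j) auto
    obtain x where x: "x \<in> ann K j" "x \<notin> K" using j by blast
    have xL: "x \<in> L" using x ann_subset by blast
    have nx: "br k x \<in> K" if "k \<in> K" for k
      using x(1) that jl[of j'] by (auto simp: j')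
    define K' where "K' = span (insert x S)"
    have K'_iff: "z \<in> K' \<longleftrightarrow> (\<exists>c. z - scale c x \<in> K)" for z
      unfolding K'_def K_def by (rule span_breakdown_eq)
    have K'D: "\<exists>k\<in>K. \<exists>c. z = k + scale c x" if "z \<in> K'" for z
      using that unfolding K'_iff by (metis diff_add_cancel)
    have K'I: "k + scale c x \<in> K'" if "k \<in> K" for k c
      unfolding K'_iff using that by (intro exI[of _ c]) simp
    have sc: "scale c x \<in> L" for c using xL subspace_scale[OF subspace_L] by blast
    have K'L: "K' \<subseteq> L"
      using K'D K(2) sc subspace_add[OF subspace_L] by blast
    have K'br: "br y z \<in> K'" if yz: "y \<in> K'" "z \<in> K'" for y z
    proof -
      obtain k c where k: "k \<in> K" "y = k + scale c x" using K'D yz by blast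
      obtain l b where l: "l \<in> K" "z = l + scale b x" using K'D yz by blast
      have KL: "k \<in> L" "l \<in> L" and zL: "z \<in> L" using k l K K'L yz by auto
      have "br y z = br k l + scale b (br k x) + scale c (br x l) + scale c (scale b (br x x))"
      proof -
        have 1: "br y z = br k z + scale c (br x z)"
          unfolding k using KL xL sc zL by (simp add: br_add_left br_scale_left)
        have 2: "br w z = br w l + scale b (br w x)" if "w \<in> L" for w
          unfolding l using that KL xL sc by (simp add: br_add_right br_scale_right)
        show ?thesis unfolding 1 2[OF KL(1)] 2[OF xL] by (simp add: scale_right_distrib add.assoc)
      qed
      then have "br y z = br k l + scale b (br k x) + scale c (br x l)"
        using br_self[OF xL] by simp
      moreover have "br x l \<in> K"
        using br_anticomm[OF xL KL(2)] nx[OF l(1)] subspace_neg[OF K(1)] by simp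
      ultimately have "br y z \<in> K"
        using Kbr[OF k(1) l(1)] nx[OF k(1)] subspace_add[OF K(1)] subspace_scale[OF K(1)] by simp
      then show ?thesis using K'I[of _ 0] by simp
    qed
    have KK': "K \<subseteq> K'" using K'I[of _ 0] by auto
    obtain N where N: "\<And>y. y \<in> L \<Longrightarrow> (br x ^^ N) y \<in> J" using nilp[OF xL] by blast
    have "ann K' (m * N) = L"
      using ann_extend[OF K(1,2) xL nx K'L K'D N, of m] m ann_subset[of K'] by blast
    moreover have "independent (insert x S)"
      using S x(2) independent_insertI unfolding good_def K_def by blast
    moreover have "J \<subseteq> K'" using KK' K(3) by blast
    ultimately have "good (insert x S)"
      using K'L K'br unfolding good_def K'_def by (intro conjI ballI exI) assumption+
    then have "card (insert x S) \<le> card S" by (rule max)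
    moreover have "x \<notin> S" using x(2) span_base unfolding K_def by blast
    ultimately show False using bound[OF S] by simp
  qed
  then show ?thesis using m by blast
qed

end

section \<open>Linear algebra\<close>

text \<open>Linear independence in the quotient by S. It is stated for an indexed family, so that
  each vector stays attached to its index, later an arrow or an exponent.\<close>

definition (in vector_space) independent_modulo :: "'b set \<Rightarrow> 'i set \<Rightarrow> ('i \<Rightarrow> 'b) \<Rightarrow> bool"
  where "independent_modulo S X f \<longleftrightarrow> (\<forall>c. (\<Sum>x\<in>X. scale (c x) (f x)) \<in> S \<longrightarrow> (\<forall>x\<in>X. c x = 0))"

context finite_dimensional_vector_space
begin

lemma independent_modulo_inj_on:
  assumes "independent_modulo S X f" "finite X" "0 \<in> S"
  shows "inj_on f X"
proof (rule inj_onI, rule ccontr)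
  fix x y assume xy: "x \<in> X" "y \<in> X" "f x = f y" "x \<noteq> y"
  define c where "c = (\<lambda>z. if z = x then 1 else if z = y then - 1 else 0 :: 'a)"
  have "(\<Sum>z\<in>X. scale (c z) (f z)) = (\<Sum>z\<in>{x, y}. scale (c z) (f z))"
    using assms(2) xy by (intro sum.mono_neutral_right) (auto simp: c_def)
  also have "\<dots> = 0" using xy by (simp add: c_def)
  finally have "c x = 0" using assms(1,3) xy(1) unfolding independent_modulo_def by auto
  then show False by (simp add: c_def)
qed

lemma independent_modulo_union:
  assumes f: "independent_modulo S X f" and X: "finite X" and S: "subspace S"
    and C: "C \<subseteq> S" "independent C"
  shows "independent (f ` X \<union> C)" "f ` X \<inter> C = {}"
proof -
  have inj: "inj_on f X" using independent_modulo_inj_on[OF f X subspace_0[OF S]] .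
  have fC: "finite C" using C(2) finiteI_independent by blast
  have sumC: "(\<Sum>v\<in>C. scale (u v) v) \<in> S" for u
    using C(1) S by (intro subspace_sum subspace_scale) auto
  show disj: "f ` X \<inter> C = {}"
  proof (rule ccontr)
    assume "f ` X \<inter> C \<noteq> {}"
    then obtain x where x: "x \<in> X" "f x \<in> S" using C(1) by auto
    have "(\<Sum>z\<in>X. scale (if z = x then 1 else 0) (f z)) = f x"
      using x(1) X by (simp add: if_distrib[of "\<lambda>c. scale c _"] sum.delta cong: if_cong)
    then have "(\<Sum>z\<in>X. scale (if z = x then 1 else 0) (f z)) \<in> S" using x(2) by simp
    then have "\<forall>y\<in>X. (if y = x then 1 else 0 :: 'a) = 0"
      using f[unfolded independent_modulo_def, rule_format, of "\<lambda>z. if z = x then 1 else 0"] by simp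
    then show False using x(1) by auto
  qed
  show "independent (f ` X \<union> C)"
  proof (rule independent_if_scalars_zero)
    fix u v assume u: "(\<Sum>v\<in>f ` X \<union> C. scale (u v) v) = 0" and v: "v \<in> f ` X \<union> C"
    have *: "(\<Sum>x\<in>X. scale (u (f x)) (f x)) + (\<Sum>v\<in>C. scale (u v) v) = 0"
      using u X fC disj by (simp add: sum.union_disjoint sum.reindex[OF inj])
    then have "(\<Sum>x\<in>X. scale (u (f x)) (f x)) = - (\<Sum>v\<in>C. scale (u v) v)"
      by (simp add: eq_neg_iff_add_eq_0)
    then have "(\<Sum>x\<in>X. scale (u (f x)) (f x)) \<in> S"
      using subspace_neg[OF S sumC] by simp
    then have ux: "\<forall>x\<in>X. u (f x) = 0" using f unfolding independent_modulo_def
      by (auto dest: spec[where x="\<lambda>x. u (f x)"])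
    then have "(\<Sum>v\<in>C. scale (u v) v) = 0" using * by simp
    then have "\<forall>v\<in>C. u v = 0" using independentD[OF C(2) fC order_refl] by blast
    then show "u v = 0" using v ux by auto
  qed (use X fC in auto)
qed

lemma independent_modulo_exchange:
  assumes f: "independent_modulo S X f" "f ` X \<subseteq> R" "R \<subseteq> span (f ` X \<union> S)"
    and X: "finite X" and S: "subspace S" "S \<subseteq> R" and R: "subspace R"
    and E: "E \<subseteq> R" "R \<subseteq> span E"
  obtains g where "independent_modulo S X g" "g ` X \<subseteq> E" "R \<subseteq> span (g ` X \<union> S)"
proof -
  obtain C where C: "C \<subseteq> S" "independent C" "S \<subseteq> span C" using basis_exists[of S] by metis
  have fC: "finite C" using C(2) finiteI_independent by blast
  have spC: "span C = S" using C span_minimal[OF C(1) S(1)] by blast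
  have inj: "inj_on f X" using independent_modulo_inj_on[OF f(1) X subspace_0[OF S(1)]] .
  note u = independent_modulo_union[OF f(1) X S(1) C(1,2)]
  have "span (f ` X \<union> S) \<subseteq> span (f ` X \<union> C)"
    using C(3) span_mono[of C "f ` X \<union> C"] by (intro span_minimal) (auto intro: span_base)
  then have dimR: "dim R = card X + card C"
    using f(2,3) C(1) S(2) u X fC
    by (intro dim_unique[of "f ` X \<union> C"]) (auto simp: card_Un_disjoint card_image[OF inj])
  obtain B where B: "C \<subseteq> B" "B \<subseteq> C \<union> E" "independent B" "C \<union> E \<subseteq> span B"
    using maximal_independent_subset_extend[of C "C \<union> E"] C(2) by blast
  have fB: "finite B" using B(3) finiteI_independent by blast
  have RB: "R \<subseteq> span B"
    using E(2) B(4) span_minimal[of E "span B"] by auto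
  have "B \<subseteq> R" using B(2) C(1) S(2) E(1) by blast
  then have "card B = card X + card C" using dim_unique[OF _ RB B(3) HOL.refl] dimR by simp
  then have "card (B - C) = card X" using card_Diff_subset[OF fC B(1)] by simp
  then obtain g where g: "bij_betw g X (B - C)"
    using finite_same_card_bij[OF X, of "B - C"] fB by auto
  have "independent_modulo S X g"
    unfolding independent_modulo_def
  proof (intro allI impI ballI)
    fix c x assume c: "(\<Sum>x\<in>X. scale (c x) (g x)) \<in> S" and x: "x \<in> X"
    obtain a where a: "(\<Sum>x\<in>X. scale (c x) (g x)) = (\<Sum>v\<in>C. scale (a v) v)"
      using c spC span_finite[OF fC] by auto
    define h where "h = inv_into X g"
    \<comment> \<open>In the basis B the assumed relation has coefficients c on \<open>B - C\<close>
      and minus a on C; independence of B makes them all vanish.\<close>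
    define w where "w v = (if v \<in> C then - a v else c (h v))" for v
    have "(\<Sum>v\<in>B. scale (w v) v) = (\<Sum>v\<in>B - C. scale (w v) v) + (\<Sum>v\<in>C. scale (w v) v)"
      using fB B(1) by (simp add: sum.subset_diff)
    also have "(\<Sum>v\<in>C. scale (w v) v) = - (\<Sum>v\<in>C. scale (a v) v)"
      by (simp add: w_def sum_negf)
    also have "(\<Sum>v\<in>B - C. scale (w v) v) = (\<Sum>x\<in>X. scale (w (g x)) (g x))"
      using sum.reindex_bij_betw[OF g, of "\<lambda>v. scale (w v) v"] by simp
    also have "\<dots> = (\<Sum>x\<in>X. scale (c x) (g x))"
      using g bij_betwE[OF g] by (intro sum.cong) (auto simp: w_def h_def bij_betw_def)
    finally have "(\<Sum>v\<in>B. scale (w v) v) = 0" using a by simp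
    then have "w (g x) = 0" using independentD[OF B(3) fB order_refl] bij_betwE[OF g] x by blast
    then show "c x = 0" using bij_betwE[OF g] x g by (auto simp: w_def h_def bij_betw_def)
  qed
  moreover have "g ` X = B - C" using g by (simp add: bij_betw_def)
  moreover have "span B \<subseteq> span (g ` X \<union> S)"
    using C(1) \<open>g ` X = B - C\<close> by (intro span_mono) auto
  ultimately have "R \<subseteq> span (g ` X \<union> S)" using RB by blast
  moreover have "g ` X \<subseteq> E" using \<open>g ` X = B - C\<close> B(2) by blast
  ultimately show thesis using that \<open>independent_modulo S X g\<close> by blast
qed

end

section \<open>Generalised eigenspaces\<close>

locale fd_operator = finite_dimensional_vector_space scale Basis
  for scale :: "'k::alg_closed_field \<Rightarrow> 'a::ab_group_add \<Rightarrow> 'a" and Basis +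
  fixes d :: "'a \<Rightarrow> 'a"
  assumes d_add: "d (x + y) = d x + d y" and d_scale: "d (scale c x) = scale c (d x)"
begin

definition shift :: "'k \<Rightarrow> 'a \<Rightarrow> 'a"
  where "shift l x = d x - scale l x"

definition gen_eigenspace :: "'k \<Rightarrow> 'a set"
  where "gen_eigenspace l = {x. \<exists>n. (shift l ^^ n) x = 0}"

lemma shift_add: "shift l (x + y) = shift l x + shift l y"
  and shift_scale: "shift l (scale c x) = scale c (shift l x)"
  and shift_commute: "shift l (shift m x) = shift m (shift l x)"
  and shift_shift: "shift l x = shift m x + scale (m - l) x"
proof -
  have d_diff: "d (x - y) = d x - d y" for x y
    using d_add[of "x - y" y] by simp
  show "shift l (x + y) = shift l x + shift l y" "shift l (scale c x) = scale c (shift l x)"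
    "shift l x = shift m x + scale (m - l) x"
    by (simp_all add: shift_def d_add d_scale scale_right_distrib scale_right_diff_distrib
        scale_left_diff_distrib mult.commute)
  show "shift l (shift m x) = shift m (shift l x)"
    by (simp add: shift_def d_diff d_scale scale_right_diff_distrib mult.commute)
qed

lemma shift_funpow_add: "(shift l ^^ n) (x + y) = (shift l ^^ n) x + (shift l ^^ n) y"
  and shift_funpow_scale: "(shift l ^^ n) (scale c x) = scale c ((shift l ^^ n) x)"
  by (induction n) (simp_all add: shift_add shift_scale)

lemma shift_funpow_0 [simp]: "(shift l ^^ n) 0 = 0"
  using shift_funpow_scale[of n l 0 0] by simp

lemma shift_funpow_commute: "(shift l ^^ n) ((shift m ^^ k) x) = (shift m ^^ k) ((shift l ^^ n) x)"
proof -
  have *: "shift l ((shift m ^^ k) x) = (shift m ^^ k) (shift l x)" for x l m k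
    by (induction k) (simp_all add: shift_commute[of l m])
  show ?thesis by (induction n) (simp_all add: *)
qed

lemma shift_funpow_mono: "(shift l ^^ n) x = 0 \<Longrightarrow> n \<le> k \<Longrightarrow> (shift l ^^ k) x = 0"
  using funpow_add[of "k - n" n "shift l"] by simp

lemma subspace_gen_eigenspace: "subspace (gen_eigenspace l)"
proof (rule subspaceI)
  show "0 \<in> gen_eigenspace l" by (auto simp: gen_eigenspace_def)
  fix x y assume "x \<in> gen_eigenspace l" "y \<in> gen_eigenspace l"
  then obtain m n where "(shift l ^^ m) x = 0" "(shift l ^^ n) y = 0"
    by (auto simp: gen_eigenspace_def)
  then have "(shift l ^^ (m + n)) (x + y) = 0"
    using shift_funpow_mono[of m l x "m + n"] shift_funpow_mono[of n l y "m + n"]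
    by (simp add: shift_funpow_add)
  then show "x + y \<in> gen_eigenspace l" by (auto simp: gen_eigenspace_def)
qed (auto simp: gen_eigenspace_def shift_funpow_scale)

lemma shift_gen_eigenspace: "x \<in> gen_eigenspace m \<Longrightarrow> (shift l ^^ n) x \<in> gen_eigenspace m"
proof -
  assume "x \<in> gen_eigenspace m"
  then obtain k where "(shift m ^^ k) x = 0" by (auto simp: gen_eigenspace_def)
  then have "(shift m ^^ k) ((shift l ^^ n) x) = 0" by (simp add: shift_funpow_commute[of k m])
  then show ?thesis by (auto simp: gen_eigenspace_def)
qed

text \<open>On an eigenvector for l the k-th power of d - m is multiplication by (l - m)^k, which
  never vanishes. Hence d - l is injective on the generalised eigenspace of m.\<close>

lemma shift_eq_0_gen_eigenspace:
  assumes x: "x \<in> gen_eigenspace m" "l \<noteq> m" "(shift l ^^ n) x = 0"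
  shows "x = 0"
proof -
  have 1: "x = 0" if x: "x \<in> gen_eigenspace m" "shift l x = 0" for x
  proof -
    have "shift m x = scale (l - m) x"
      using shift_shift[of m x l] x(2) by simp
    then have "(shift m ^^ k) x = scale ((l - m) ^ k) x" for k
      by (induction k) (simp_all add: shift_scale mult.commute)
    moreover obtain k where "(shift m ^^ k) x = 0" using x(1) by (auto simp: gen_eigenspace_def)
    ultimately show ?thesis using \<open>l \<noteq> m\<close> by auto
  qed
  show ?thesis
    using x(3)
  proof (induction n)
    case (Suc n)
    then show ?case using 1[OF shift_gen_eigenspace[OF x(1)]] by simp
  qed simp
qed

text \<open>A power of d - m removes the m-component of the sum and maps every other component into
  its own eigenspace, on which d - m is injective.\<close>

lemma gen_eigenspace_independent:
  assumes "finite F" "\<And>l. l \<in> F \<Longrightarrow> g l \<in> gen_eigenspace l" "(\<Sum>l\<in>F. g l) = 0" "l \<in> F"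
  shows "g l = 0"
  using assms
proof (induction F arbitrary: g l)
  case (insert m F)
  obtain n where n: "(shift m ^^ n) (g m) = 0" using insert.prems(1)[of m] by (auto simp: gen_eigenspace_def)
  have sum: "(shift m ^^ n) (sum g F) = (\<Sum>l\<in>F. (shift m ^^ n) (g l))" for g
    using insert.hyps(1) by (induction F) (simp_all add: shift_funpow_add)
  have "0 = (shift m ^^ n) (\<Sum>l\<in>insert m F. g l)" using insert.prems(2) by simp
  also have "\<dots> = (\<Sum>l\<in>F. (shift m ^^ n) (g l))"
    using insert.hyps n by (simp add: shift_funpow_add sum)
  finally have z: "(\<Sum>l\<in>F. (shift m ^^ n) (g l)) = 0" by (rule HOL.sym)
  have F: "g l = 0" if l: "l \<in> F" for l
  proof (rule shift_eq_0_gen_eigenspace)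
    show "g l \<in> gen_eigenspace l" "m \<noteq> l" using insert.prems(1) insert.hyps(2) l by auto
    show "(shift m ^^ n) (g l) = 0"
      using insert.IH[OF _ z l] insert.prems(1) shift_gen_eigenspace by blast
  qed
  then have "g m = 0" using insert.prems(2) insert.hyps by simp
  then show ?case using F insert.prems(3) by auto
qed simp

text \<open>Induction on the exponent that kills x: if (d - l) h = (d - m) x, then (x - h) / (m - l)
  is a preimage of x, because (d - l) x = (d - m) x + (m - l) x.\<close>

lemma shift_surj_gen_eigenspace:
  assumes W: "subspace W" "\<And>x. x \<in> W \<Longrightarrow> d x \<in> W" and "l \<noteq> m" "x \<in> gen_eigenspace m \<inter> W"
  shows "\<exists>h\<in>gen_eigenspace m \<inter> W. shift l h = x"
proof -
  have sW: "shift m x \<in> W" if "x \<in> W" for x m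
    unfolding shift_def using that W subspace_diff subspace_scale by blast
  have "\<exists>h\<in>gen_eigenspace m \<inter> W. shift l h = x" if "(shift m ^^ n) x = 0" "x \<in> W" for n x
    using that
  proof (induction n arbitrary: x)
    case 0
    then show ?case
      using subspace_0[OF subspace_gen_eigenspace] subspace_0[OF W(1)] shift_funpow_0[of 1 l] by auto
  next
    case (Suc n)
    have "(shift m ^^ n) (shift m x) = 0" using Suc.prems(1) by (simp add: funpow_swap1)
    then obtain h where h: "h \<in> gen_eigenspace m" "h \<in> W" "shift l h = shift m x"
      using Suc.IH sW[OF Suc.prems(2)] by blast
    define h' where "h' = scale (inverse (m - l)) (x - h)"
    have "shift l (x - h) = shift l x - shift l h"
      using shift_add[of l "x - h" h] by simp
    then have "shift l h' = x"
      using \<open>l \<noteq> m\<close> shift_shift[of l x m] by (simp add: h'_def shift_scale h(3))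
    moreover have "x \<in> gen_eigenspace m" unfolding gen_eigenspace_def using Suc.prems(1) by blast
    then have "h' \<in> gen_eigenspace m \<inter> W"
      unfolding h'_def using h Suc.prems(2) W(1) subspace_gen_eigenspace
      by (auto intro: subspace_scale subspace_diff)
    ultimately show ?case by blast
  qed
  then show ?thesis using assms(4) by (auto simp: gen_eigenspace_def)
qed

section \<open>Polynomials in the operator, and spanning by generalised eigenvectors\<close>

definition poly_op :: "'k poly \<Rightarrow> 'a \<Rightarrow> 'a"
  where "poly_op p x = (\<Sum>i\<le>degree p. scale (coeff p i) ((d ^^ i) x))"

lemma poly_op_bound: "degree p \<le> n \<Longrightarrow> poly_op p x = (\<Sum>i\<le>n. scale (coeff p i) ((d ^^ i) x))"
  unfolding poly_op_def by (rule sum.mono_neutral_left) (auto simp: coeff_eq_0)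

lemma poly_op_linear_factor: "poly_op ([:- l, 1:] * q) x = shift l (poly_op q x)"
proof -
  let ?n = "degree q"
  have d_sum: "d (sum f A) = (\<Sum>i\<in>A. d (f i))" for f and A :: "nat set"
    using d_scale[of 0 0] by (induction A rule: infinite_finite_induct) (simp_all add: d_add)
  have "degree ([:- l, 1:] * q) \<le> Suc ?n"
    using degree_mult_le[of "[:- l, 1:]" q] by simp
  then have "poly_op ([:- l, 1:] * q) x =
      (\<Sum>i\<le>Suc ?n. scale (coeff (pCons 0 q) i) ((d ^^ i) x) - scale (l * coeff q i) ((d ^^ i) x))"
    by (subst poly_op_bound[of _ "Suc ?n"]) (simp_all only: scale_left_diff_distrib[symmetric], simp add: coeff_pCons)
  also have "\<dots> = (\<Sum>i\<le>Suc ?n. scale (coeff (pCons 0 q) i) ((d ^^ i) x))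
      - scale l (\<Sum>i\<le>Suc ?n. scale (coeff q i) ((d ^^ i) x))"
    by (simp only: sum_subtractf scale_sum_right scale_scale)
  also have "(\<Sum>i\<le>Suc ?n. scale (coeff (pCons 0 q) i) ((d ^^ i) x)) = d (poly_op q x)"
    by (subst sum.atMost_Suc_shift) (simp add: poly_op_def d_sum d_scale)
  also have "(\<Sum>i\<le>Suc ?n. scale (coeff q i) ((d ^^ i) x)) = poly_op q x"
    by (rule poly_op_bound[symmetric]) simp
  finally show ?thesis by (simp add: shift_def)
qed

text \<open>The \<open>dimension + 1\<close> iterates of d on x are linearly dependent. They are
  treated as an indexed family because iterates may coincide.\<close>

lemma poly_op_annihilator: "\<exists>p. p \<noteq> 0 \<and> poly_op p x = 0"
proof -
  have "\<not> independent_modulo {0} {..dimension} (\<lambda>i. (d ^^ i) x)"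
  proof
    assume *: "independent_modulo {0} {..dimension} (\<lambda>i. (d ^^ i) x)"
    have "independent ((\<lambda>i. (d ^^ i) x) ` {..dimension})"
      using independent_modulo_union(1)[OF *, of "{}"] by (simp add: subspace_single_0 independent_empty)
    then have "card ((\<lambda>i. (d ^^ i) x) ` {..dimension}) \<le> dimension"
      using independent_card_le_dim[OF subset_UNIV] dim_UNIV dimension_def by metis
    then show False using card_image[OF independent_modulo_inj_on[OF *]] by simp
  qed
  then obtain c i where c: "(\<Sum>i\<le>dimension. scale (c i) ((d ^^ i) x)) = 0" "i \<le> dimension" "c i \<noteq> 0"
    by (auto simp: independent_modulo_def)
  define p where "p = (\<Sum>i\<le>dimension. monom (c i) i)"
  have coeff: "coeff p i = (if i \<le> dimension then c i else 0)" for i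
    by (simp add: p_def coeff_sum if_distrib sum.delta' cong: if_cong)
  have "degree p \<le> dimension" by (rule degree_le) (simp add: coeff)
  then have "poly_op p x = 0" using c(1) by (simp add: poly_op_bound coeff)
  moreover have "p \<noteq> 0" using coeff[of i] c(2,3) by auto
  ultimately show ?thesis by blast
qed

text \<open>
  If \<open>x \<in> W\<close> is outside the span, let \<open>p\<close> have minimal degree such that \<open>p(d) x\<close> is in the span, and split off
  a root \<open>l\<close> of \<open>p\<close>: the span then contains \<open>(d - l) y\<close> for some \<open>y \<in> W\<close> outside the span, although every element
  of the span is congruent modulo \<open>gen_eigenspace l\<close> to some \<open>(d - l) h\<close> with \<open>h\<close> in the span.
\<close>

lemma gen_eigenspace_span:
  assumes W: "subspace W" "\<And>x. x \<in> W \<Longrightarrow> d x \<in> W"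
  shows "W \<subseteq> span (\<Union>l. gen_eigenspace l \<inter> W)"
proof (rule ccontr)
  let ?U = "span (\<Union>l. gen_eigenspace l \<inter> W)"
  assume "\<not> W \<subseteq> ?U"
  then obtain x where x: "x \<in> W" "x \<notin> ?U" by blast
  define P where "P p \<longleftrightarrow> p \<noteq> 0 \<and> poly_op p x \<in> ?U" for p
  obtain p0 where "P p0" using poly_op_annihilator[of x] unfolding P_def by (metis span_zero)
  then obtain p where p: "P p" and min: "\<And>q. P q \<Longrightarrow> degree p \<le> degree q"
    using ex_has_least_nat[of P p0 degree] by auto
  have "degree p \<noteq> 0"
  proof
    assume "degree p = 0"
    then obtain a where a: "p = [:a:]" using degree_eq_zeroE by blast
    then have "scale a x \<in> ?U" "a \<noteq> 0" using p by (auto simp: P_def poly_op_def)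
    from span_scale[OF this(1), of "inverse a"] have "x \<in> ?U" using \<open>a \<noteq> 0\<close> by simp
    then show False using x(2) by contradiction
  qed
  then obtain l where "poly p l = 0" using alg_closed_imp_poly_has_root[of p] by auto
  then obtain q where q: "p = [:- l, 1:] * q" by (auto simp: poly_eq_0_iff_dvd)
  have "q \<noteq> 0" using p q by (auto simp: P_def)
  then have "degree q < degree p" unfolding q by (subst degree_mult_eq) auto
  then have yU: "poly_op q x \<notin> ?U" using min[of q] \<open>q \<noteq> 0\<close> by (auto simp: P_def)
  define y where "y = poly_op q x"
  have dW: "(d ^^ i) x \<in> W" for i using x(1) W(2) by (induction i) auto
  have yW: "y \<in> W" unfolding y_def poly_op_def using dW W(1) by (intro subspace_sum subspace_scale)
  have "shift l y \<in> ?U" using p unfolding P_def q poly_op_linear_factor y_def by blast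
  moreover have "\<exists>h\<in>?U \<inter> W. u - shift l h \<in> gen_eigenspace l \<inter> W" if "u \<in> ?U" for u
    using that
  proof (induction rule: span_induct_alt)
    case base
    then show ?case
      using subspace_0[OF W(1)] span_zero subspace_0[OF subspace_gen_eigenspace[of l]] shift_funpow_0[of 1 l]
      by (intro bexI[of _ 0]) auto
  next
    case (step c v u)
    then obtain h where h: "h \<in> ?U \<inter> W" "u - shift l h \<in> gen_eigenspace l \<inter> W" by blast
    obtain m where m: "v \<in> gen_eigenspace m \<inter> W" using step by blast
    have "\<exists>k\<in>?U \<inter> W. v - shift l k \<in> gen_eigenspace l \<inter> W"
    proof (cases "m = l")
      case True
      then have "v - shift l 0 \<in> gen_eigenspace l \<inter> W" using m shift_funpow_0[of 1 l] by auto
      then show ?thesis using subspace_0[OF W(1)] by (intro bexI[of _ 0]) (simp_all add: span_zero)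
    next
      case False
      have "\<exists>k\<in>gen_eigenspace m \<inter> W. shift l k = v"
        by (rule shift_surj_gen_eigenspace[OF W(1) W(2)]) (use False m in auto)
      then obtain k where k: "k \<in> gen_eigenspace m \<inter> W" "shift l k = v" by (elim bexE)
      have "k \<in> ?U" by (rule span_base) (use k(1) in blast)
      moreover have "v - shift l k \<in> gen_eigenspace l \<inter> W"
        using k(2) subspace_0[OF W(1)] subspace_0[OF subspace_gen_eigenspace[of l]] by simp
      ultimately show ?thesis using k(1) by blast
    qed
    then obtain k where k: "k \<in> ?U \<inter> W" "v - shift l k \<in> gen_eigenspace l \<inter> W" by blast
    have "scale c v + u - shift l (scale c k + h) = scale c (v - shift l k) + (u - shift l h)"
      by (simp add: shift_add shift_scale scale_right_diff_distrib)
    also have "\<dots> \<in> gen_eigenspace l \<inter> W"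
      using h k W(1) subspace_gen_eigenspace[of l] by (auto intro!: subspace_add subspace_scale)
    finally have "scale c v + u - shift l (scale c k + h) \<in> gen_eigenspace l \<inter> W" .
    moreover have "scale c k + h \<in> ?U \<inter> W"
      using h k W(1) by (auto intro!: subspace_add subspace_scale span_add span_scale)
    ultimately show ?case by blast
  qed
  ultimately obtain h where h: "h \<in> ?U" "h \<in> W" "shift l y - shift l h \<in> gen_eigenspace l" by blast
  \<comment> \<open>Now (d - l)(y - h) is a generalised eigenvector for l. Hence so is y - h, which
    forces y into the span.\<close>
  have "shift l (y - h) = shift l y - shift l h" using shift_add[of l "y - h" h] by simp
  then obtain n where "(shift l ^^ n) (shift l (y - h)) = 0" using h(3) by (auto simp: gen_eigenspace_def)
  then have "(shift l ^^ Suc n) (y - h) = 0" by (simp add: funpow_swap1)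
  then have "y - h \<in> gen_eigenspace l \<inter> W"
    unfolding gen_eigenspace_def using subspace_diff[OF W(1) yW h(2)] by blast
  then have "y - h \<in> ?U" by (intro span_base) blast
  then have "y \<in> ?U" using span_add[of "y - h" _ h] h(1) by simp
  then show False using yU by (simp add: y_def)
qed

end

section \<open>Presentations inside an algebra\<close>

text \<open>The data e, y amount to a unital algebra homomorphism from kQ to A, which is
  \<open>realise\<close> below. Keeping them as elements of A turns a change of presentation into a
  mere change of y.\<close>

locale quiver_system = algebra_over scale
  for scale :: "'k::field \<Rightarrow> 'a::{ring, monoid_mult} \<Rightarrow> 'a" +
  fixes Q :: "('v, 'e) pre_digraph" and e :: "'v \<Rightarrow> 'a" and y :: "'e \<Rightarrow> 'a"
  assumes fin: "fin_digraph Q"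
    and e_mult: "\<lbrakk>u \<in> verts Q; v \<in> verts Q\<rbrakk> \<Longrightarrow> e u * e v = (if u = v then e u else 0)"
    and e_sum: "(\<Sum>v\<in>verts Q. e v) = 1"
    and y_head: "a \<in> arcs Q \<Longrightarrow> e (head Q a) * y a = y a"
    and y_tail: "a \<in> arcs Q \<Longrightarrow> y a * e (tail Q a) = y a"
begin

primrec arrow_prod :: "'e list \<Rightarrow> 'a"
  where
    "arrow_prod [] = 1"
  | "arrow_prod (a # as) = arrow_prod as * y a"

text \<open>\<open>arrow_prod\<close> does not know the starting vertex. The factor
  \<open>e (fst p)\<close> supplies it for trivial paths and changes nothing for the other paths of
  Q.\<close>

definition path_elem :: "('v, 'e) qpath \<Rightarrow> 'a"
  where "path_elem p = arrow_prod (snd p) * e (fst p)"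

definition realise :: "(('v, 'e) qpath \<Rightarrow>\<^sub>0 'k) \<Rightarrow> 'a"
  where "realise x = (\<Sum>p\<in>Poly_Mapping.keys x. scale (Poly_Mapping.lookup x p) (path_elem p))"

lemma wf: "wf_digraph Q" and finite_verts: "finite (verts Q)" and finite_arcs: "finite (arcs Q)"
  using fin by (simp_all add: fin_digraph_def fin_digraph_axioms_def)

lemma arc_verts: "a \<in> arcs Q \<Longrightarrow> tail Q a \<in> verts Q" "a \<in> arcs Q \<Longrightarrow> head Q a \<in> verts Q"
  using wf by (simp_all add: wf_digraph_def)

lemma arrow_prod_append: "arrow_prod (as @ bs) = arrow_prod bs * arrow_prod as"
  by (induction as) (simp_all add: mult.assoc)

lemma path_verts: "p \<in> paths Q \<Longrightarrow> psource p \<in> verts Q" "p \<in> paths Q \<Longrightarrow> ptarget Q p \<in> verts Q"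
  using ptarget_vert[OF wf] by (auto simp: paths_iff psource_def)

lemma path_Cons:
  "(u, a # as) \<in> paths Q \<longleftrightarrow> a \<in> arcs Q \<and> u = tail Q a \<and> (head Q a, as) \<in> paths Q"
  "ptarget Q (u, a # as) = ptarget Q (head Q a, as)"
proof -
  show *: "ptarget Q (u, a # as) = ptarget Q (head Q a, as)" by (simp add: ptarget_def')
  show "(u, a # as) \<in> paths Q \<longleftrightarrow> a \<in> arcs Q \<and> u = tail Q a \<and> (head Q a, as) \<in> paths Q"
    using arc_verts by (auto simp: paths_iff pre_digraph.cas.simps *)
qed

lemma path_elem_trivial [simp]: "path_elem (v, []) = e v"
  by (simp add: path_elem_def)

lemma path_elem_Cons: "a \<in> arcs Q \<Longrightarrow> path_elem (tail Q a, a # as) = path_elem (head Q a, as) * y a"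
  by (simp add: path_elem_def mult.assoc y_head y_tail)

lemma path_elem_arrow: "a \<in> arcs Q \<Longrightarrow> path_elem (tail Q a, [a]) = y a"
  by (simp add: path_elem_Cons y_head)

lemma path_elem_source:
  assumes "p \<in> paths Q" "v \<in> verts Q"
  shows "path_elem p * e v = (if v = psource p then path_elem p else 0)"
  using e_mult[of "fst p" v] path_verts(1)[OF assms(1)] assms(2)
  by (auto simp: path_elem_def psource_def mult.assoc)

lemma path_elem_target:
  assumes "p \<in> paths Q" "v \<in> verts Q"
  shows "e v * path_elem p = (if v = ptarget Q p then path_elem p else 0)"
proof -
  have "e v * path_elem (u, as) = (if v = ptarget Q (u, as) then path_elem (u, as) else 0)"
    if "(u, as) \<in> paths Q" for u as
    using that
  proof (induction as arbitrary: u)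
    case Nil
    then show ?case using e_mult[OF assms(2)] by (auto simp: psource_def)
  next
    case (Cons a as)
    then have a: "a \<in> arcs Q" "u = tail Q a" "(head Q a, as) \<in> paths Q" by (simp_all add: path_Cons)
    show ?case
      using Cons.IH[OF a(3)] by (simp add: a(2) path_elem_Cons[OF a(1)] path_Cons(2) mult.assoc[symmetric])
  qed
  from this[of "fst p" "snd p"] show ?thesis using assms(1) by simp
qed

lemma path_elem_mult:
  assumes "p \<in> paths Q" "q \<in> paths Q"
  shows "path_elem p * path_elem q = (if ptarget Q q = psource p then path_elem (pcomp p q) else 0)"
proof -
  have "path_elem p * path_elem q = arrow_prod (snd p) * (e (psource p) * path_elem q)"
    by (simp add: path_elem_def psource_def mult.assoc)
  also have "\<dots> = (if ptarget Q q = psource p then path_elem (pcomp p q) else 0)"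
    using path_elem_target[OF assms(2) path_verts(1)[OF assms(1)]]
    by (auto simp: path_elem_def pcomp_def arrow_prod_append mult.assoc)
  finally show ?thesis .
qed

section \<open>The homomorphism from the path algebra\<close>

lemma realise_superset:
  assumes "finite S" "Poly_Mapping.keys x \<subseteq> S"
  shows "realise x = (\<Sum>p\<in>S. scale (Poly_Mapping.lookup x p) (path_elem p))"
  unfolding realise_def
  by (rule sum.mono_neutral_left) (use assms in \<open>auto simp: in_keys_iff\<close>)

lemma realise_add: "realise (x + z) = realise x + realise z"
proof -
  let ?S = "Poly_Mapping.keys x \<union> Poly_Mapping.keys z"
  have "Poly_Mapping.keys (x + z) \<subseteq> ?S" by (rule Poly_Mapping.keys_add)
  then show ?thesis
    by (simp add: realise_superset[of ?S] lookup_add scale_left_distrib sum.distrib)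
qed

lemma realise_0 [simp]: "realise 0 = 0"
  by (simp add: realise_def)

lemma realise_sum: "realise (sum f S) = (\<Sum>s\<in>S. realise (f s))"
  by (induction S rule: infinite_finite_induct) (simp_all add: realise_add)

lemma realise_single: "realise (Poly_Mapping.single p c) = scale c (path_elem p)"
  by (simp add: realise_superset[of "{p}"])

lemma realise_map: "realise (Poly_Mapping.map ((*) c) x) = scale c (realise x)"
proof -
  have "Poly_Mapping.keys (Poly_Mapping.map ((*) c) x) \<subseteq> Poly_Mapping.keys x"
    by (auto simp: in_keys_iff Poly_Mapping.map.rep_eq)
  then show ?thesis
    by (subst (1 2) realise_superset[of "Poly_Mapping.keys x"])
      (auto simp: Poly_Mapping.map.rep_eq when_def scale_sum_right in_keys_iff intro!: sum.cong)
qed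

lemma realise_mult:
  assumes "Poly_Mapping.keys x \<subseteq> paths Q" "Poly_Mapping.keys z \<subseteq> paths Q"
  shows "realise (path_mult Q x z) = realise x * realise z"
proof -
  have "realise (path_mult Q x z) = (\<Sum>p\<in>Poly_Mapping.keys x. \<Sum>q\<in>Poly_Mapping.keys z.
      scale (Poly_Mapping.lookup x p) (path_elem p) * scale (Poly_Mapping.lookup z q) (path_elem q))"
    unfolding path_mult_def realise_sum
    using assms
    by (auto simp: realise_single path_elem_mult scale_mult_left scale_mult_right subset_iff
        mult.commute intro!: sum.cong)
  then show ?thesis by (simp add: realise_def sum_product)
qed

lemma realise_one: "realise (\<Sum>v\<in>verts Q. Poly_Mapping.single (v, []) 1) = 1"
  by (simp add: realise_sum realise_single e_sum)

lemma range_realise: "realise ` carrier (path_algebra Q) = span (path_elem ` paths Q)"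
proof (intro subset_antisym subsetI)
  fix x assume "x \<in> span (path_elem ` paths Q)"
  then show "x \<in> realise ` carrier (path_algebra Q)"
  proof (induction rule: span_induct_alt)
    case base
    show ?case by (intro image_eqI[of _ _ 0]) (auto simp: path_algebra_def)
  next
    case (step c x z)
    then obtain p w where pw: "p \<in> paths Q" "x = path_elem p" "Poly_Mapping.keys w \<subseteq> paths Q" "z = realise w"
      by (auto simp: path_algebra_def)
    have "Poly_Mapping.keys (Poly_Mapping.single p c + w) \<subseteq> paths Q"
      using pw Poly_Mapping.keys_add[of "Poly_Mapping.single p c" w] by (auto split: if_splits)
    then show ?case
      by (intro image_eqI[of _ _ "Poly_Mapping.single p c + w"])
        (simp_all add: realise_add realise_single pw path_algebra_def)
  qed
qed (auto simp: realise_def path_algebra_def intro!: span_sum span_scale intro: span_base)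

lemma ring_hom_realise: "realise \<in> ring_hom (path_algebra Q) type_ring"
  by (rule ring_hom_memI) (simp_all add: path_algebra_def type_ring_def realise_mult realise_add realise_one)

lemma ring_type_ring: "ring (type_ring :: 'a ring)"
proof (rule ringI)
  show "abelian_group (type_ring :: 'a ring)"
  proof (rule abelian_groupI)
    fix x :: 'a show "\<exists>y\<in>carrier type_ring. y \<oplus>\<^bsub>type_ring\<^esub> x = \<zero>\<^bsub>type_ring\<^esub>"
      by (intro bexI[of _ "- x"]) (simp_all add: type_ring_def)
  qed (simp_all add: type_ring_def add_ac)
  show "Group.monoid (type_ring :: 'a ring)"
    by (rule monoidI) (simp_all add: type_ring_def mult.assoc)
qed (simp_all add: type_ring_def distrib_left distrib_right)

lemma ring_hom_ring_realise: "ring_hom_ring (path_algebra Q) type_ring realise"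
  by (rule ring_hom_ringI2[OF ring_path_algebra[OF fin] ring_type_ring ring_hom_realise])

end

text \<open>Admissibility of the kernel of \<open>realise\<close>, expressed in A:
  \<open>generated\<close> is surjectivity, \<open>nilpotent\<close> puts a power of the arrow ideal
  into the kernel, and \<open>minimal\<close> puts the kernel into the square of the arrow
  ideal.\<close>

locale presentation = quiver_system scale Q e y
  for scale :: "'k::field \<Rightarrow> 'a::{ring, monoid_mult} \<Rightarrow> 'a"
    and Q :: "('v, 'e) pre_digraph" and e y +
  assumes generated: "span (path_elem ` paths Q) = UNIV"
    and nilpotent: "\<exists>m. \<forall>p\<in>paths Q. m \<le> length (snd p) \<longrightarrow> path_elem p = 0"
    and minimal: "\<lbrakk>Poly_Mapping.keys x \<subseteq> paths Q; realise x = 0; p \<in> Poly_Mapping.keys x\<rbrakk>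
      \<Longrightarrow> 2 \<le> length (snd p)"
begin

definition relations :: "(('v, 'e) qpath \<Rightarrow>\<^sub>0 'k) set"
  where "relations = {x. Poly_Mapping.keys x \<subseteq> paths Q \<and> realise x = 0}"

lemma relations_kernel: "relations = a_kernel (path_algebra Q) type_ring realise"
  by (auto simp: relations_def a_kernel_def' path_algebra_def type_ring_def)

lemma admissible_presentation_relations: "admissible_presentation Q relations"
proof -
  interpret R: ring_hom_ring "path_algebra Q" type_ring realise by (rule ring_hom_ring_realise)
  have id: "ideal relations (path_algebra Q)" unfolding relations_kernel by (rule R.kernel_is_ideal)
  interpret I: ideal relations "path_algebra Q" by (rule id)
  obtain m where m: "\<And>p. p \<in> paths Q \<Longrightarrow> m \<le> length (snd p) \<Longrightarrow> path_elem p = 0"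
    using nilpotent by blast
  \<comment> \<open>Admissibility asks for an exponent of at least 2, hence m + 2 in place of
    m.\<close>
  have "arrow_ideal_power Q (m + 2) \<subseteq> relations"
    using m by (auto simp: arrow_ideal_power_def relations_def path_algebra_def realise_def subset_iff
        intro!: sum.neutral)
  moreover have "relations \<subseteq> arrow_ideal_power Q 2"
    using minimal by (auto simp: arrow_ideal_power_def relations_def path_algebra_def)
  ultimately have adm: "admissible_ideal Q relations"
    unfolding admissible_ideal_def using id by (intro conjI exI[of _ "m + 2"]) auto
  let ?h = "\<lambda>X. the_elem (realise ` X)"
  have surj: "realise ` carrier (path_algebra Q) = carrier (type_ring :: 'a ring)"
    using range_realise generated by (simp add: type_ring_def)
  have iso: "?h \<in> ring_iso (path_algebra Q Quot relations) type_ring"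
    unfolding relations_kernel by (rule R.FactRing_iso_set[OF surj])
  have h: "?h (relations +>\<^bsub>path_algebra Q\<^esub> x) = realise x" if x: "x \<in> carrier (path_algebra Q)" for x
  proof -
    have "relations +>\<^bsub>path_algebra Q\<^esub> x = {z + x |z. z \<in> relations}"
      by (auto simp: a_r_coset_def' path_algebra_def)
    moreover have "0 \<in> relations" by (simp add: relations_def)
    ultimately have "realise ` (relations +>\<^bsub>path_algebra Q\<^esub> x) = {realise x}"
      by (force simp: realise_add relations_def image_iff)
    then show ?thesis by simp
  qed
  have "Poly_Mapping.map ((*) c) x \<in> carrier (path_algebra Q)" if "x \<in> carrier (path_algebra Q)"
    for c :: 'k and x :: "('v, 'e) qpath \<Rightarrow>\<^sub>0 'k"
    using that by (auto simp: path_algebra_def in_keys_iff Poly_Mapping.map.rep_eq when_def split: if_splits)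
  then have "\<forall>c. \<forall>x\<in>carrier (path_algebra Q).
        ?h (relations +>\<^bsub>path_algebra Q\<^esub> Poly_Mapping.map ((*) c) x) =
          scale c (?h (relations +>\<^bsub>path_algebra Q\<^esub> x))"
    by (simp add: h realise_map)
  then show ?thesis
    unfolding admissible_presentation_def using fin adm iso by (intro conjI bexI[of _ ?h])
qed

end

text \<open>The vertices and arrows are sent to their images under kQ -> kQ/I -> A. The composite
  has kernel I and agrees with \<open>realise\<close> on paths, hence everywhere, so admissibility
  of I turns into the three conditions on e and y.\<close>

lemma (in algebra_over) admissible_presentationD:
  assumes "admissible_presentation Q I"
  shows "\<exists>e y. presentation scale Q e y"
proof -
  let ?R = "path_algebra Q :: (('b, 'c) qpath \<Rightarrow>\<^sub>0 'k) ring"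
  let ?S = "\<lambda>p. Poly_Mapping.single p (1 :: 'k)"
  obtain \<phi> where fin: "fin_digraph Q" and adm: "admissible_ideal Q I"
    and iso: "\<phi> \<in> ring_iso (?R Quot I) (type_ring :: 'a ring)"
    and sc: "\<And>c x. x \<in> carrier ?R \<Longrightarrow> \<phi> (I +>\<^bsub>?R\<^esub> Poly_Mapping.map ((*) c) x) = scale c (\<phi> (I +>\<^bsub>?R\<^esub> x))"
    using assms unfolding admissible_presentation_def by blast
  have idl: "ideal I ?R" using adm by (simp add: admissible_ideal_def)
  interpret R: ring ?R by (rule ring_path_algebra[OF fin])
  interpret I: ideal I ?R by (rule idl)
  interpret F: fin_digraph Q by (rule fin)
  define \<psi> where "\<psi> = (\<lambda>x. \<phi> (I +>\<^bsub>?R\<^esub> x))"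
  have hom: "\<psi> \<in> ring_hom ?R type_ring"
    using ring_hom_trans[OF I.rcos_ring_hom, of \<phi> type_ring] iso
    by (auto simp: ring_iso_def \<psi>_def comp_def)
  have carr: "x \<in> carrier ?R \<longleftrightarrow> Poly_Mapping.keys x \<subseteq> paths Q" for x by (simp add: path_algebra_def)
  have mult: "\<psi> (path_mult Q x z) = \<psi> x * \<psi> z" if "x \<in> carrier ?R" "z \<in> carrier ?R" for x z
    using ring_hom_mult[OF hom that] by (simp add: path_algebra_def type_ring_def)
  have add: "\<psi> (x + z) = \<psi> x + \<psi> z" if "x \<in> carrier ?R" "z \<in> carrier ?R" for x z
    using ring_hom_add[OF hom that] by (simp add: path_algebra_def type_ring_def)
  have one: "\<psi> (\<Sum>v\<in>verts Q. ?S (v, [])) = 1"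
    using ring_hom_one[OF hom] by (simp add: path_algebra_def type_ring_def)
  have zero: "\<psi> 0 = 0" using add[of 0 0] by (simp add: carr)
  have sum: "\<psi> (sum f A) = (\<Sum>s\<in>A. \<psi> (f s))" if "\<And>s. s \<in> A \<Longrightarrow> f s \<in> carrier ?R" for f and A :: "('b, 'c) qpath set"
    using that
  proof (induction A rule: infinite_finite_induct)
    case (insert s A)
    have "sum f A \<in> carrier ?R" unfolding carr by (rule keys_sum_subset) (use insert.prems carr in auto)
    then show ?case using insert by (simp add: add)
  qed (simp_all add: zero)
  have vsum: "\<psi> (\<Sum>v\<in>V. ?S (v, [])) = (\<Sum>v\<in>V. \<psi> (?S (v, [])))" if "V \<subseteq> verts Q" for V
    using that
  proof (induction V rule: infinite_finite_induct)
    case (insert s A)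
    have "(\<Sum>v\<in>A. ?S (v, [])) \<in> carrier ?R" unfolding carr by (rule keys_sum_subset) (use insert.prems in auto)
    then show ?case using insert by (simp add: add carr)
  qed (simp_all add: zero)
  have single: "\<psi> (Poly_Mapping.single p c) = scale c (\<psi> (?S p))" if "p \<in> paths Q" for p c
  proof -
    have "Poly_Mapping.map ((*) c) (?S p) = Poly_Mapping.single p c"
      by (rule poly_mapping_eqI) (simp add: Poly_Mapping.map.rep_eq lookup_single when_def)
    then show ?thesis using sc[of "?S p" c] that by (simp add: \<psi>_def carr)
  qed
  define e where "e = (\<lambda>v. \<psi> (?S (v, [])))"
  define y where "y = (\<lambda>a. \<psi> (?S (tail Q a, [a])))"
  have arrow: "(tail Q a, [a]) \<in> paths Q" if "a \<in> arcs Q" for a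
    using that by (auto simp: paths_iff pre_digraph.cas.simps ptarget_def')
  interpret P: quiver_system scale Q e y
  proof
    show "e u * e v = (if u = v then e u else 0)" if "u \<in> verts Q" "v \<in> verts Q" for u v
      using mult[of "?S (u, [])" "?S (v, [])"] that zero
      by (auto simp: carr path_mult_single psource_def pcomp_def e_def)
    show "(\<Sum>v\<in>verts Q. e v) = 1" using one vsum[of "verts Q"] by (simp add: e_def)
    show "e (head Q a) * y a = y a" "y a * e (tail Q a) = y a" if "a \<in> arcs Q" for a
      using mult[of "?S (head Q a, [])" "?S (tail Q a, [a])"] mult[of "?S (tail Q a, [a])" "?S (tail Q a, [])"]
        that arrow[OF that]
      by (auto simp: carr path_mult_single psource_def ptarget_def' pcomp_def e_def y_def)
  qed
  have pe: "\<psi> (?S (u, as)) = P.path_elem (u, as)" if "(u, as) \<in> paths Q" for u as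
    using that
  proof (induction as arbitrary: u)
    case Nil then show ?case by (simp only: P.path_elem_trivial) (simp only: e_def)
  next
    case (Cons a as)
    then have a: "a \<in> arcs Q" "u = tail Q a" "(head Q a, as) \<in> paths Q" by (simp_all add: P.path_Cons)
    have "path_mult Q (?S (head Q a, as)) (?S (tail Q a, [a])) = ?S (u, a # as)"
      by (simp add: path_mult_single ptarget_def' psource_def pcomp_def a(2))
    moreover have "\<psi> (path_mult Q (?S (head Q a, as)) (?S (tail Q a, [a]))) =
        \<psi> (?S (head Q a, as)) * \<psi> (?S (tail Q a, [a]))"
      by (rule mult) (use a arrow in \<open>auto simp: carr\<close>)
    moreover have "y a = \<psi> (?S (tail Q a, [a]))" by (simp only: y_def)
    ultimately show ?case using Cons.IH[OF a(3)] a(2) P.path_elem_Cons[OF a(1)] by metis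
  qed
  have re: "\<psi> x = P.realise x" if x: "Poly_Mapping.keys x \<subseteq> paths Q" for x
  proof -
    have "\<psi> x = (\<Sum>p\<in>Poly_Mapping.keys x. \<psi> (Poly_Mapping.single p (Poly_Mapping.lookup x p)))"
    proof (subst sum[symmetric])
      show "Poly_Mapping.single p (Poly_Mapping.lookup x p) \<in> carrier ?R"
        if "p \<in> Poly_Mapping.keys x" for p using subsetD[OF x that] unfolding carr by simp
    qed (rule arg_cong[OF sum_of_singles])
    also have "\<dots> = P.realise x"
      unfolding P.realise_def
    proof (rule sum.cong)
      fix p assume "p \<in> Poly_Mapping.keys x"
      then have p: "p \<in> paths Q" using x by blast
      then show "\<psi> (Poly_Mapping.single p (Poly_Mapping.lookup x p)) =
          scale (Poly_Mapping.lookup x p) (P.path_elem p)"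
        using single[OF p, of "Poly_Mapping.lookup x p"] pe[of "fst p" "snd p"] by (simp only: prod.collapse)
    qed simp
    finally show ?thesis .
  qed
  have ker: "x \<in> I" if "x \<in> carrier ?R" "\<psi> x = 0" for x
  proof -
    have inj: "inj_on \<phi> (carrier (?R Quot I))" using iso by (simp add: ring_iso_def bij_betw_def)
    have c: "I +>\<^bsub>?R\<^esub> x \<in> carrier (?R Quot I)" "I +>\<^bsub>?R\<^esub> 0 \<in> carrier (?R Quot I)"
      using that(1) by (auto simp: FactRing_def A_RCOSETS_def' carr)
    have "\<phi> (I +>\<^bsub>?R\<^esub> x) = \<phi> (I +>\<^bsub>?R\<^esub> 0)" using that(2) zero by (simp add: \<psi>_def)
    then have "I +>\<^bsub>?R\<^esub> x = I +>\<^bsub>?R\<^esub> 0" using inj_onD[OF inj _ c] by blast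
    moreover have "x \<in> I +>\<^bsub>?R\<^esub> x" using I.a_rcos_self[OF that(1)] .
    moreover have "I +>\<^bsub>?R\<^esub> 0 = I" by (auto simp: a_r_coset_def' path_algebra_def)
    ultimately show ?thesis by simp
  qed
  have IR: "x \<in> carrier ?R \<and> \<psi> x = 0" if "x \<in> I" for x
  proof -
    have "x \<in> carrier ?R" using that I.a_Hcarr by blast
    moreover have "I +>\<^bsub>?R\<^esub> x = I +>\<^bsub>?R\<^esub> 0"
      using I.a_rcos_const[OF that] by (auto simp: a_r_coset_def' path_algebra_def)
    ultimately show ?thesis using zero by (simp add: \<psi>_def)
  qed
  have "presentation scale Q e y"
  proof
    have "\<psi> ` carrier ?R = UNIV"
    proof -
      have "\<phi> ` carrier (?R Quot I) = UNIV" using iso by (simp add: ring_iso_def bij_betw_def type_ring_def)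
      moreover have "carrier (?R Quot I) = (\<lambda>x. I +>\<^bsub>?R\<^esub> x) ` carrier ?R"
        by (auto simp: FactRing_def A_RCOSETS_def')
      ultimately show ?thesis by (simp add: \<psi>_def image_image)
    qed
    moreover have "\<psi> ` carrier ?R = P.realise ` carrier ?R" using re by (intro image_cong) (auto simp: carr)
    ultimately show "span (P.path_elem ` paths Q) = UNIV" using P.range_realise by simp
    obtain m where m: "arrow_ideal_power Q m \<subseteq> I" using adm by (auto simp: admissible_ideal_def)
    show "\<exists>m. \<forall>p\<in>paths Q. m \<le> length (snd p) \<longrightarrow> P.path_elem p = 0"
    proof (intro exI[of _ m] ballI impI)
      fix p assume p: "p \<in> paths Q" "m \<le> length (snd p)"
      then have "?S p \<in> I" using m by (auto simp: arrow_ideal_power_def carr)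
      then show "P.path_elem p = 0" using IR[of "?S p"] pe[of "fst p" "snd p"] p by simp
    qed
    show "2 \<le> length (snd p)"
      if "Poly_Mapping.keys x \<subseteq> paths Q" "P.realise x = 0" "p \<in> Poly_Mapping.keys x" for x p
      using ker[of x] that re[of x] adm by (auto simp: carr admissible_ideal_def arrow_ideal_power_def)
  qed
  then show ?thesis by blast
qed

section \<open>The radical and the Gabriel quiver\<close>

context presentation
begin

text \<open>The image in A of the k-th power of the arrow ideal. For k = 1 and k = 2 it is
  identified below with the radical and its square.\<close>

definition path_ideal :: "nat \<Rightarrow> 'a set"
  where "path_ideal k = span (path_elem ` {p \<in> paths Q. k \<le> length (snd p)})"

lemma subspace_path_ideal: "subspace (path_ideal k)"
  by (simp add: path_ideal_def)

lemma path_elem_path_ideal: "p \<in> paths Q \<Longrightarrow> k \<le> length (snd p) \<Longrightarrow> path_elem p \<in> path_ideal k"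
  unfolding path_ideal_def by (rule span_base) blast

lemma path_ideal_0: "path_ideal 0 = UNIV"
  using generated by (simp add: path_ideal_def)

lemma path_ideal_mono: "i \<le> j \<Longrightarrow> path_ideal j \<subseteq> path_ideal i"
  unfolding path_ideal_def by (rule span_mono) auto

lemma path_ideal_mult:
  assumes "x \<in> path_ideal i" "z \<in> path_ideal j"
  shows "x * z \<in> path_ideal (i + j)"
proof -
  have 1: "path_elem p * z \<in> path_ideal (i + j)" if p: "p \<in> paths Q" "i \<le> length (snd p)" for p
    using assms(2) unfolding path_ideal_def[of j]
  proof (induction rule: span_induct_alt)
    case base
    show ?case by (simp add: subspace_0[OF subspace_path_ideal])
  next
    case (step c x z)
    then obtain q where q: "q \<in> paths Q" "j \<le> length (snd q)" "x = path_elem q" by blast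
    have "path_elem (pcomp p q) \<in> path_ideal (i + j)" if "ptarget Q q = psource p"
      using p q that by (intro path_elem_path_ideal pcomp_paths) (auto simp: pcomp_def)
    then have "path_elem p * x \<in> path_ideal (i + j)"
      by (simp add: q path_elem_mult p(1) subspace_0[OF subspace_path_ideal])
    then show ?case using step(2) subspace_path_ideal
      by (simp add: distrib_left scale_mult_right subspace_add subspace_scale)
  qed
  show ?thesis
    using assms(1) unfolding path_ideal_def[of i]
  proof (induction rule: span_induct_alt)
    case base
    show ?case by (simp add: subspace_0[OF subspace_path_ideal])
  next
    case (step c x w)
    then have "x * z \<in> path_ideal (i + j)" using 1 by auto
    then show ?case using step(2) subspace_path_ideal
      by (simp add: distrib_right scale_mult_left subspace_add subspace_scale)
  qed
qed

lemma path_ideal_mult_left: "x \<in> path_ideal k \<Longrightarrow> z * x \<in> path_ideal k"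
  and path_ideal_mult_right: "x \<in> path_ideal k \<Longrightarrow> x * z \<in> path_ideal k"
  using path_ideal_mult[of z 0 x k] path_ideal_mult[of x k z 0] by (simp_all add: path_ideal_0)

lemma path_ideal_nilpotent: "\<exists>m. path_ideal m = {0}"
proof -
  obtain m where m: "\<And>p. p \<in> paths Q \<Longrightarrow> m \<le> length (snd p) \<Longrightarrow> path_elem p = 0"
    using nilpotent by blast
  have "path_ideal m \<subseteq> span {0}" unfolding path_ideal_def using m by (intro span_mono) auto
  then show ?thesis using subspace_0[OF subspace_path_ideal[of m]] by auto
qed

lemma path_ideal_realise:
  "x \<in> path_ideal k \<Longrightarrow> \<exists>w. Poly_Mapping.keys w \<subseteq> {p \<in> paths Q. k \<le> length (snd p)} \<and> realise w = x"
  unfolding path_ideal_def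
proof (induction rule: span_induct_alt)
  case base
  show ?case by (intro exI[of _ 0]) simp
next
  case (step c x z)
  then obtain p w where pw: "p \<in> {p \<in> paths Q. k \<le> length (snd p)}" "x = path_elem p"
      "Poly_Mapping.keys w \<subseteq> {p \<in> paths Q. k \<le> length (snd p)}" "z = realise w" by auto
  have "Poly_Mapping.keys (Poly_Mapping.single p c + w) \<subseteq> {p \<in> paths Q. k \<le> length (snd p)}"
    using pw(1,3) Poly_Mapping.keys_add[of "Poly_Mapping.single p c" w] by (auto split: if_splits)
  then show ?case
    by (intro exI[of _ "Poly_Mapping.single p c + w"]) (simp add: realise_add realise_single pw)
qed

text \<open>The realised element also comes from a combination w of paths of length at least 2. The
  difference x - w is a relation, so by \<open>minimal\<close> it contains no shorter path
  either.\<close>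

lemma realise_path_ideal_2:
  assumes "Poly_Mapping.keys x \<subseteq> paths Q" "realise x \<in> path_ideal 2" "length (snd p) < 2"
  shows "Poly_Mapping.lookup x p = 0"
proof -
  obtain w where w: "Poly_Mapping.keys w \<subseteq> {p \<in> paths Q. 2 \<le> length (snd p)}" "realise w = realise x"
    using path_ideal_realise[OF assms(2)] by blast
  have "realise (x - w) + realise w = realise x" using realise_add[of "x - w" w] by simp
  then have "realise (x - w) = 0" using w(2) by simp
  moreover have "Poly_Mapping.keys (x - w) \<subseteq> paths Q"
    using assms(1) w(1) Poly_Mapping.keys_diff[of x w] by blast
  ultimately have "p \<notin> Poly_Mapping.keys (x - w)" using minimal[of "x - w" p] assms(3) by auto
  moreover have "p \<notin> Poly_Mapping.keys w" using w(1) assms(3) by auto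
  ultimately show ?thesis by (simp add: in_keys_iff lookup_minus)
qed

lemma e_notin_path_ideal_1: assumes "v \<in> verts Q" shows "e v \<notin> path_ideal 1"
proof
  assume "e v \<in> path_ideal 1"
  then obtain w where w: "Poly_Mapping.keys w \<subseteq> {p \<in> paths Q. 1 \<le> length (snd p)}" "realise w = e v"
    using path_ideal_realise by blast
  let ?x = "Poly_Mapping.single (v, []) 1 - w"
  have "realise ?x + realise w = e v" using realise_add[of ?x w] by (simp add: realise_single)
  then have "realise ?x \<in> path_ideal 2" using w(2) subspace_0[OF subspace_path_ideal] by simp
  moreover have "Poly_Mapping.keys ?x \<subseteq> paths Q"
    using w(1) assms Poly_Mapping.keys_diff[of "Poly_Mapping.single (v, []) (1 :: 'k)" w] by auto
  ultimately have "Poly_Mapping.lookup ?x (v, []) = 0" using realise_path_ideal_2 by simp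
  moreover have "(v, []) \<notin> Poly_Mapping.keys w" using w(1) by auto
  ultimately show False by (simp add: in_keys_iff lookup_minus)
qed

lemma arrow_path: "a \<in> arcs Q \<Longrightarrow> (tail Q a, [a]) \<in> paths Q"
  using arc_verts by (simp add: path_Cons)

lemma y_path_ideal_1: "a \<in> arcs Q \<Longrightarrow> y a \<in> path_ideal 1"
  using path_elem_path_ideal[OF arrow_path, of a 1] by (simp add: path_elem_arrow)

lemma sum_y_path_ideal_2:
  assumes "X \<subseteq> arcs Q" "(\<Sum>a\<in>X. scale (c a) (y a)) \<in> path_ideal 2" "a \<in> X"
  shows "c a = 0"
proof -
  let ?x = "\<Sum>a\<in>X. Poly_Mapping.single (tail Q a, [a]) (c a)"
  have fX: "finite X" using assms(1) finite_arcs finite_subset by blast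
  have "realise ?x = (\<Sum>a\<in>X. scale (c a) (y a))"
    unfolding realise_sum using assms(1) by (intro sum.cong) (auto simp: realise_single path_elem_arrow)
  moreover have "Poly_Mapping.keys ?x \<subseteq> paths Q"
    by (rule keys_sum_subset) (use assms(1) arrow_path in auto)
  ultimately have "Poly_Mapping.lookup ?x (tail Q a, [a]) = 0"
    using realise_path_ideal_2[of ?x "(tail Q a, [a])"] assms(2) by simp
  also have "Poly_Mapping.lookup ?x (tail Q a, [a]) = (\<Sum>b\<in>X. if b = a then c b else 0)"
    unfolding lookup_sum lookup_single by (intro sum.cong) (auto simp: when_def)
  also have "\<dots> = c a" using fX assms(3) by simp
  finally show ?thesis .
qed

lemma expand_e: "\<exists>c. x - (\<Sum>v\<in>verts Q. scale (c v) (e v)) \<in> path_ideal 1"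
proof -
  have "x \<in> span (path_elem ` paths Q)" using generated by simp
  then show ?thesis
  proof (induction rule: span_induct_alt)
    case base
    show ?case by (intro exI[of _ "\<lambda>_. 0"]) (simp add: subspace_0[OF subspace_path_ideal])
  next
    case (step b x z)
    then obtain p c where p: "p \<in> paths Q" "x = path_elem p"
      and c: "z - (\<Sum>v\<in>verts Q. scale (c v) (e v)) \<in> path_ideal 1" by blast
    show ?case
    proof (cases "snd p = []")
      case True
      define u where "u = fst p"
      have u: "u \<in> verts Q" "x = e u" using p True by (auto simp: paths_iff u_def path_elem_def)
      have "(\<Sum>v\<in>verts Q. scale (c v + (if v = u then b else 0)) (e v)) =
          (\<Sum>v\<in>verts Q. scale (c v) (e v)) + (\<Sum>v\<in>verts Q. if v = u then scale b (e u) else 0)"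
        unfolding sum.distrib[symmetric] by (rule sum.cong) (auto simp: scale_left_distrib)
      also have "(\<Sum>v\<in>verts Q. if v = u then scale b (e u) else 0) = scale b (e u)"
        using u finite_verts by simp
      finally show ?thesis using c u(2)
        by (intro exI[of _ "\<lambda>v. c v + (if v = u then b else 0)"]) (simp add: algebra_simps)
    next
      case False
      then have "scale b x \<in> path_ideal 1"
        using p path_elem_path_ideal[OF p(1), of 1] subspace_scale[OF subspace_path_ideal]
        by (cases "snd p") auto
      then have "scale b x + (z - (\<Sum>v\<in>verts Q. scale (c v) (e v))) \<in> path_ideal 1"
        using c subspace_add[OF subspace_path_ideal] by blast
      then show ?thesis by (intro exI[of _ c]) (simp add: algebra_simps)
    qed
  qed
qed

text \<open>The projective module A e_v has a one-dimensional top. Both the maximal left ideals that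
  compute the radical and the primitivity of \<open>e v\<close> rest on this.\<close>

lemma expand_mult_e: assumes "v \<in> verts Q" shows "\<exists>c. x * e v - scale c (e v) \<in> path_ideal 1"
proof -
  obtain c where c: "x - (\<Sum>u\<in>verts Q. scale (c u) (e u)) \<in> path_ideal 1" using expand_e by blast
  have "(\<Sum>u\<in>verts Q. scale (c u) (e u)) * e v = (\<Sum>u\<in>verts Q. if u = v then scale (c v) (e v) else 0)"
    unfolding sum_distrib_right
    by (rule sum.cong) (auto simp: scale_mult_left e_mult[OF _ assms])
  then have "(x - (\<Sum>u\<in>verts Q. scale (c u) (e u))) * e v = x * e v - scale (c v) (e v)"
    using assms finite_verts by (simp add: left_diff_distrib)
  then show ?thesis using path_ideal_mult_right[OF c] by metis
qed

lemma power_path_ideal: "x \<in> path_ideal 1 \<Longrightarrow> x ^ n \<in> path_ideal n"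
proof (induction n)
  case (Suc n)
  then show ?case using path_ideal_mult[of x 1 "x ^ n" n] by simp
qed (simp add: path_ideal_0)

lemma nilpotent_path_ideal_1: "x \<in> path_ideal 1 \<Longrightarrow> \<exists>n. x ^ n = 0"
proof -
  assume x: "x \<in> path_ideal 1"
  obtain n where n: "path_ideal n = {0}" using path_ideal_nilpotent ..
  have "x ^ n \<in> {0}" unfolding n[symmetric] by (rule power_path_ideal[OF x])
  then show ?thesis by blast
qed

lemma idempotent_path_ideal_1: assumes "x \<in> path_ideal 1" "x * x = x" shows "x = 0"
proof -
  obtain n where n: "x ^ n = 0" using nilpotent_path_ideal_1 assms(1) by blast
  have "x ^ Suc n = x" for n by (induction n) (use assms(2) in simp_all)
  moreover have "x ^ Suc n = 0" using n by simp
  ultimately show ?thesis by simp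
qed

text \<open>If M did not contain the nilpotent ideal, their sum K would be everything, so 1 = m + j
  with j nilpotent. Then M contains 1 - j, by telescoping every 1 - j^n, and finally 1.\<close>

lemma path_ideal_1_subset_maximal:
  assumes "maximal_left_ideal M"
  shows "path_ideal 1 \<subseteq> M"
proof
  fix x assume x: "x \<in> path_ideal 1"
  have li: "left_ideal M" and M_UNIV: "M \<noteq> UNIV"
    and max: "\<And>K. left_ideal K \<Longrightarrow> M \<subseteq> K \<Longrightarrow> K = M \<or> K = UNIV"
    using assms unfolding maximal_left_ideal_def by blast+
  have M: "0 \<in> M" "\<And>x z. x \<in> M \<Longrightarrow> z \<in> M \<Longrightarrow> x + z \<in> M" "\<And>a x. x \<in> M \<Longrightarrow> a * x \<in> M"
    using li unfolding left_ideal_def by blast+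
  show "x \<in> M"
  proof (rule ccontr)
    assume "x \<notin> M"
    define K where "K = {m + j |m j. m \<in> M \<and> j \<in> path_ideal 1}"
    note P = subspace_0[OF subspace_path_ideal[of 1]] subspace_add[OF subspace_path_ideal[of 1]]
    have "left_ideal K"
      unfolding left_ideal_def
    proof (intro conjI ballI allI)
      show "0 \<in> K" unfolding K_def using M(1) P(1) by force
    next
      fix s t assume "s \<in> K" "t \<in> K"
      then obtain m j m' j' where *: "s = m + j" "t = m' + j'" "m \<in> M" "m' \<in> M"
          "j \<in> path_ideal 1" "j' \<in> path_ideal 1" unfolding K_def by blast
      then have "s + t = (m + m') + (j + j')" by (simp add: add_ac)
      then show "s + t \<in> K" unfolding K_def using * M(2) P(2) by blast
    next
      fix a s assume "s \<in> K"
      then obtain m j where "s = m + j" "m \<in> M" "j \<in> path_ideal 1" unfolding K_def by blast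
      then have "a * s = a * m + a * j" "a * m \<in> M" "a * j \<in> path_ideal 1"
        using M(3) path_ideal_mult_left by (simp_all add: distrib_left)
      then show "a * s \<in> K" unfolding K_def by blast
    qed
    moreover have "m \<in> K" if "m \<in> M" for m
      unfolding K_def using that P(1) by (intro CollectI exI[of _ m] exI[of _ 0]) simp
    moreover have "x \<in> K" unfolding K_def using x M(1) by force
    ultimately have "K = UNIV" using max[of K] \<open>x \<notin> M\<close> by blast
    then obtain m j where mj: "1 = m + j" "m \<in> M" "j \<in> path_ideal 1" unfolding K_def by blast
    then have m: "1 - j \<in> M" by (metis add_diff_cancel_right')
    have "1 - j ^ n \<in> M" for n
    proof (induction n)
      case (Suc n)
      have "1 - j ^ Suc n = (1 - j ^ n) + j ^ n * (1 - j)"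
        by (simp only: power_Suc2 right_diff_distrib mult_1_right) simp
      then show ?case using M(2)[OF Suc M(3)[OF m]] by (simp only:)
    qed (simp add: M(1))
    then have "1 \<in> M" using nilpotent_path_ideal_1[OF mj(3)] by (metis diff_zero)
    then have "a \<in> M" for a using M(3)[of 1 a] by simp
    then show False using M_UNIV by blast
  qed
qed

text \<open>For the inclusion of the radical, each vertex v gives the left ideal of all x with x e_v
  in \<open>path_ideal 1\<close>, which is maximal because the top of A e_v is one-dimensional. An x
  in all of these lies in \<open>path_ideal 1\<close>, since the \<open>e v\<close> sum to
  1.\<close>

lemma jacobson_radical_eq: "jacobson_radical = path_ideal 1"
proof (intro subset_antisym subsetI)
  fix x :: 'a assume "x \<in> path_ideal 1"
  then show "x \<in> jacobson_radical"
    unfolding jacobson_radical_def using path_ideal_1_subset_maximal by blast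
next
  fix x :: 'a assume x: "x \<in> jacobson_radical"
  note P = subspace_0[OF subspace_path_ideal[of 1]] subspace_add[OF subspace_path_ideal[of 1]]
    subspace_scale[OF subspace_path_ideal[of 1]]
  have xv: "x * e v \<in> path_ideal 1" if v: "v \<in> verts Q" for v
  proof -
    define M where "M = {x. x * e v \<in> path_ideal 1}"
    have "maximal_left_ideal M"
      unfolding maximal_left_ideal_def
    proof (intro conjI allI impI)
      show "left_ideal M"
        unfolding left_ideal_def M_def using P path_ideal_mult_left by (auto simp: distrib_right mult.assoc)
      show "M \<noteq> UNIV" using e_notin_path_ideal_1[OF v] by (auto simp: M_def set_eq_iff intro: exI[of _ 1])
      fix K assume K: "left_ideal K \<and> M \<subseteq> K"
      show "K = M \<or> K = UNIV"
      proof (rule disjCI)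
        assume "K \<noteq> UNIV"
        show "K = M"
        proof (rule ccontr)
          assume "K \<noteq> M"
          then obtain z where z: "z \<in> K" "z * e v \<notin> path_ideal 1" using K by (auto simp: M_def)
          obtain c where c: "z * e v - scale c (e v) \<in> path_ideal 1" using expand_mult_e[OF v] by blast
          have "c \<noteq> 0" using c z(2) by auto
          have "(scale c 1 - z) * e v = scale (-1) (z * e v - scale c (e v))"
            by (simp add: left_diff_distrib scale_mult_left)
          then have "(scale c 1 - z) * e v \<in> path_ideal 1" using P(3)[OF c] by (simp only:)
          then have "scale c 1 - z \<in> K" using K unfolding M_def by blast
          then have "(scale c 1 - z) + z \<in> K" using K z(1) unfolding left_ideal_def by blast
          then have "scale (inverse c) 1 * scale c 1 \<in> K" using K unfolding left_ideal_def by simp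
          then have "1 \<in> K" using \<open>c \<noteq> 0\<close> by (simp add: scale_mult_left)
          then have "a * 1 \<in> K" for a using K unfolding left_ideal_def by blast
          then show False using \<open>K \<noteq> UNIV\<close> by auto
        qed
      qed
    qed
    then have "x \<in> M" using x unfolding jacobson_radical_def by blast
    then show ?thesis by (simp add: M_def)
  qed
  have "x = (\<Sum>v\<in>verts Q. x * e v)" by (simp add: sum_distrib_left[symmetric] e_sum)
  then show "x \<in> path_ideal 1" using xv subspace_sum[OF subspace_path_ideal] by metis
qed

lemma radical_square_eq: "radical_square = path_ideal 2"
proof
  show "radical_square \<subseteq> path_ideal 2"
    unfolding radical_square_def jacobson_radical_eq
    using path_ideal_mult[of _ 1 _ 1] by (intro span_minimal subspace_path_ideal) (auto simp: numeral_2_eq_2)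
  have "path_elem p \<in> radical_square" if p: "p \<in> paths Q" "2 \<le> length (snd p)" for p
  proof -
    obtain u b a as where as': "p = (u, a # b # as)"
      using p(2) by (cases p) (auto simp: numeral_2_eq_2 Suc_le_length_iff)
    define as' where "as' = b # as"
    have as: "p = (u, a # as')" "as' \<noteq> []" by (simp_all add: as' as'_def)
    have a: "a \<in> arcs Q" "u = tail Q a" "(head Q a, as') \<in> paths Q" using p(1) unfolding as(1) path_Cons by blast+
    have "path_elem (head Q a, as') \<in> path_ideal 1"
      using as(2) a(3) by (intro path_elem_path_ideal) (auto simp: Suc_le_eq)
    then show ?thesis
      using y_path_ideal_1[OF a(1)] unfolding radical_square_def jacobson_radical_eq as(1) a(2)
      by (intro span_base) (auto simp: path_elem_Cons[OF a(1)])
  qed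
  then show "path_ideal 2 \<subseteq> radical_square"
    unfolding path_ideal_def radical_square_def by (intro span_minimal) auto
qed

text \<open>In a decomposition e_v = f + g, the idempotent f is congruent to c e_v modulo the
  nilpotent ideal \<open>path_ideal 1\<close>. Multiplying by f puts (1 - c) f into this ideal. So
  either f or, for c = 1, the complement g is an idempotent in a nilpotent ideal and
  vanishes.\<close>

lemma primitive_idempotent_e: assumes v: "v \<in> verts Q" shows "primitive_idempotent (e v)"
  unfolding primitive_idempotent_def
proof (intro conjI notI)
  show "e v * e v = e v" using e_mult[OF v v] by simp
  show "False" if "e v = 0"
    using that e_notin_path_ideal_1[OF v] subspace_0[OF subspace_path_ideal] by simp
  show False if dec: "\<exists>f g. f \<noteq> 0 \<and> g \<noteq> 0 \<and> f * f = f \<and> g * g = g \<and> f * g = 0 \<and> g * f = 0 \<and> e v = f + g"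
  proof -
    obtain f g where fg: "f \<noteq> 0" "g \<noteq> 0" "f * f = f" "g * g = g" "f * g = 0" "g * f = 0" "e v = f + g"
      using dec by blast
    have fe: "f * e v = f" using fg by (simp add: distrib_left)
    obtain c where c: "f * e v - scale c (e v) \<in> path_ideal 1" using expand_mult_e[OF v] by blast
    have "c = 1"
    proof (rule ccontr)
      assume "c \<noteq> 1"
      have "f * (f * e v - scale c (e v)) = scale (1 - c) f"
        by (simp only: fe right_diff_distrib scale_mult_right fg(3) scale_left_diff_distrib scale_one)
      then have "scale (1 - c) f \<in> path_ideal 1" using path_ideal_mult_left[OF c] by metis
      then have "scale (inverse (1 - c)) (scale (1 - c) f) \<in> path_ideal 1"
        by (rule subspace_scale[OF subspace_path_ideal])
      then have "f \<in> path_ideal 1" using \<open>c \<noteq> 1\<close> by simp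
      then show False using idempotent_path_ideal_1 fg by blast
    qed
    then have "f * e v - scale c (e v) = - g" by (simp only: fe scale_one) (simp add: fg(7))
    then have "- g \<in> path_ideal 1" using c by (simp only:)
    then have "g \<in> path_ideal 1" using subspace_neg[OF subspace_path_ideal, of "- g"] by simp
    then show False using idempotent_path_ideal_1 fg by blast
  qed
qed

end

section \<open>Comparison with the Gabriel quiver\<close>

locale fd_presentation = presentation scale Q e y + fin_dim_algebra scale
  for scale :: "'k::field \<Rightarrow> 'a::{ring, monoid_mult} \<Rightarrow> 'a"
    and Q :: "('v, 'e) pre_digraph" and e y
begin

text \<open>An arrow of \<open>Q\<close> is not in \<open>rad\<^sup>2\<close>, and the equivalences of idempotents carry it to an element of
  \<open>e' v (rad A) e' u\<close> that is not in \<open>e' v (rad\<^sup>2 A) e' u\<close>.\<close>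

lemma gabriel_quiver_arrow:
  fixes Q' :: "('w, 'f) pre_digraph" and e' :: "'w \<Rightarrow> 'a"
  assumes card: "card {a \<in> arcs Q'. tail Q' a = u' \<and> head Q' a = v'} =
      dim ((\<lambda>x. e' v' * x * e' u') ` jacobson_radical) - dim ((\<lambda>x. e' v' * x * e' u') ` radical_square)"
    and idem: "e' u' * e' u' = e' u'" "e' v' * e' v' = e' v'"
    and a: "a \<in> arcs Q" "equivalent_idempotents (e (tail Q a)) (e' u')"
      "equivalent_idempotents (e (head Q a)) (e' v')"
  shows "\<exists>b\<in>arcs Q'. tail Q' b = u' \<and> head Q' b = v'"
proof -
  obtain B where "finite_dimensional_vector_space scale B" using finite_dimensional by blast
  then interpret F: finite_dimensional_vector_space scale B .
  obtain r s where rs: "r = e (tail Q a) * r * e' u'" "s = e' u' * s * e (tail Q a)" "r * s = e (tail Q a)"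
    using a(2) unfolding equivalent_idempotents_def by blast
  obtain p q where pq: "p = e (head Q a) * p * e' v'" "q = e' v' * q * e (head Q a)" "p * q = e (head Q a)"
    using a(3) unfolding equivalent_idempotents_def by blast
  let ?f = "\<lambda>x. e' v' * x * e' u'"
  let ?z = "q * y a * r"
  have sub: "subspace (?f ` path_ideal k)" for k
  proof (rule subspaceI)
    show "0 \<in> ?f ` path_ideal k"
      using subspace_0[OF subspace_path_ideal] by (intro image_eqI[of _ _ 0]) auto
    show "x + z \<in> ?f ` path_ideal k" if "x \<in> ?f ` path_ideal k" "z \<in> ?f ` path_ideal k" for x z
      using that subspace_add[OF subspace_path_ideal]
      by (force simp: distrib_left[symmetric] distrib_right[symmetric])
    show "scale c x \<in> ?f ` path_ideal k" if x: "x \<in> ?f ` path_ideal k" for c x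
    proof -
      obtain w where "w \<in> path_ideal k" "x = e' v' * w * e' u'" using x by blast
      then show ?thesis using subspace_scale[OF subspace_path_ideal, of w k c]
        by (intro image_eqI[of _ _ "scale c w"]) (simp_all add: scale_mult_left scale_mult_right)
    qed
  qed
  have "e' v' * q = e' v' * (e' v' * q * e (head Q a))" "r * e' u' = e (tail Q a) * r * e' u' * e' u'"
    using rs(1) pq(2) by simp_all
  then have ends: "e' v' * q = q" "r * e' u' = r"
    using rs(1) pq(2) idem by (metis mult.assoc)+
  have "?z \<in> path_ideal 1"
    using y_path_ideal_1[OF a(1)] by (intro path_ideal_mult_left path_ideal_mult_right)
  then have 1: "?z \<in> ?f ` path_ideal 1"
    using ends by (intro image_eqI[of _ _ ?z]) (metis mult.assoc)+
  have 2: "?z \<notin> ?f ` path_ideal 2"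
  proof
    assume "?z \<in> ?f ` path_ideal 2"
    then have "p * ?z * s \<in> path_ideal 2"
      using path_ideal_mult_left path_ideal_mult_right by auto
    moreover have "p * ?z * s = (p * q) * y a * (r * s)" by (simp add: mult.assoc)
    ultimately have "y a \<in> path_ideal 2" by (simp add: rs(3) pq(3) y_head y_tail a(1))
    then have "(\<Sum>b\<in>{a}. scale 1 (y b)) \<in> path_ideal 2" by simp
    then show False using sum_y_path_ideal_2[of "{a}" "\<lambda>_. 1" a] a(1) by simp
  qed
  have le: "?f ` path_ideal 2 \<subseteq> ?f ` path_ideal 1" using path_ideal_mono[of 1 2] by auto
  \<comment> \<open>The number of arrows is a difference of dimensions in the natural numbers; it is
    nonzero as soon as the inclusion of the two subspaces is strict.\<close>
  have "\<not> dim (?f ` path_ideal 1) \<le> dim (?f ` path_ideal 2)"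
    using F.subspace_dim_equal[OF sub sub le] 1 2 by blast
  then have "card {a \<in> arcs Q'. tail Q' a = u' \<and> head Q' a = v'} \<noteq> 0"
    unfolding card jacobson_radical_eq radical_square_eq by simp
  then have "{a \<in> arcs Q'. tail Q' a = u' \<and> head Q' a = v'} \<noteq> {}" by force
  then show ?thesis by blast
qed

text \<open>Triangularity speaks of some quiver \<open>Q'\<close> with the intrinsic properties. A
  vertex v goes to the vertex \<open>\<sigma> v\<close> of \<open>Q'\<close> whose idempotent is
  equivalent to \<open>e v\<close>; lifting arrows one by one then turns a closed walk of Q into a
  closed walk of \<open>Q'\<close> of the same length.\<close>

lemma acyclic_if_triangular:
  assumes triangular
  shows "acyclic_quiver Q"
proof -
  obtain Q' :: "(nat, nat) pre_digraph" where Q': "gabriel_quiver Q'" "acyclic_quiver Q'"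
    using assms unfolding triangular_def by blast
  obtain e' where idem: "\<And>v. v \<in> verts Q' \<Longrightarrow> primitive_idempotent (e' v)"
    and pr: "\<And>f. primitive_idempotent f \<Longrightarrow> \<exists>!v. v \<in> verts Q' \<and> equivalent_idempotents f (e' v)"
    and card: "\<And>u v. u \<in> verts Q' \<Longrightarrow> v \<in> verts Q' \<Longrightarrow> card {a \<in> arcs Q'. tail Q' a = u \<and> head Q' a = v} =
          dim ((\<lambda>x. e' v * x * e' u) ` jacobson_radical) - dim ((\<lambda>x. e' v * x * e' u) ` radical_square)"
    using Q'(1) unfolding gabriel_quiver_def by blast
  have "\<exists>\<sigma>. \<forall>v\<in>verts Q. \<sigma> v \<in> verts Q' \<and> equivalent_idempotents (e v) (e' (\<sigma> v))"
    using pr[OF primitive_idempotent_e] by (intro bchoice ballI) blast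
  then obtain \<sigma> where \<sigma>: "\<And>v. v \<in> verts Q \<Longrightarrow> \<sigma> v \<in> verts Q'"
    "\<And>v. v \<in> verts Q \<Longrightarrow> equivalent_idempotents (e v) (e' (\<sigma> v))" by blast
  have "\<exists>p'. pre_digraph.awalk Q' (\<sigma> u) p' (\<sigma> w) \<and> length p' = length p"
    if "pre_digraph.awalk Q u p w" for u p w
    using that
  proof (induction p arbitrary: u)
    case Nil
    then show ?case using \<sigma>(1) by (auto simp: pre_digraph.awalk_def pre_digraph.cas.simps)
  next
    case (Cons a p)
    then have a: "a \<in> arcs Q" "u = tail Q a" "pre_digraph.awalk Q (head Q a) p w"
      using arc_verts by (auto simp: pre_digraph.awalk_def pre_digraph.cas.simps)
    obtain p' where p': "pre_digraph.awalk Q' (\<sigma> (head Q a)) p' (\<sigma> w)" "length p' = length p"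
      using Cons.IH[OF a(3)] by blast
    note v = arc_verts[OF a(1)]
    obtain b where "b \<in> arcs Q'" "tail Q' b = \<sigma> u" "head Q' b = \<sigma> (head Q a)"
      using gabriel_quiver_arrow[OF card[OF \<sigma>(1)[OF v(1)] \<sigma>(1)[OF v(2)]] _ _ a(1) \<sigma>(2)[OF v(1)] \<sigma>(2)[OF v(2)]]
        idem[OF \<sigma>(1)[OF v(1)]] idem[OF \<sigma>(1)[OF v(2)]] a(2)
      unfolding primitive_idempotent_def by blast
    then show ?case using p' \<sigma>(1)[OF v(1)] a(2)
      by (intro exI[of _ "b # p'"]) (auto simp: pre_digraph.awalk_def pre_digraph.cas.simps)
  qed
  then show ?thesis using Q'(2) unfolding acyclic_quiver_def by (metis length_0_conv)
qed

end

section \<open>Changing the arrows of a presentation\<close>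

context presentation
begin

lemma e_e_left: "v \<in> verts Q \<Longrightarrow> e v * (e v * x) = e v * x"
  and e_e_right: "v \<in> verts Q \<Longrightarrow> x * e v * e v = x * e v"
  using e_mult[of v v] by (simp_all add: mult.assoc[symmetric]) (simp_all add: mult.assoc)

text \<open>New arrows forming a basis of \<open>path_ideal 1\<close> modulo
  \<open>path_ideal 2\<close> still generate: every old path is a combination of new ones up to an
  error one layer deeper, and the layers end at 0. The part of a relation in length 0 or 1 would
  contradict \<open>e v\<close> lying outside \<open>path_ideal 1\<close>, or the independence
  modulo \<open>path_ideal 2\<close>.\<close>

lemma presentation_change_arrows:
  assumes y': "\<And>a. a \<in> arcs Q \<Longrightarrow> e (head Q a) * y' a = y' a" "\<And>a. a \<in> arcs Q \<Longrightarrow> y' a * e (tail Q a) = y' a"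
      "\<And>a. a \<in> arcs Q \<Longrightarrow> y' a \<in> path_ideal 1"
    and indep: "independent_modulo (path_ideal 2) (arcs Q) y'"
    and span: "path_ideal 1 \<subseteq> span (y' ` arcs Q \<union> path_ideal 2)"
  shows "presentation scale Q e y'"
proof -
  interpret D: fin_digraph Q by (rule fin)
  interpret N: quiver_system scale Q e y'
    by unfold_locales (use e_mult e_sum y' in auto)
  have pe: "N.path_elem (u, as) \<in> path_ideal (length as)" if "(u, as) \<in> paths Q" for u as
    using that
  proof (induction as arbitrary: u)
    case Nil
    then show ?case by (simp add: path_ideal_0)
  next
    case (Cons a as)
    then have a: "a \<in> arcs Q" "u = tail Q a" "(head Q a, as) \<in> paths Q" by (simp_all add: path_Cons)
    show ?case
      using path_ideal_mult[OF Cons.IH[OF a(3)] y'(3)[OF a(1)]] N.path_elem_Cons[OF a(1)] a(2) by simp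
  qed
  then have pe': "N.path_elem p \<in> path_ideal k" if "p \<in> paths Q" "k \<le> length (snd p)" for p k
    using that path_ideal_mono[OF that(2)] by (cases p) auto
  let ?S = "span (N.path_elem ` paths Q)"
  have S_mult: "s * t \<in> ?S" if "s \<in> ?S" "t \<in> ?S" for s t
  proof -
    obtain x z where "Poly_Mapping.keys x \<subseteq> paths Q" "Poly_Mapping.keys z \<subseteq> paths Q"
      "s = N.realise x" "t = N.realise z"
      using \<open>s \<in> ?S\<close> \<open>t \<in> ?S\<close> unfolding N.range_realise[symmetric] by (auto simp: path_algebra_def)
    then have "s * t = N.realise (path_mult Q x z)" "path_mult Q x z \<in> carrier (path_algebra Q)"
      by (simp_all add: N.realise_mult path_mult_closed path_algebra_def)
    then show ?thesis unfolding N.range_realise[symmetric] by blast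
  qed
  \<comment> \<open>Appending an arrow y a = t + j with j in \<open>path_ideal 2\<close> leaves the
    error s j. That s lies in the layer given by the length of the path is therefore part of the
    claim.\<close>
  have approx: "\<exists>s\<in>?S \<inter> path_ideal (length as). path_elem (u, as) - s \<in> path_ideal (Suc (length as))"
    if "(u, as) \<in> paths Q" for u as
    using that
  proof (induction as arbitrary: u)
    case Nil
    then have "e u \<in> ?S" by (intro span_base image_eqI[of _ _ "(u, [])"]) auto
    then show ?case
      by (intro bexI[of _ "e u"]) (simp_all add: path_ideal_0 subspace_0[OF subspace_path_ideal])
  next
    case (Cons a as)
    then have a: "a \<in> arcs Q" "u = tail Q a" "(head Q a, as) \<in> paths Q" by (simp_all add: path_Cons)
    obtain s where s: "s \<in> ?S" "s \<in> path_ideal (length as)"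
      "path_elem (head Q a, as) - s \<in> path_ideal (Suc (length as))" using Cons.IH[OF a(3)] by blast
    have "y a \<in> span (y' ` arcs Q \<union> path_ideal 2)" using y_path_ideal_1[OF a(1)] span by blast
    then obtain t j where tj: "y a = t + j" "t \<in> span (y' ` arcs Q)" "j \<in> span (path_ideal 2)"
      unfolding span_Un by blast
    have j: "j \<in> path_ideal 2" using tj(3) span_minimal[OF order_refl subspace_path_ideal] by blast
    have "y' b \<in> ?S" if "b \<in> arcs Q" for b
      using arrow_path[OF that] N.path_elem_arrow[OF that]
      by (intro span_base image_eqI[of _ _ "(tail Q b, [b])"]) auto
    then have t: "t \<in> ?S" "t \<in> path_ideal 1"
      using tj(2) span_minimal[of "y' ` arcs Q" ?S] span_minimal[OF _ subspace_path_ideal, of "y' ` arcs Q" 1] y'(3)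
      by auto
    let ?r = "path_elem (head Q a, as) - s"
    have "path_elem (u, a # as) - s * t = ?r * y a + s * j"
      using path_elem_Cons[OF a(1)] a(2) by (simp add: tj(1) left_diff_distrib distrib_left)
    moreover have "?r * y a \<in> path_ideal (Suc (length (a # as)))"
      using path_ideal_mult[OF s(3) y_path_ideal_1[OF a(1)]] by simp
    moreover have "s * j \<in> path_ideal (Suc (length (a # as)))"
      using path_ideal_mult[OF s(2) j] by simp
    ultimately have "path_elem (u, a # as) - s * t \<in> path_ideal (Suc (length (a # as)))"
      using subspace_add[OF subspace_path_ideal] by simp
    moreover have "s * t \<in> path_ideal (length (a # as))"
      using path_ideal_mult[OF s(2) t(2)] by simp
    ultimately show ?case using S_mult[OF s(1) t(1)] by blast
  qed
  obtain m where m: "path_ideal m = {0}" using path_ideal_nilpotent ..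
  \<comment> \<open>Descent through the layers, from \<open>path_ideal m\<close>, which is 0, up to
    \<open>path_ideal 0\<close>, which is all of A.\<close>
  have "path_ideal (m - k) \<subseteq> ?S" for k
  proof (induction k)
    case 0
    show ?case using m span_zero by auto
  next
    case (Suc k)
    have "path_elem p \<in> ?S" if p: "p \<in> paths Q" "m - Suc k \<le> length (snd p)" for p
    proof -
      obtain s where s: "s \<in> ?S" "path_elem p - s \<in> path_ideal (Suc (length (snd p)))"
        using approx[of "fst p" "snd p"] p(1) by auto
      have "path_ideal (Suc (length (snd p))) \<subseteq> path_ideal (m - k)"
        using p(2) by (intro path_ideal_mono) auto
      then have "path_elem p - s \<in> ?S" using s(2) Suc.IH by blast
      then show ?thesis using span_add[OF _ s(1)] by (metis diff_add_cancel)
    qed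
    then show ?case unfolding path_ideal_def[of "m - Suc k"] by (intro span_minimal) auto
  qed
  from this[of m] have gen: "?S = UNIV" using path_ideal_0 by auto
  show ?thesis
  proof
    show "span (N.path_elem ` paths Q) = UNIV" by (rule gen)
    show "\<exists>m. \<forall>p\<in>paths Q. m \<le> length (snd p) \<longrightarrow> N.path_elem p = 0"
      using pe'[of _ m] m by (intro exI[of _ m]) auto
    fix x p assume x: "Poly_Mapping.keys x \<subseteq> paths Q" "N.realise x = 0" "p \<in> Poly_Mapping.keys x"
    let ?c = "Poly_Mapping.lookup x"
    let ?K = "\<lambda>k. {p \<in> Poly_Mapping.keys x. k \<le> length (snd p)}"
    have tail_sum: "(\<Sum>p\<in>?K k. scale (?c p) (N.path_elem p)) \<in> path_ideal k" for k
      using x(1) pe' by (intro subspace_sum subspace_scale subspace_path_ideal) auto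
    \<comment> \<open>Among the trivial paths, right multiplication by \<open>e v\<close> retains
      only the one at v; all longer paths lie in \<open>path_ideal 1\<close>.\<close>
    have triv: "(v, []) \<notin> Poly_Mapping.keys x" for v
    proof
      assume v: "(v, []) \<in> Poly_Mapping.keys x"
      then have vQ: "v \<in> verts Q" using x(1) by auto
      let ?T = "{p \<in> Poly_Mapping.keys x. length (snd p) = 0}"
      have "(\<Sum>p\<in>?T. scale (?c p) (N.path_elem p)) + (\<Sum>p\<in>?K 1. scale (?c p) (N.path_elem p))
          = (\<Sum>p\<in>?T \<union> ?K 1. scale (?c p) (N.path_elem p))"
        by (rule sum.union_disjoint[symmetric]) auto
      also have "?T \<union> ?K 1 = Poly_Mapping.keys x" by (auto simp: Suc_le_eq)
      also have "(\<Sum>p\<in>Poly_Mapping.keys x. scale (?c p) (N.path_elem p)) = 0"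
        using x(2) by (simp add: N.realise_def)
      finally have "(\<Sum>p\<in>?T. scale (?c p) (N.path_elem p)) = - (\<Sum>p\<in>?K 1. scale (?c p) (N.path_elem p))"
        by (simp add: eq_neg_iff_add_eq_0)
      then have "(\<Sum>p\<in>?T. scale (?c p) (N.path_elem p)) \<in> path_ideal 1"
        using subspace_neg[OF subspace_path_ideal tail_sum[of 1]] by simp
      then have "(\<Sum>p\<in>?T. scale (?c p) (N.path_elem p)) * e v \<in> path_ideal 1"
        by (rule path_ideal_mult_right)
      also have "(\<Sum>p\<in>?T. scale (?c p) (N.path_elem p)) * e v
          = (\<Sum>p\<in>?T. if p = (v, []) then scale (?c (v, [])) (e v) else 0)"
        unfolding sum_distrib_right
      proof (rule sum.cong)
        fix p assume "p \<in> ?T"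
        then have p: "p = (fst p, [])" "p \<in> paths Q" using x(1) by (cases p; auto)+
        show "scale (?c p) (N.path_elem p) * e v = (if p = (v, []) then scale (?c (v, [])) (e v) else 0)"
          using N.path_elem_source[OF p(2) vQ] p(1)
          by (cases p) (auto simp: scale_mult_left psource_def)
      qed simp
      also have "\<dots> = scale (?c (v, [])) (e v)" using v by simp
      finally have "scale (inverse (?c (v, []))) (scale (?c (v, [])) (e v)) \<in> path_ideal 1"
        by (rule subspace_scale[OF subspace_path_ideal])
      then have "e v \<in> path_ideal 1" using v by (simp add: in_keys_iff)
      then show False using e_notin_path_ideal_1[OF vQ] by contradiction
    qed
    show "2 \<le> length (snd p)"
    proof (rule ccontr)
      assume "\<not> 2 \<le> length (snd p)"
      then have "length (snd p) = 1" using triv[of "fst p"] x(3)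
        by (cases p) (auto simp: not_le less_2_cases_iff)
      then obtain u a where "p = (u, [a])" by (cases p) (auto simp: length_Suc_conv)
      then have a: "a \<in> arcs Q" "p = (tail Q a, [a])" using x(1,3) by (auto simp: path_Cons)
      let ?T = "{p \<in> Poly_Mapping.keys x. length (snd p) = 1}"
      have "(\<Sum>p\<in>?T. scale (?c p) (N.path_elem p)) + (\<Sum>p\<in>?K 2. scale (?c p) (N.path_elem p))
          = (\<Sum>p\<in>?T \<union> ?K 2. scale (?c p) (N.path_elem p))"
        by (rule sum.union_disjoint[symmetric]) auto
      also have "?T \<union> ?K 2 = Poly_Mapping.keys x"
      proof -
        have "length (snd p) = 1 \<or> 2 \<le> length (snd p)" if "p \<in> Poly_Mapping.keys x" for p
          using triv[of "fst p"] that by (cases p; cases "snd p") (auto simp: Suc_le_eq)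
        then show ?thesis by blast
      qed
      also have "(\<Sum>p\<in>Poly_Mapping.keys x. scale (?c p) (N.path_elem p)) = 0"
        using x(2) by (simp add: N.realise_def)
      finally have "(\<Sum>p\<in>?T. scale (?c p) (N.path_elem p)) = - (\<Sum>p\<in>?K 2. scale (?c p) (N.path_elem p))"
        by (simp add: eq_neg_iff_add_eq_0)
      then have "(\<Sum>p\<in>?T. scale (?c p) (N.path_elem p)) \<in> path_ideal 2"
        using subspace_neg[OF subspace_path_ideal tail_sum[of 2]] by simp
      also have "(\<Sum>p\<in>?T. scale (?c p) (N.path_elem p))
          = (\<Sum>p\<in>(\<lambda>b. (tail Q b, [b])) ` arcs Q. scale (?c p) (N.path_elem p))"
      proof (rule sum.mono_neutral_left)
        show "?T \<subseteq> (\<lambda>b. (tail Q b, [b])) ` arcs Q"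
        proof
          fix p assume p: "p \<in> ?T"
          then obtain u b where "p = (u, [b])" by (cases p) (auto simp: length_Suc_conv)
          then show "p \<in> (\<lambda>b. (tail Q b, [b])) ` arcs Q" using p x(1) by (auto simp: path_Cons)
        qed
      qed (use finite_arcs in \<open>auto simp: in_keys_iff\<close>)
      also have "\<dots> = (\<Sum>b\<in>arcs Q. scale (?c (tail Q b, [b])) (y' b))"
        by (subst sum.reindex) (auto intro!: inj_onI sum.cong simp: N.path_elem_arrow)
      finally have "?c (tail Q a, [a]) = 0"
        using indep a(1) unfolding independent_modulo_def by (auto dest: spec[where x="\<lambda>b. ?c (tail Q b, [b])"])
      then show False using x(3) a(2) by (simp add: in_keys_iff)
    qed
  qed
qed

end

section \<open>Derivations that vanish on the vertices of an acyclic quiver\<close>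

locale derivation_presentation = presentation scale Q e y + fd_operator scale Basis d
  for scale :: "'k::alg_closed_field \<Rightarrow> 'a::{ring, monoid_mult} \<Rightarrow> 'a"
    and Q :: "('v, 'e) pre_digraph" and e y Basis d +
  assumes acyclic: "acyclic_quiver Q"
    and d_mult: "d (x * z) = d x * z + x * d z"
    and d_e: "v \<in> verts Q \<Longrightarrow> d (e v) = 0"
begin

lemma no_closed_path: "p \<in> paths Q \<Longrightarrow> psource p = ptarget Q p \<Longrightarrow> snd p = []"
  using acyclic unfolding acyclic_quiver_def paths_def by auto

lemma corner_span:
  assumes "u \<in> verts Q" "v \<in> verts Q"
  shows "e v * x * e u \<in> span (path_elem ` {p \<in> paths Q. psource p = u \<and> ptarget Q p = v})"
proof -
  have "x \<in> span (path_elem ` paths Q)" using generated by simp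
  then show ?thesis
  proof (induction rule: span_induct_alt)
    case base
    show ?case by (simp add: span_zero)
  next
    case (step c x z)
    then obtain p where p: "p \<in> paths Q" "x = path_elem p" by blast
    have "e v * path_elem p * e u = (if psource p = u \<and> ptarget Q p = v then path_elem p else 0)"
      using path_elem_target[OF p(1) assms(2)] path_elem_source[OF p(1) assms(1)] by auto
    then have "e v * x * e u \<in> span (path_elem ` {p \<in> paths Q. psource p = u \<and> ptarget Q p = v})"
      using p by (auto intro!: span_base simp: span_zero)
    then show ?case using step(2)
      by (simp add: distrib_left distrib_right scale_mult_left scale_mult_right span_add span_scale)
  qed
qed

lemma d_corner: "u \<in> verts Q \<Longrightarrow> v \<in> verts Q \<Longrightarrow> d (e v * x * e u) = e v * d x * e u"
  by (simp add: d_mult d_e)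

lemma d_0: "d 0 = 0"
  using d_scale[of 0 0] by simp

text \<open>
  In positive characteristic a derivation need not preserve the radical.  Here it does, because for an
  acyclic quiver the radical is spanned by the off-diagonal corners \<open>e v * A * e u\<close>, \<open>u \<noteq> v\<close>.
\<close>

lemma d_path_ideal_1: assumes "x \<in> path_ideal 1" shows "d x \<in> path_ideal 1"
  using assms unfolding path_ideal_def[of 1]
proof (induction rule: span_induct_alt)
  case base
  show ?case by (simp add: d_0 span_zero)
next
  case (step c x z)
  then obtain p where p: "p \<in> paths Q" "1 \<le> length (snd p)" "x = path_elem p" by blast
  define u v where "u = psource p" and "v = ptarget Q p"
  have uv: "u \<in> verts Q" "v \<in> verts Q" "u \<noteq> v"
    using path_verts[OF p(1)] no_closed_path[OF p(1)] p(2) by (auto simp: u_def v_def)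
  have "path_elem p = e v * path_elem p * e u"
    using path_elem_target[OF p(1) uv(2)] path_elem_source[OF p(1) uv(1)] by (simp add: u_def v_def)
  then have "d x = e v * d x * e u" using d_corner[OF uv(1,2), of x] p(3) by simp
  also have "\<dots> \<in> span (path_elem ` {p \<in> paths Q. psource p = u \<and> ptarget Q p = v})"
    by (rule corner_span[OF uv(1,2)])
  also have "\<dots> \<subseteq> span (path_elem ` {p \<in> paths Q. 1 \<le> length (snd p)})"
    using uv(3) by (intro span_mono image_mono) (auto simp: Suc_le_eq psource_def ptarget_def')
  finally show ?case using step(2) by (simp add: d_add d_scale span_add span_scale)
qed

text \<open>By the Leibniz rule, d - (l + m) acts on x z as d - l on x plus d - m on z. If i and j
  applications kill the factors, i + j applications kill the product; induction on i + j replaces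
  the binomial expansion.\<close>

lemma gen_eigenspace_mult:
  assumes "x \<in> gen_eigenspace l" "z \<in> gen_eigenspace m"
  shows "x * z \<in> gen_eigenspace (l + m)"
proof -
  have step: "shift (l + m) (x * z) = shift l x * z + x * shift m z" for x z
    by (simp add: shift_def d_mult left_diff_distrib right_diff_distrib scale_mult_left
        scale_mult_right scale_left_distrib)
  have "(shift (l + m) ^^ n) (x * z) = 0"
    if "(shift l ^^ i) x = 0" "(shift m ^^ j) z = 0" "i + j = n" for n i j x z
    using that
  proof (induction n arbitrary: i j x z)
    case (Suc n)
    show ?case
    proof (cases "i = 0 \<or> j = 0")
      case True
      then have "x * z = 0" using Suc.prems by auto
      then show ?thesis by (simp only: shift_funpow_0)
    next
      case False
      then obtain i' j' where ij: "i = Suc i'" "j = Suc j'" by (metis not0_implies_Suc)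
      have "(shift (l + m) ^^ n) (shift l x * z) = 0"
        using Suc.IH[of i' "shift l x" j z] Suc.prems by (simp add: ij funpow_swap1)
      moreover have "(shift (l + m) ^^ n) (x * shift m z) = 0"
        using Suc.IH[of i x j' "shift m z"] Suc.prems by (simp add: ij funpow_swap1)
      ultimately show ?thesis by (simp only: funpow_Suc_right comp_apply step shift_funpow_add) simp
    qed
  qed simp
  then show ?thesis using assms unfolding gen_eigenspace_def by blast
qed

lemma e_gen_eigenspace: "v \<in> verts Q \<Longrightarrow> e v \<in> gen_eigenspace 0"
  unfolding gen_eigenspace_def by (intro CollectI exI[of _ 1]) (simp add: shift_def d_e)

text \<open>Each corner of the radical is stable under d, hence spanned by generalised eigenvectors
  lying in it. The exchange lemma then trades the arrows from u to v for such eigenvectors; staying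
  in the corner keeps their source and target.\<close>

lemma eigen_arrows_between:
  assumes uv: "u \<in> verts Q" "v \<in> verts Q"
  defines "X \<equiv> {a \<in> arcs Q. tail Q a = u \<and> head Q a = v}"
    and "corner \<equiv> \<lambda>k. {x \<in> path_ideal k. e v * x * e u = x}"
  shows "\<exists>g. independent_modulo (corner 2) X g \<and> g ` X \<subseteq> (\<Union>l. gen_eigenspace l \<inter> corner 1) \<and>
    corner 1 \<subseteq> span (g ` X \<union> corner 2)"
proof -
  have sub: "subspace (corner k)" for k
    unfolding corner_def using subspace_path_ideal[of k]
    by (auto simp: subspace_def distrib_left distrib_right scale_mult_left scale_mult_right)
  have idem: "e v * (e v * x * e u) * e u = e v * x * e u" for x
  proof -
    have "e v * (e v * x * e u) * e u = (e v * (e v * x)) * e u * e u" by (simp only: mult.assoc)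
    then show ?thesis by (simp only: e_e_left[OF uv(2)] e_e_right[OF uv(1)])
  qed
  have X: "finite X" unfolding X_def using finite_arcs by simp
  have yc: "e v * y a * e u = y a" if "a \<in> X" for a
    using that y_head[of a] y_tail[of a] by (auto simp: X_def)
  have "independent_modulo (corner 2) X y"
    unfolding independent_modulo_def using sum_y_path_ideal_2[of X] by (auto simp: X_def corner_def)
  moreover have "y ` X \<subseteq> corner 1" using yc y_path_ideal_1 by (auto simp: corner_def X_def)
  moreover have "corner 1 \<subseteq> span (y ` X \<union> corner 2)"
  proof
    fix x assume x: "x \<in> corner 1"
    have "e v * x * e u \<in> span (y ` X \<union> corner 2)" if "x \<in> path_ideal 1" for x
      using that unfolding path_ideal_def[of 1]
    proof (induction rule: span_induct_alt)
      case base
      show ?case by (simp add: span_zero)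
    next
      case (step c x z)
      then obtain p where p: "p \<in> paths Q" "1 \<le> length (snd p)" "x = path_elem p" by blast
      have "e v * x * e u \<in> span (y ` X \<union> corner 2)"
      proof (cases "2 \<le> length (snd p)")
        case True
        then have "e v * x * e u \<in> path_ideal 2"
          using path_elem_path_ideal[OF p(1) True] p(3) path_ideal_mult_left path_ideal_mult_right by simp
        then have "e v * x * e u \<in> corner 2" using idem by (simp add: corner_def)
        then show ?thesis by (intro span_base) simp
      next
        case False
        then have "length (snd p) = 1" using p(2) by linarith
        then obtain w a where "p = (w, [a])" by (cases p) (auto simp: length_Suc_conv)
        then have a: "a \<in> arcs Q" "x = y a" "p = (tail Q a, [a])"
          using p by (auto simp: path_Cons path_elem_arrow)
        have "e v * x * e u = (if a \<in> X then y a else 0)"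
          using path_elem_target[OF p(1) uv(2)] path_elem_source[OF p(1) uv(1)] a(1)
          unfolding p(3)[symmetric] a(2) by (auto simp: X_def a(3) psource_def ptarget_def')
        then show ?thesis by (auto intro: span_base span_zero)
      qed
      then show ?case using step(2)
        by (simp add: distrib_left distrib_right scale_mult_left scale_mult_right span_add span_scale)
    qed
    from this[of x] show "x \<in> span (y ` X \<union> corner 2)" using x by (simp add: corner_def)
  qed
  moreover have "corner 2 \<subseteq> corner 1" using path_ideal_mono[of 1 2] by (auto simp: corner_def)
  moreover have "corner 1 \<subseteq> span (\<Union>l. gen_eigenspace l \<inter> corner 1)"
  proof (rule gen_eigenspace_span[OF sub])
    show "d x \<in> corner 1" if "x \<in> corner 1" for x
      using that d_path_ideal_1 d_corner[OF uv, of x] by (simp add: corner_def)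
  qed
  ultimately show ?thesis
    using independent_modulo_exchange[of "corner 2" X y "corner 1" "\<Union>l. gen_eigenspace l \<inter> corner 1"] X sub
    by (metis (no_types, lifting) Int_lower2 UN_least)
qed

text \<open>The choices for the single pairs of vertices glue: multiplying by \<open>e v\<close> on
  the left and \<open>e u\<close> on the right projects a relation modulo
  \<open>path_ideal 2\<close> onto one corner, where independence is known.\<close>

lemma eigen_arrows:
  obtains y' l where "presentation scale Q e y'" "\<And>a. a \<in> arcs Q \<Longrightarrow> y' a \<in> gen_eigenspace (l a)"
proof -
  define X where "X u v = {a \<in> arcs Q. tail Q a = u \<and> head Q a = v}" for u v
  define corner where "corner u v k = {x \<in> path_ideal k. e v * x * e u = x}" for u v k
  define P where "P u v g \<longleftrightarrow> independent_modulo (corner u v 2) (X u v) g \<and>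
      g ` X u v \<subseteq> (\<Union>l. gen_eigenspace l \<inter> corner u v 1) \<and> corner u v 1 \<subseteq> span (g ` X u v \<union> corner u v 2)"
    for u v g
  define g where "g u v = (SOME g. P u v g)" for u v
  have "P u v (g u v)" if "u \<in> verts Q" "v \<in> verts Q" for u v
    unfolding g_def
    by (rule someI_ex[of "P u v"]) (use eigen_arrows_between[OF that] in \<open>simp only: P_def X_def corner_def\<close>)
  then have g: "\<And>u v. u \<in> verts Q \<Longrightarrow> v \<in> verts Q \<Longrightarrow> independent_modulo (corner u v 2) (X u v) (g u v)"
      "\<And>u v. u \<in> verts Q \<Longrightarrow> v \<in> verts Q \<Longrightarrow> g u v ` X u v \<subseteq> (\<Union>l. gen_eigenspace l \<inter> corner u v 1)"
      "\<And>u v. u \<in> verts Q \<Longrightarrow> v \<in> verts Q \<Longrightarrow> corner u v 1 \<subseteq> span (g u v ` X u v \<union> corner u v 2)"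
    unfolding P_def by blast+
  define y' where "y' a = g (tail Q a) (head Q a) a" for a
  have y': "\<exists>l. y' a \<in> gen_eigenspace l" "y' a \<in> path_ideal 1"
    "e (head Q a) * y' a = y' a" "y' a * e (tail Q a) = y' a" if a: "a \<in> arcs Q" for a
  proof -
    note v = arc_verts[OF a]
    have "y' a \<in> g (tail Q a) (head Q a) ` X (tail Q a) (head Q a)" using a by (simp add: y'_def X_def)
    then have *: "y' a \<in> (\<Union>l. gen_eigenspace l \<inter> corner (tail Q a) (head Q a) 1)" using g(2)[OF v] by blast
    then show "\<exists>l. y' a \<in> gen_eigenspace l" "y' a \<in> path_ideal 1" by (auto simp: corner_def)
    have c: "e (head Q a) * y' a * e (tail Q a) = y' a" using * by (auto simp: corner_def)
    have "e (head Q a) * (e (head Q a) * y' a * e (tail Q a)) = e (head Q a) * y' a * e (tail Q a)"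
      by (simp only: e_e_left[OF v(2)] mult.assoc)
    moreover have "(e (head Q a) * y' a * e (tail Q a)) * e (tail Q a) = e (head Q a) * y' a * e (tail Q a)"
      by (rule e_e_right[OF v(1)])
    ultimately show "e (head Q a) * y' a = y' a" "y' a * e (tail Q a) = y' a" unfolding c by blast+
  qed
  have "presentation scale Q e y'"
  proof (rule presentation_change_arrows)
    show "independent_modulo (path_ideal 2) (arcs Q) y'"
      unfolding independent_modulo_def
    proof (intro allI impI ballI)
      fix c a assume c: "(\<Sum>b\<in>arcs Q. scale (c b) (y' b)) \<in> path_ideal 2" and a: "a \<in> arcs Q"
      define u v where "u = tail Q a" and "v = head Q a"
      have uv: "u \<in> verts Q" "v \<in> verts Q" using arc_verts[OF a] by (simp_all add: u_def v_def)
      have yb: "e v * y' b * e u = (if b \<in> X u v then y' b else 0)" if b: "b \<in> arcs Q" for b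
      proof -
        have "e v * y' b * e u = e v * (e (head Q b) * y' b * e (tail Q b)) * e u"
          by (simp only: y'(3,4)[OF b])
        also have "\<dots> = (e v * e (head Q b)) * y' b * (e (tail Q b) * e u)"
          by (simp only: mult.assoc)
        also have "\<dots> = (if b \<in> X u v then e (head Q b) * y' b * e (tail Q b) else 0)"
          using e_mult[OF uv(2) arc_verts(2)[OF b]] e_mult[OF arc_verts(1)[OF b] uv(1)] b
          by (simp add: X_def)
        finally show ?thesis by (simp only: y'(3,4)[OF b])
      qed
      have "e v * (\<Sum>b\<in>arcs Q. scale (c b) (y' b)) * e u = (\<Sum>b\<in>arcs Q. scale (c b) (if b \<in> X u v then y' b else 0))"
        unfolding sum_distrib_left sum_distrib_right
        by (rule sum.cong) (simp_all add: scale_mult_left scale_mult_right yb)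
      also have "\<dots> = (\<Sum>b\<in>X u v. scale (c b) (g u v b))"
        using finite_arcs by (intro sum.mono_neutral_cong_right) (auto simp: X_def y'_def)
      finally have eq: "e v * (\<Sum>b\<in>arcs Q. scale (c b) (y' b)) * e u = (\<Sum>b\<in>X u v. scale (c b) (g u v b))" .
      have "e v * (e v * x * e u) * e u = e v * x * e u" for x
        using e_e_left[OF uv(2), of "x * e u"] e_e_right[OF uv(1), of "e v * (e v * x)"]
        by (simp add: mult.assoc)
      then have "(\<Sum>b\<in>X u v. scale (c b) (g u v b)) \<in> corner u v 2"
        unfolding corner_def eq[symmetric] using c path_ideal_mult_left path_ideal_mult_right by simp
      moreover have "a \<in> X u v" using a by (simp add: X_def u_def v_def)
      ultimately show "c a = 0" using g(1)[OF uv] unfolding independent_modulo_def by blast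
    qed
    show "path_ideal 1 \<subseteq> span (y' ` arcs Q \<union> path_ideal 2)"
      unfolding path_ideal_def[of 1]
    proof (intro span_minimal image_subsetI subspace_span)
      fix p assume "p \<in> {p \<in> paths Q. 1 \<le> length (snd p)}"
      then have p: "p \<in> paths Q" "1 \<le> length (snd p)" by auto
      define u v where "u = psource p" and "v = ptarget Q p"
      have uv: "u \<in> verts Q" "v \<in> verts Q" using path_verts[OF p(1)] by (simp_all add: u_def v_def)
      have "path_elem p \<in> corner u v 1"
        using path_elem_target[OF p(1) uv(2)] path_elem_source[OF p(1) uv(1)] path_elem_path_ideal[OF p]
        by (simp add: corner_def u_def v_def)
      then have "path_elem p \<in> span (g u v ` X u v \<union> corner u v 2)" using g(3)[OF uv] by blast
      also have "\<dots> \<subseteq> span (y' ` arcs Q \<union> path_ideal 2)"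
        by (intro span_mono) (force simp: X_def y'_def corner_def)
      finally show "path_elem p \<in> span (y' ` arcs Q \<union> path_ideal 2)" .
    qed
  qed (use y' in auto)
  moreover obtain l where "\<And>a. a \<in> arcs Q \<Longrightarrow> y' a \<in> gen_eigenspace (l a)" using y'(1) by metis
  ultimately show thesis by (rule that)
qed

end

section \<open>Weights on a simply connected quiver with relations\<close>

definition path_weight :: "('e \<Rightarrow> 'k::ab_group_add) \<Rightarrow> 'e list \<Rightarrow> 'k"
  where "path_weight l as = sum_list (map l as)"

definition walk_weight :: "('e \<Rightarrow> 'k::ab_group_add) \<Rightarrow> ('e \<times> bool) list \<Rightarrow> 'k"
  where "walk_weight l ws = sum_list (map (\<lambda>(a, s). if s then l a else - l a) ws)"

lemma walk_weight_append: "walk_weight l (v @ w) = walk_weight l v + walk_weight l w"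
  by (simp add: walk_weight_def)

lemma walk_weight_path: "walk_weight l (map (\<lambda>a. (a, True)) as) = path_weight l as"
  by (simp add: walk_weight_def path_weight_def comp_def)

lemma walk_weight_reverse: "walk_weight l (map (\<lambda>(a, s). (a, \<not> s)) (rev w)) = - walk_weight l w"
  by (induction w) (auto simp: walk_weight_def)

text \<open>Every generator of homotopy preserves the signed weight: an arrow cancels its inverse,
  concatenation adds weights, and minimal relations are covered by \<open>rel\<close>.\<close>

lemma homotopic_walk_weight:
  assumes rel: "\<And>r p q. minimal_relation I r \<Longrightarrow> p \<in> Poly_Mapping.keys r \<Longrightarrow> q \<in> Poly_Mapping.keys r \<Longrightarrow>
      path_weight l (snd p) = path_weight l (snd q)"
    and "homotopic Q I v w"
  shows "walk_weight l (snd v) = walk_weight l (snd w)"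
  using assms(2)
proof (induction rule: homotopic.induct)
  case (rel r p q)
  show ?case using assms(1)[OF rel(1,2,3)] by (simp add: walk_of_path_def walk_weight_path)
next
  case (cong v v' u w)
  then show ?case by (simp only: pcomp_def snd_conv walk_weight_append)
next
  case (trans u v w)
  show ?case by (rule HOL.trans[OF trans.IH])
qed (simp_all add: walk_weight_def)

text \<open>All loops at the base points have weight 0, so the weights form a coboundary: c v is
  minus the weight of a chosen walk from v to the base point of its component.\<close>

lemma simply_connected_potential:
  fixes Q :: "('v, 'e) pre_digraph" and I :: "(('v, 'e) qpath \<Rightarrow>\<^sub>0 'k::field) set"
    and l :: "'e \<Rightarrow> 'l::ab_group_add"
  assumes Q: "fin_digraph Q" and I: "ideal I (path_algebra Q)"
    and triv: "trivial_group (fundamental_group Q I)"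
    and rel: "\<And>r p q. minimal_relation I r \<Longrightarrow> p \<in> Poly_Mapping.keys r \<Longrightarrow> q \<in> Poly_Mapping.keys r \<Longrightarrow>
      path_weight l (snd p) = path_weight l (snd q)"
  shows "\<exists>c. \<forall>a\<in>arcs Q. l a = c (head Q a) - c (tail Q a)"
proof -
  interpret Q: fin_digraph Q by (rule Q)
  let ?D = "double_quiver Q"
  let ?G = "\<lambda>C. fundamental_group_at Q I (SOME x. x \<in> C)"
  have loop_weight: "walk_weight l (snd w) = 0"
    if C: "C \<in> components Q" and w: "w \<in> loops Q (SOME x. x \<in> C)" for C w
  proof -
    let ?x = "SOME x. x \<in> C"
    have carr: "(\<Pi>\<^sub>E D\<in>components Q. carrier (?G D)) = {\<lambda>D\<in>components Q. \<one>\<^bsub>?G D\<^esub>}"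
      using triv by (simp add: trivial_group_def fundamental_group_def product_group_def)
    \<comment> \<open>Triviality is known only for the product of all components. The class of w is
      extended by the identity in every other coordinate.\<close>
    define f where "f = (\<lambda>D\<in>components Q. if D = C then homotopy_class Q I w else \<one>\<^bsub>?G D\<^esub>)"
    have "(\<lambda>D\<in>components Q. \<one>\<^bsub>?G D\<^esub>) \<in> (\<Pi>\<^sub>E D\<in>components Q. carrier (?G D))" using carr by simp
    then have "\<one>\<^bsub>?G D\<^esub> \<in> carrier (?G D)" if "D \<in> components Q" for D
      using that by (auto dest: PiE_mem)
    moreover have "homotopy_class Q I w \<in> carrier (?G C)" using w by (simp add: fundamental_group_at_def)
    ultimately have "f \<in> (\<Pi>\<^sub>E D\<in>components Q. carrier (?G D))" by (auto simp: f_def)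
    then have "f = (\<lambda>D\<in>components Q. \<one>\<^bsub>?G D\<^esub>)" using carr by simp
    then have "f C = \<one>\<^bsub>?G C\<^esub>" using C by simp
    then have "homotopy_class Q I w = homotopy_class Q I (?x, [])"
      using C by (simp add: f_def fundamental_group_at_def)
    moreover have "w \<in> homotopy_class Q I w"
      using w by (auto simp: loops_def homotopy_class_def intro: homotopic.refl)
    ultimately have "homotopic Q I (?x, []) w" by (simp add: homotopy_class_def)
    from homotopic_walk_weight[OF rel this] show ?thesis by (simp add: walk_weight_def)
  qed
  define comp where "comp v = {z. \<exists>w\<in>walks Q. psource w = v \<and> ptarget ?D w = z}" for v
  \<comment> \<open>This is the very point that \<open>fundamental_group\<close> picks in the
    component, so that loops through it are covered by the triviality.\<close>
  define base where "base v = (SOME x. x \<in> comp v)" for v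
  have comp_mem: "comp v \<in> components Q" "base v \<in> comp v" if v: "v \<in> verts Q" for v
  proof -
    show "comp v \<in> components Q"
      using quotientI[OF v, of "{(u, v). \<exists>w\<in>walks Q. psource w = u \<and> ptarget ?D w = v}"]
      by (simp add: components_def comp_def Image_def)
    have "(v, []) \<in> walks Q" using v by (simp add: double_quiver_def)
    then have "v \<in> comp v" by (auto simp: comp_def psource_def intro!: bexI[of _ "(v, [])"])
    then show "base v \<in> comp v" unfolding base_def by (rule someI)
  qed
  have "\<exists>w. (v, w) \<in> walks Q \<and> ptarget ?D (v, w) = base v" if v: "v \<in> verts Q" for v
  proof -
    obtain w where "w \<in> walks Q" "psource w = v" "ptarget ?D w = base v"
      using comp_mem(2)[OF v] by (auto simp: comp_def)
    then show ?thesis by (cases w) (auto simp: psource_def)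
  qed
  then obtain g where g: "\<And>v. v \<in> verts Q \<Longrightarrow> (v, g v) \<in> walks Q" "\<And>v. v \<in> verts Q \<Longrightarrow> ptarget ?D (v, g v) = base v"
    by metis
  have "l a = - walk_weight l (g (head Q a)) - - walk_weight l (g (tail Q a))" if a: "a \<in> arcs Q" for a
  proof -
    let ?t = "tail Q a" and ?h = "head Q a"
    have v: "?t \<in> verts Q" "?h \<in> verts Q" using a by auto
    have arc: "(?t, [(a, True)]) \<in> walks Q" "ptarget ?D (?t, [(a, True)]) = ?h"
      "(?h, [(a, False)]) \<in> walks Q" "ptarget ?D (?h, [(a, False)]) = ?t"
      using a v by (auto simp: paths_iff pre_digraph.cas.simps ptarget_def' double_quiver_def)
    have "comp s \<subseteq> comp r" if "(r, p) \<in> walks Q" "ptarget ?D (r, p) = s" for r s p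
    proof
      fix z assume "z \<in> comp s"
      then obtain w where "w \<in> walks Q" "psource w = s" "ptarget ?D w = z" by (auto simp: comp_def)
      then show "z \<in> comp r"
        unfolding comp_def using that pcomp_paths[of w ?D "(r, p)"] ptarget_pcomp[of ?D "(r, p)" w]
        by (intro CollectI bexI[of _ "pcomp w (r, p)"]) (auto simp: psource_def[of "(r, p)"])
    qed
    from this[OF arc(1,2)] this[OF arc(3,4)] have "comp ?t = comp ?h" by blast
    then have base: "base ?t = base ?h" by (simp add: base_def)
    let ?rt = "(base ?t, map (\<lambda>(a, s). (a, \<not> s)) (rev (g ?t)))"
    have rt: "?rt \<in> walks Q" "ptarget ?D ?rt = ?t"
      using bar_walk[OF Q I g(1)[OF v(1)]] g(2)[OF v(1)] by (auto simp: comp_def)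
    \<comment> \<open>The loop runs from the base point back to the tail of a, along a, and from the
      head of a to the base point again.\<close>
    define w where "w = pcomp (?h, g ?h) (pcomp (?t, [(a, True)]) ?rt)"
    have 1: "pcomp (?t, [(a, True)]) ?rt \<in> walks Q" "ptarget ?D (pcomp (?t, [(a, True)]) ?rt) = ?h"
      using pcomp_paths[OF arc(1) rt(1)] ptarget_pcomp[of ?D ?rt "(?t, [(a, True)])"] rt(2) arc(2)
      by (auto simp: psource_def)
    have "w \<in> walks Q" "ptarget ?D w = base ?h"
      unfolding w_def
      using pcomp_paths[OF g(1)[OF v(2)] 1(1)] ptarget_pcomp[of ?D _ "(?h, g ?h)"] 1(2) g(2)[OF v(2)]
      by (auto simp: psource_def)
    moreover have "psource w = base ?h" by (simp add: w_def psource_def pcomp_def base)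
    ultimately have "w \<in> loops Q (SOME x. x \<in> comp ?h)" by (simp add: loops_def base_def)
    then have "walk_weight l (snd w) = 0" using loop_weight comp_mem(1)[OF v(2)] by blast
    then show ?thesis
      by (simp add: w_def pcomp_def walk_weight_append walk_weight_reverse)
        (simp add: walk_weight_def algebra_simps)
  qed
  then show ?thesis by (intro exI[of _ "\<lambda>v. - walk_weight l (g v)"]) blast
qed

text \<open>The exponent n is allowed to depend on x here; finite dimension makes it uniform in
  \<open>Der_nilpotent_mod_Inn\<close>.\<close>

lemma (in derivation_presentation) inner_up_to_nilpotent:
  assumes sc: "\<And>I. admissible_presentation Q I \<Longrightarrow> trivial_group (fundamental_group Q I)"
  shows "\<exists>z. \<forall>x. \<exists>n. ((\<lambda>x. d x - (z * x - x * z)) ^^ n) x = 0"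
proof -
  obtain y' l where P: "presentation scale Q e y'" and l: "\<And>a. a \<in> arcs Q \<Longrightarrow> y' a \<in> gen_eigenspace (l a)"
    using eigen_arrows by blast
  interpret P: presentation scale Q e y' by (rule P)
  let ?W = "\<lambda>p. path_weight l (snd p)"
  have weight: "P.path_elem (u, as) \<in> gen_eigenspace (path_weight l as)" if "(u, as) \<in> paths Q" for u as
    using that
  proof (induction as arbitrary: u)
    case Nil
    then show ?case using e_gen_eigenspace by (simp add: path_weight_def)
  next
    case (Cons a as)
    then have a: "a \<in> arcs Q" "u = tail Q a" "(head Q a, as) \<in> paths Q" by (simp_all add: path_Cons)
    show ?case
      using gen_eigenspace_mult[OF Cons.IH[OF a(3)] l[OF a(1)]] P.path_elem_Cons[OF a(1)] a(2)
      by (simp add: path_weight_def add.commute)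
  qed
  \<comment> \<open>The homogeneous components of a relation are relations, so minimal relations are homogeneous.\<close>
  have rel: "?W p = ?W q"
    if r: "minimal_relation P.relations r" and p: "p \<in> Poly_Mapping.keys r" and q: "q \<in> Poly_Mapping.keys r" for r p q
  proof -
    let ?K = "Poly_Mapping.keys r" and ?c = "Poly_Mapping.lookup r"
    have rI: "?K \<subseteq> paths Q" "P.realise r = 0" using r by (auto simp: minimal_relation_def P.relations_def)
    define T where "T m = {p \<in> ?K. ?W p = m}" for m
    define h where "h m = (\<Sum>p\<in>T m. scale (?c p) (P.path_elem p))" for m
    have "h m \<in> gen_eigenspace m" for m
      unfolding h_def using rI(1) weight subspace_gen_eigenspace
      by (intro subspace_sum subspace_scale) (auto simp: T_def)
    moreover have "(\<Sum>m\<in>?W ` ?K. h m) = 0"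
    proof -
      have "(\<Sum>m\<in>?W ` ?K. h m) = (\<Sum>p\<in>?K. scale (?c p) (P.path_elem p))"
        unfolding h_def T_def by (rule sum.group) auto
      then show ?thesis using rI(2) by (simp add: P.realise_def)
    qed
    ultimately have "h (?W p) = 0"
      using gen_eigenspace_independent[of "?W ` ?K" h "?W p"] p by auto
    have TK: "T (?W p) \<subseteq> ?K" by (auto simp: T_def)
    let ?s = "\<Sum>p\<in>T (?W p). Poly_Mapping.single p (?c p)"
    have "P.realise ?s = h (?W p)" by (simp add: P.realise_sum P.realise_single h_def)
    moreover have "Poly_Mapping.keys ?s \<subseteq> paths Q"
      by (rule keys_sum_subset) (use TK rI(1) in auto)
    ultimately have "?s \<in> P.relations" using \<open>h (?W p) = 0\<close> by (simp add: P.relations_def)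
    moreover have "p \<in> T (?W p)" using p by (simp add: T_def)
    then have "T (?W p) \<noteq> {}" by blast
    ultimately have "\<not> T (?W p) \<subset> ?K" using r unfolding minimal_relation_def by blast
    then have "q \<in> T (?W p)" using TK q by blast
    then show ?thesis by (simp add: T_def)
  qed
  have adm: "admissible_presentation Q P.relations" by (rule P.admissible_presentation_relations)
  have "trivial_group (fundamental_group Q P.relations)" by (rule sc[OF adm])
  then obtain c where c: "\<And>a. a \<in> arcs Q \<Longrightarrow> l a = c (head Q a) - c (tail Q a)"
    using simply_connected_potential[of Q P.relations l] rel adm fin
    unfolding admissible_presentation_def admissible_ideal_def by metis
  define z where "z = (\<Sum>v\<in>verts Q. scale (c v) (e v))"
  define D where "D x = d x - (z * x - x * z)" for x
  \<comment> \<open>On the corner e_v A e_u the inner derivation of z is multiplication by c v - c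
    u, which by \<open>pw\<close> is the weight of each path from u to v.\<close>
  have D_corner: "(D ^^ n) (e v * x * e u) = (shift (c v - c u) ^^ n) (e v * x * e u)"
    if uv: "u \<in> verts Q" "v \<in> verts Q" for u v n x
  proof (induction n arbitrary: x)
    case (Suc n)
    have "z * e v = (\<Sum>w\<in>verts Q. if w = v then scale (c v) (e v) else 0)"
      unfolding z_def sum_distrib_right using uv by (intro sum.cong) (auto simp: scale_mult_left e_mult)
    then have zv: "z * e v = scale (c v) (e v)" using uv finite_verts by simp
    have "e u * z = (\<Sum>w\<in>verts Q. if w = u then scale (c u) (e u) else 0)"
      unfolding z_def sum_distrib_left using uv by (intro sum.cong) (auto simp: scale_mult_right e_mult)
    then have zu: "e u * z = scale (c u) (e u)" using uv finite_verts by simp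
    have 1: "z * (e v * x * e u) = scale (c v) (e v * x * e u)"
      by (simp add: mult.assoc[symmetric] zv scale_mult_left)
    have 2: "e v * x * e u * z = scale (c u) (e v * x * e u)"
      by (simp add: mult.assoc zu scale_mult_right)
    have "D (e v * x * e u) = shift (c v - c u) (e v * x * e u)"
      unfolding D_def 1 2 shift_def by (simp add: scale_left_diff_distrib)
    moreover have "shift (c v - c u) (e v * x * e u) = e v * shift (c v - c u) x * e u"
      by (simp add: shift_def d_corner uv right_diff_distrib left_diff_distrib scale_mult_left scale_mult_right)
    ultimately show ?case using Suc.IH[of "shift (c v - c u) x"]
      by (simp only: funpow_Suc_right comp_apply)
  qed simp
  have pw: "path_weight l as = c (ptarget Q (u, as)) - c u" if "(u, as) \<in> paths Q" for u as
    using that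
  proof (induction as arbitrary: u)
    case (Cons a as)
    then have a: "a \<in> arcs Q" "u = tail Q a" "(head Q a, as) \<in> paths Q" by (simp_all add: path_Cons)
    show ?case using Cons.IH[OF a(3)] c[OF a(1)] by (simp add: path_weight_def path_Cons(2) a(2))
  qed (simp add: path_weight_def)
  have D_path: "\<exists>n. (D ^^ n) (P.path_elem p) = 0" if p: "p \<in> paths Q" for p
  proof -
    define u v where "u = psource p" and "v = ptarget Q p"
    have uv: "u \<in> verts Q" "v \<in> verts Q" using path_verts[OF p] by (simp_all add: u_def v_def)
    have pe: "P.path_elem p = e v * P.path_elem p * e u"
      using P.path_elem_target[OF p uv(2)] P.path_elem_source[OF p uv(1)] by (simp add: u_def v_def)
    have "P.path_elem p \<in> gen_eigenspace (c v - c u)"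
      using weight[of "fst p" "snd p"] pw[of "fst p" "snd p"] p by (simp add: u_def v_def psource_def)
    then show ?thesis
      using D_corner[OF uv, of _ "P.path_elem p"] unfolding pe[symmetric] gen_eigenspace_def by auto
  qed
  have D_add: "D (x + w) = D x + D w" and D_scale: "D (scale b x) = scale b (D x)" for x w b
    by (simp_all add: D_def d_add d_scale distrib_left distrib_right scale_mult_left scale_mult_right
        scale_right_diff_distrib)
  interpret D: fd_operator scale Basis D by unfold_locales (rule D_add D_scale)+
  \<comment> \<open>The vectors killed by some power of D form a subspace, namely the generalised
    eigenspace of D for 0, so testing paths is enough.\<close>
  have "D.gen_eigenspace 0 = UNIV"
  proof -
    have "(\<lambda>x. D.shift 0 x) = D" by (simp add: D.shift_def)
    then have "P.path_elem p \<in> D.gen_eigenspace 0" if "p \<in> paths Q" for p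
      using D_path[OF that] by (simp add: D.gen_eigenspace_def)
    then have "span (P.path_elem ` paths Q) \<subseteq> D.gen_eigenspace 0"
      by (intro span_minimal D.subspace_gen_eigenspace) auto
    then show ?thesis using P.generated by auto
  qed
  then have "x \<in> D.gen_eigenspace 0" for x by simp
  moreover have "D.shift 0 = D" by (auto simp: D.shift_def)
  ultimately have "\<exists>n. (D ^^ n) x = 0" for x unfolding D.gen_eigenspace_def by simp
  then show ?thesis unfolding D_def by blast
qed

section \<open>Nilpotency of the first Hochschild cohomology\<close>

definition commutator :: "('a \<Rightarrow> 'a) \<Rightarrow> ('a \<Rightarrow> 'a) \<Rightarrow> 'a \<Rightarrow> 'a::ab_group_add"
  where "commutator f g = (\<lambda>x. f (g x) - g (f x))"

text \<open>The k-th iterated commutator is a combination of terms n^i f n^j with i + j = k, and for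
  k = 2 N one of the exponents reaches N. The induction carries extra powers of n on both sides,
  which spares writing out the combination.\<close>

lemma commutator_nilpotent:
  fixes n f :: "'a \<Rightarrow> 'a::ab_group_add"
  assumes add: "\<And>x z. n (x + z) = n x + n z" and nil: "\<And>x. (n ^^ N) x = 0"
    and f: "f 0 = 0"
  shows "(commutator n ^^ (2 * N)) f = (\<lambda>x. 0)"
proof -
  have diff: "(n ^^ i) (x - z) = (n ^^ i) x - (n ^^ i) z" for i x z
  proof -
    have "n (x - z) = n x - n z" for x z using add[of "x - z" z] by simp
    then show ?thesis by (induction i) simp_all
  qed
  have zero: "(n ^^ i) 0 = 0" for i using diff[of i 0 0] by simp
  have nil': "(n ^^ i) x = 0" if "N \<le> i" for i x
    using funpow_add[of "i - N" N n] that nil zero by simp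
  have "(n ^^ i) ((commutator n ^^ k) f ((n ^^ j) x)) = 0" if "2 * N \<le> i + j + k" for i j k x
    using that
  proof (induction k arbitrary: i j)
    case 0
    then have "N \<le> i \<or> N \<le> j" by linarith
    then show ?case using nil' zero f by auto
  next
    case (Suc k)
    let ?g = "(commutator n ^^ k) f"
    have "(n ^^ i) ((commutator n ^^ Suc k) f ((n ^^ j) x)) =
        (n ^^ Suc i) (?g ((n ^^ j) x)) - (n ^^ i) (?g ((n ^^ Suc j) x))"
      by (simp only: funpow.simps(2) comp_apply commutator_def[of n ?g] diff funpow_swap1[of n])
    also have "\<dots> = 0" using Suc.IH[of "Suc i" j] Suc.IH[of i "Suc j"] Suc.prems by simp
    finally show ?case .
  qed
  from this[of 0 0 "2 * N"] show ?thesis by auto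
qed

context algebra_over
begin

lemma vector_space_fun: "vector_space (\<lambda>c (f :: 'a \<Rightarrow> 'a) x. scale c (f x))"
  by unfold_locales (auto simp: plus_fun_def scale_right_distrib scale_left_distrib)

lemma lie_ideal_pair_Der: "lie_ideal_pair (\<lambda>c f x. scale c (f x)) Der Inn commutator"
proof -
  interpret V: vector_space "\<lambda>c (f :: 'a \<Rightarrow> 'a) x. scale c (f x)" by (rule vector_space_fun)
  show ?thesis
  proof
    show "V.subspace Der"
      using Der_zero Der_add Der_scale by (auto simp: V.subspace_def zero_fun_def plus_fun_def)
    show "V.subspace Inn"
      using Inn_zero Inn_add Inn_scale by (auto simp: V.subspace_def zero_fun_def plus_fun_def)
    show "commutator f g \<in> Der" if "f \<in> Der" "g \<in> Der" for f g
      unfolding commutator_def by (rule Der_bracket[OF that])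
    show "commutator f g \<in> Inn" if "f \<in> Der" "g \<in> Inn" for f g
      unfolding commutator_def by (rule Inn_bracket[OF that(2,1)])
  qed (use Inn_subset_Der in \<open>auto simp: commutator_def plus_fun_def zero_fun_def DerD scale_right_diff_distrib
      algebra_simps fun_eq_iff\<close>)
qed

text \<open>Inn is an ideal of Der, and [f, s] - [g, t] = [g, s - t] - [s, f - g]. Nilpotency of
  [n, -] thus passes, modulo Inn, to every d that differs from n by an inner derivation.\<close>

lemma commutator_funpow_Inn:
  assumes f: "f \<in> Der" "g \<in> Der" "(\<lambda>x. f x - g x) \<in> Inn" and h: "h \<in> Der"
  shows "(commutator f ^^ k) h \<in> Der \<and> (\<lambda>x. (commutator f ^^ k) h x - (commutator g ^^ k) h x) \<in> Inn"
proof (induction k)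
  case 0
  then show ?case using h Inn_zero by simp
next
  case (Suc k)
  define s t where "s = (commutator f ^^ k) h" and "t = (commutator g ^^ k) h"
  have s: "s \<in> Der" and st: "(\<lambda>x. s x - t x) \<in> Inn" using Suc by (simp_all add: s_def t_def)
  define p q where "p = (\<lambda>x. f x - g x)" and "q = (\<lambda>x. s x - t x)"
  have "(\<lambda>x. g (q x) - q (g x)) \<in> Inn" using Inn_bracket[OF st f(2)] by (simp add: q_def)
  moreover have "(\<lambda>x. s (p x) - p (s x)) \<in> Inn" using Inn_bracket[OF f(3) s] by (simp add: p_def)
  ultimately have "(\<lambda>x. (g (q x) - q (g x)) + - (s (p x) - p (s x))) \<in> Inn"
    using Inn_add Inn_minus by blast
  also have "(\<lambda>x. (g (q x) - q (g x)) + - (s (p x) - p (s x))) = (\<lambda>x. commutator f s x - commutator g t x)"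
    by (simp add: fun_eq_iff commutator_def p_def q_def DerD(4)[OF f(2)] DerD(4)[OF s])
  finally have "(\<lambda>x. commutator f s x - commutator g t x) \<in> Inn" .
  moreover have "commutator f s \<in> Der" unfolding commutator_def by (rule Der_bracket[OF f(1) s])
  ultimately show ?case by (simp add: s_def t_def)
qed

text \<open>Read downwards from its m-th term Der, the series \<open>ann Der\<close> is a central
  series modulo Inn. Its images contain the lower central series of HH1 term by term and end in the
  zero class.\<close>

lemma nilpotent_HH1I:
  assumes "lie_ideal_pair.ann Der Inn commutator Der m = Der"
  shows "nilpotent_lie_algebra HH1"
proof -
  interpret P: lie_ideal_pair "\<lambda>c f x. scale c (f x)" Der Inn commutator by (rule lie_ideal_pair_Der)
  have span: "lie_span HH1 S \<subseteq> outer_class ` P.ann Der j" if S: "S \<subseteq> outer_class ` P.ann Der j" for S j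
  proof
    note sub = P.subspace_ann[OF order_refl, of j] and Der = P.ann_subset[of Der j]
    fix x assume "x \<in> lie_span HH1 S"
    then show "x \<in> outer_class ` P.ann Der j"
    proof (induction rule: lie_span.induct)
      case zero
      have "(\<lambda>x. 0) \<in> P.ann Der j" using P.subspace_0[OF sub] by (simp add: zero_fun_def)
      then show ?case by (simp add: HH1_zero)
    next
      case (base x)
      then show ?case using S by blast
    next
      case (add x z)
      then obtain f g where fg: "f \<in> P.ann Der j" "g \<in> P.ann Der j" "x = outer_class f" "z = outer_class g" by blast
      then have "lie_add HH1 x z = outer_class (\<lambda>x. f x + g x)" using HH1_add Der by blast
      moreover have "(\<lambda>x. f x + g x) \<in> P.ann Der j" using P.subspace_add[OF sub fg(1,2)] by (simp add: plus_fun_def)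
      ultimately show ?case by simp
    next
      case (scale x c)
      then obtain f where f: "f \<in> P.ann Der j" "x = outer_class f" by blast
      then have "lie_scale HH1 c x = outer_class (\<lambda>x. scale c (f x))" using HH1_scale by simp
      then show ?case using P.subspace_scale[OF sub f(1), of c] by simp
    qed
  qed
  have lcs: "lower_central_series HH1 n \<subseteq> outer_class ` P.ann Der (m - n)" if "n \<le> m" for n
    using that
  proof (induction n)
    case 0
    then show ?case using assms by (simp add: HH1_carrier)
  next
    case (Suc n)
    have mn: "m - n = Suc (m - Suc n)" using Suc.prems by simp
    have "lie_bracket HH1 x z \<in> outer_class ` P.ann Der (m - Suc n)"
      if "x \<in> lie_carrier HH1" "z \<in> lower_central_series HH1 n" for x z
    proof -
      obtain f where f: "f \<in> Der" "x = outer_class f" using \<open>x \<in> lie_carrier HH1\<close> by (auto simp: HH1_carrier)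
      obtain g where g: "g \<in> P.ann Der (Suc (m - Suc n))" "z = outer_class g"
        using Suc.IH Suc.prems \<open>z \<in> lower_central_series HH1 n\<close> unfolding mn by auto
      then have "g \<in> Der" "commutator f g \<in> P.ann Der (m - Suc n)" using f(1) by auto
      then show ?thesis using HH1_bracket[OF f(1), of g] f(2) g(2) by (simp add: commutator_def)
    qed
    then show ?case by (simp only: lower_central_series.simps) (rule span, blast)
  qed
  have "outer_class f = Inn" if "f \<in> Inn" for f
    using outer_class_eqI[of f "\<lambda>x. 0"] that by (simp add: Inn_eq)
  then have "lower_central_series HH1 m \<subseteq> {lie_zero HH1}"
    using lcs[of m] by (auto simp: HH1_def)
  moreover have "lie_zero HH1 \<in> lower_central_series HH1 m"
    using lie_algebra.zero_closed[OF lie_algebra_HH1] by (cases m) (auto intro: lie_span.zero)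
  ultimately show ?thesis unfolding nilpotent_lie_algebra_def using lie_algebra_HH1 by blast
qed

end

context fin_dim_algebra
begin

text \<open>Derivations are linear, so the matrix units E of a basis span them. Finiteness is stated
  relative to Der because the ambient space consists of all maps on the algebra.\<close>

lemma Der_span_finite:
  "\<exists>T. finite T \<and> Der \<subseteq> module.span (\<lambda>c (f :: 'b \<Rightarrow> 'b) x. scale c (f x)) T"
proof -
  interpret V: vector_space "\<lambda>c (f :: 'b \<Rightarrow> 'b) x. scale c (f x)" by (rule vector_space_fun)
  obtain B where "finite_dimensional_vector_space scale B" using finite_dimensional by blast
  then interpret F: finite_dimensional_vector_space scale B .
  define E where "E = (\<lambda>(b, b') x. scale (representation B x b) b')"
  have sum_apply: "(\<Sum>i\<in>A. g i) x = (\<Sum>i\<in>A. g i x)" for g :: "'b \<times> 'b \<Rightarrow> 'b \<Rightarrow> 'b" and A x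
    by (induction A rule: infinite_finite_induct) (simp_all add: plus_fun_def zero_fun_def)
  have rep: "x = (\<Sum>b\<in>B. scale (representation B x b) b)" for x
    using sum_representation_eq[OF F.independent_Basis, of x B] F.span_Basis F.finite_Basis by simp
  have "f \<in> V.span (E ` (B \<times> B))" if f: "f \<in> Der" for f
  proof -
    have f_sum: "f (sum g A) = (\<Sum>a\<in>A. f (g a))" for g :: "'b \<Rightarrow> 'b" and A
      by (induction A rule: infinite_finite_induct) (simp_all add: DerD[OF f])
    have "f x = (\<Sum>i\<in>B \<times> B. (\<lambda>x. scale (representation B (f (fst i)) (snd i)) (E i x))) x" for x
    proof -
      have "f x = (\<Sum>b\<in>B. scale (representation B x b) (f b))"
        by (subst rep[of x]) (simp only: f_sum DerD(2)[OF f])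
      also have "\<dots> = (\<Sum>b\<in>B. \<Sum>b'\<in>B. scale (representation B x b * representation B (f b) b') b')"
        by (rule sum.cong[OF HOL.refl], subst rep[of "f _"]) (simp only: scale_sum_right scale_scale)
      also have "\<dots> = (\<Sum>i\<in>B \<times> B. scale (representation B (f (fst i)) (snd i)) (E i x))"
        unfolding sum.cartesian_product by (rule sum.cong) (auto simp: E_def mult.commute)
      finally show ?thesis by (simp only: sum_apply)
    qed
    then have "f = (\<Sum>i\<in>B \<times> B. (\<lambda>x. scale (representation B (f (fst i)) (snd i)) (E i x)))" by (rule ext)
    also have "\<dots> \<in> V.span (E ` (B \<times> B))"
      by (intro V.span_sum V.span_scale V.span_base) auto
    finally show ?thesis .
  qed
  then show ?thesis using F.finite_Basis by (intro exI[of _ "E ` (B \<times> B)"]) auto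
qed

end

section \<open>Derivations of a simply connected algebra modulo inner ones\<close>

locale simply_connected_presentation = fd_presentation scale Q e y
  for scale :: "'k::alg_closed_field \<Rightarrow> 'a::{ring, monoid_mult} \<Rightarrow> 'a"
    and Q :: "('v, 'e) pre_digraph" and e y +
  assumes acyclic: "acyclic_quiver Q"
    and trivial_fundamental_group:
      "\<And>I. admissible_presentation Q I \<Longrightarrow> trivial_group (fundamental_group Q I)"
begin

text \<open>The span of the \<open>e v\<close> is a separable subalgebra with separability
  idempotent the sum of all e_v \<otimes> e_v, whence the witness z. The check uses e_u d(e_v) =
  d(e_u e_v) - d(e_u) e_v and that the \<open>e v\<close> sum to 1.\<close>

lemma Der_inner_on_e:
  assumes d: "d \<in> Der"
  shows "\<exists>z. \<forall>v\<in>verts Q. d (e v) = z * e v - e v * z"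
proof (intro exI ballI)
  let ?z = "\<Sum>v\<in>verts Q. d (e v) * e v"
  fix u assume u: "u \<in> verts Q"
  have "?z * e u = (\<Sum>v\<in>verts Q. if v = u then d (e u) * e u else 0)"
    unfolding sum_distrib_right using u by (intro sum.cong) (auto simp: mult.assoc e_mult)
  then have 1: "?z * e u = d (e u) * e u" using u finite_verts by simp
  have "e u * ?z = (\<Sum>v\<in>verts Q. (if v = u then d (e u) * e u else 0) - d (e u) * e v)"
    unfolding sum_distrib_left
  proof (rule sum.cong)
    fix v assume v: "v \<in> verts Q"
    have "e u * d (e v) = d (e u * e v) - d (e u) * e v" using DerD(3)[OF d, of "e u" "e v"] by simp
    then have "e u * (d (e v) * e v) = d (e u * e v) * e v - d (e u) * e v * e v"
      by (simp only: mult.assoc[symmetric] left_diff_distrib)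
    also have "d (e u) * e v * e v = d (e u) * e v" by (rule e_e_right[OF v])
    finally show "e u * (d (e v) * e v) = (if v = u then d (e u) * e u else 0) - d (e u) * e v"
      using e_mult[OF u v] DerD(5)[OF d] by auto
  qed simp
  also have "\<dots> = d (e u) * e u - d (e u) * (\<Sum>v\<in>verts Q. e v)"
    using u finite_verts by (simp add: sum_subtractf sum_distrib_left)
  finally show "d (e u) = ?z * e u - e u * ?z" by (simp add: 1 e_sum)
qed

text \<open>Two inner derivations are subtracted: the one of z makes d vanish on the vertices, and
  the one of w removes the eigenvalues.\<close>

lemma Der_nilpotent_mod_Inn:
  assumes d: "d \<in> Der"
  shows "\<exists>n\<in>Der. (\<lambda>x. d x - n x) \<in> Inn \<and> (\<exists>N. \<forall>x. (n ^^ N) x = 0)"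
proof -
  obtain z where z: "\<And>v. v \<in> verts Q \<Longrightarrow> d (e v) = z * e v - e v * z" using Der_inner_on_e[OF d] by blast
  have inn: "(\<lambda>x. a * x - x * a) \<in> Inn" for a by (auto simp: Inn_def)
  have sub: "(\<lambda>x. f x - g x) \<in> Der" if "f \<in> Der" "g \<in> Inn" for f g
    using Der_add[OF that(1), of "\<lambda>x. - g x"] Inn_minus[OF that(2)] Inn_subset_Der by auto
  define d0 where "d0 = (\<lambda>x. d x - (z * x - x * z))"
  have d0: "d0 \<in> Der" unfolding d0_def by (rule sub[OF d inn])
  obtain B where "finite_dimensional_vector_space scale B" using finite_dimensional by blast
  then interpret F: finite_dimensional_vector_space scale B .
  interpret D: derivation_presentation scale Q e y B d0
    by unfold_locales (use DerD[OF d0] acyclic z in \<open>auto simp: d0_def\<close>)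
  obtain w where w: "\<And>x. \<exists>n. ((\<lambda>x. d0 x - (w * x - x * w)) ^^ n) x = 0"
    using D.inner_up_to_nilpotent[OF trivial_fundamental_group] by blast
  define n where "n = (\<lambda>x. d0 x - (w * x - x * w))"
  have n: "n \<in> Der" unfolding n_def by (rule sub[OF d0 inn])
  have add: "(n ^^ k) (x + x') = (n ^^ k) x + (n ^^ k) x'" and scale: "(n ^^ k) (scale c x) = scale c ((n ^^ k) x)"
    for k c x x' by (induction k) (simp_all add: DerD[OF n])
  have zero: "(n ^^ k) 0 = 0" for k by (induction k) (simp_all add: DerD[OF n])
  obtain N where N: "\<And>x. (n ^^ N x) x = 0" using w unfolding n_def by metis
  \<comment> \<open>M dominates the exponents of all basis vectors, so by linearity the M-th power
    of n vanishes everywhere.\<close>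
  define M where "M = (\<Sum>b\<in>B. N b)"
  have "(n ^^ M) b = 0" if "b \<in> B" for b
  proof -
    have "N b \<le> M" unfolding M_def using that F.finite_Basis by (intro member_le_sum) auto
    then show ?thesis using funpow_add[of "M - N b" "N b" n] N[of b] zero by simp
  qed
  moreover have "subspace {x. (n ^^ M) x = 0}" by (auto simp: subspace_def add scale zero)
  ultimately have "span B \<subseteq> {x. (n ^^ M) x = 0}" by (intro span_minimal) auto
  then have "\<forall>x. (n ^^ M) x = 0" using F.span_Basis by auto
  moreover have "(\<lambda>x. d x - n x) \<in> Inn"
    using Inn_add[OF inn[of z] inn[of w]] by (simp add: n_def d0_def algebra_simps)
  ultimately show ?thesis using n by blast
qed

lemma nilpotent_HH1: "nilpotent_lie_algebra HH1"
proof -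
  interpret P: lie_ideal_pair "\<lambda>c f x. scale c (f x)" Der Inn commutator by (rule lie_ideal_pair_Der)
  obtain T where T: "finite T" "Der \<subseteq> P.span T" using Der_span_finite by blast
  have "\<exists>N. \<forall>f\<in>Der. (commutator d ^^ N) f \<in> Inn" if d: "d \<in> Der" for d
  proof -
    obtain n N where n: "n \<in> Der" "(\<lambda>x. d x - n x) \<in> Inn" "\<And>x. (n ^^ N) x = 0"
      using Der_nilpotent_mod_Inn[OF d] by blast
    \<comment> \<open>The exponent 2 N comes from \<open>commutator_nilpotent\<close>: that power of
      [n, -] is exactly 0 on f, and the one of [d, -] differs from it by an inner
      derivation.\<close>
    have "(commutator d ^^ (2 * N)) f \<in> Inn" if f: "f \<in> Der" for f
      using commutator_funpow_Inn[OF d n(1,2) f, of "2 * N"]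
        commutator_nilpotent[of n N f, OF DerD(1)[OF n(1)] n(3) DerD(5)[OF f]] by simp
    then show ?thesis by blast
  qed
  from P.engel_mod_ideal[OF T this] obtain m where "P.ann Der m = Der" by blast
  then show ?thesis by (rule nilpotent_HH1I)
qed

end

theorem theorem5:
  fixes scale :: "'k::alg_closed_field \<Rightarrow> 'a::{ring, monoid_mult} \<Rightarrow> 'a"
  assumes "fin_dim_algebra scale"
    and "algebra_over.simply_connected scale"
  shows "nilpotent_lie_algebra (algebra_over.HH1 scale)"
proof -
  interpret A: fin_dim_algebra scale by (rule assms(1))
  obtain Q :: "(nat, nat) pre_digraph" and I where Q: "A.admissible_presentation Q I"
    and triangular: "A.triangular"
    and sc: "\<And>I. A.admissible_presentation Q I \<Longrightarrow> trivial_group (fundamental_group Q I)"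
    using assms(2) unfolding A.simply_connected_def by blast
  obtain e y where "presentation scale Q e y" using A.admissible_presentationD[OF Q] by blast
  then interpret P: presentation scale Q e y .
  interpret P: fd_presentation scale Q e y ..
  interpret P: simply_connected_presentation scale Q e y
    by unfold_locales (rule P.acyclic_if_triangular[OF triangular], rule sc)
  show ?thesis by (rule P.nilpotent_HH1)
qed

end
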